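(* The assignment $Y\mapsto\Lambda(Y)$ to spans of spans preserves vertical composition strictly: if $X_1,X_2,X_3$ are spans of essentially finite groupoids from $A_1$ to $A_2$, and $Y:X_1\to X_2$ and $Y':X_2\to X_3$ are (strictly commuting) spans of span maps, with vertical composite $Y'\circ Y:X_1\to X_3$, then $$\Lambda(Y'\circ Y)=\Lambda(Y')\circ\Lambda(Y)$$ as natural transformations $\Lambda(X_1)\Rightarrow\Lambda(X_3)$.
   Context: Vect is the category of finite-dimensional complex vector spaces; a groupoid is essentially finite if it is equivalent to a finite groupoid; $[A,\mathrm{Vect}]$ is the category of functors $A\to\mathrm{Vect}$. All groupoids are essentially finite. For a functor $f:B\to A$, $f^*F=F\circ f$, and $f_*:[B,\mathrm{Vect}]\to[A,\mathrm{Vect}]$ is the colimit of $G$ over the comma category $(f\downarrow a)$; explicitly $$(f_*G)(a)=\bigoplus_{[b]\,:\,f(b)\cong a}\mathbb{C}[\hom(f(b),a)]\otimes_{\mathbb{C}[\mathrm{Aut}(b)]}G(b),$$ the sum over isomorphism classes of $b\in B$ with $f(b)\cong a$ (choosing an isomorphism $f(b)\cong a$ turns $\mathbb{C}[\hom(f(b),a)]$ into $\mathbb{C}[\mathrm{Aut}(a)]$). The functor $f_*$ is both left and right adjoint to $f^*$. The left counit $\epsilon_{L,f}:f_*f^*\Rightarrow\mathrm{Id}$ is $\bigoplus_{[b]}g_b\otimes v_b\mapsto\sum_{[b]}F(g_b)(v_b)$, and the right unit $\eta_{R,f}:\mathrm{Id}\Rightarrow f_*f^*$ is $$\eta_{R,f}(F)(a):v\mapsto\bigoplus_{[b]:f(b)\cong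 a}\frac{1}{\#\mathrm{Aut}(b)}\sum_{g\in\hom(a,f(b))}g^{-1}\otimes F(g)(v).$$ Canonically $(fg)^*=g^*f^*$ and $(fg)_*\cong f_*g_*$. A span $A_1\xleftarrow{s_i}X_i\xrightarrow{t_i}A_2$ has $\Lambda(X_i)=(t_i)_*\circ s_i^*$. A span of span maps $Y:X_1\to X_2$ is a span $X_1\xleftarrow{s}Y\xrightarrow{t}X_2$ with natural isomorphisms $\zeta_s:s_1s\to s_2t$ and $\zeta_t:t_1s\to t_2t$; it is strictly commuting if these are identities. $\Lambda(Y)$ is the composite $$(t_1)_*s_1^*\Rightarrow(t_1)_*s_*s^*s_1^*\cong(t_2)_*t_*t^*s_2^*\Rightarrow(t_2)_*s_2^*$$ of $\eta_{R,s}$, the isomorphism induced by $\zeta_t$ and $\zeta_s$ (the canonical identification when $Y$ commutes strictly), and $\epsilon_{L,t}$. The vertical composite $Y'\circ Y$ of $X_1\xleftarrow{s}Y\xrightarrow{t}X_2$ and $X_2\xleftarrow{s'}Y'\xrightarrow{t'}X_3$ is $X_1\xleftarrow{s\circ S}Y'\circ Y\xrightarrow{t'\circ T}X_3$, where the groupoid $Y'\circ Y$ is the weak pullback over $X_2$: objects are triples $(y,g,y')$ with $g:t(y)\to s'(y')$ in $X_2$, morphisms are pairs of morphisms of $Y$ and $Y'$ making the evident square commute, and $S,T$ are the projections to $Y,Y'$. Its natural isomorphisms to $A_1$ and $A_2$ are those induced by the tautological isomorphism $g:tS\Rightarrow s'T$, namely $s_2(g):s_1sS=s_2tS\to s_2s'T=s_3t'T$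 and $t_2(g):t_1sS=t_2tS\to t_2s'T=t_3t'T$. *)

theory Defs
  imports "HOL-Algebra.AbelCoset" "Jordan_Normal_Form.VS_Connect"
begin

section \<open>Categories, functors, groupoids\<close>

record ('o, 'm) category =
  Obj :: "'o set"
  Arr :: "'m set"
  Dom :: "'m \<Rightarrow> 'o"
  Cod :: "'m \<Rightarrow> 'o"
  Ident :: "'o \<Rightarrow> 'm"
  Comp :: "'m \<Rightarrow> 'm \<Rightarrow> 'm"  \<comment> \<open>\<open>Comp C g f\<close> is \<open>g\<close> after \<open>f\<close>\<close>

definition homs :: "('o, 'm) category \<Rightarrow> 'o \<Rightarrow> 'o \<Rightarrow> 'm set" where
  "homs C x y = {f \<in> Arr C. Dom C f = x \<and> Cod C f = y}"

locale category =
  fixes C :: "('o, 'm) category"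
  assumes dom_obj: "f \<in> Arr C \<Longrightarrow> Dom C f \<in> Obj C"
    and cod_obj: "f \<in> Arr C \<Longrightarrow> Cod C f \<in> Obj C"
    and ident_hom: "x \<in> Obj C \<Longrightarrow> Ident C x \<in> homs C x x"
    and comp_hom: "\<lbrakk>f \<in> homs C x y; g \<in> homs C y z\<rbrakk> \<Longrightarrow> Comp C g f \<in> homs C x z"
    and comp_ident_right: "f \<in> homs C x y \<Longrightarrow> Comp C f (Ident C x) = f"
    and comp_ident_left: "f \<in> homs C x y \<Longrightarrow> Comp C (Ident C y) f = f"
    and comp_assoc:
      "\<lbrakk>f \<in> homs C w x; g \<in> homs C x y; h \<in> homs C y z\<rbrakk>
        \<Longrightarrow> Comp C h (Comp C g f) = Comp C (Comp C h g) f"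

definition inverse_arrows :: "('o, 'm) category \<Rightarrow> 'm \<Rightarrow> 'm \<Rightarrow> bool" where
  "inverse_arrows C f g \<longleftrightarrow> f \<in> Arr C \<and> g \<in> homs C (Cod C f) (Dom C f) \<and>
     Comp C g f = Ident C (Dom C f) \<and> Comp C f g = Ident C (Cod C f)"

definition iso_arrow :: "('o, 'm) category \<Rightarrow> 'm \<Rightarrow> bool" where
  "iso_arrow C f \<longleftrightarrow> (\<exists>g. inverse_arrows C f g)"

definition inv_arrow :: "('o, 'm) category \<Rightarrow> 'm \<Rightarrow> 'm" where
  "inv_arrow C f = (THE g. inverse_arrows C f g)"

locale groupoid = category +
  assumes arr_iso: "f \<in> Arr C \<Longrightarrow> iso_arrow C f"

definition auts :: "('o, 'm) category \<Rightarrow> 'o \<Rightarrow> 'm set" where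
  "auts C x = {f \<in> homs C x x. iso_arrow C f}"

definition iso_rel :: "('o, 'm) category \<Rightarrow> ('o \<times> 'o) set" where
  "iso_rel C = {(x, y). x \<in> Obj C \<and> y \<in> Obj C \<and> (\<exists>f \<in> homs C x y. iso_arrow C f)}"

record ('o, 'm, 'p, 'n) ftor =
  omap :: "'o \<Rightarrow> 'p"
  amap :: "'m \<Rightarrow> 'n"

locale cat_functor = S?: category C + T?: category D
  for C :: "('o, 'm) category" and D :: "('p, 'n) category" +
  fixes f :: "('o, 'm, 'p, 'n) ftor"
  assumes obj: "x \<in> Obj C \<Longrightarrow> omap f x \<in> Obj D"
    and arr: "h \<in> homs C x y \<Longrightarrow> amap f h \<in> homs D (omap f x) (omap f y)"
    and ident: "x \<in> Obj C \<Longrightarrow> amap f (Ident C x) = Ident D (omap f x)"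
    and comp: "\<lbrakk>h \<in> homs C x y; k \<in> homs C y z\<rbrakk>
      \<Longrightarrow> amap f (Comp C k h) = Comp D (amap f k) (amap f h)"

definition fcomp :: "('p, 'n, 'q, 'l) ftor \<Rightarrow> ('o, 'm, 'p, 'n) ftor \<Rightarrow> ('o, 'm, 'q, 'l) ftor"
    (infixl \<open>\<circ>\<^sub>F\<close> 60) where
  "g \<circ>\<^sub>F f = \<lparr>omap = omap g \<circ> omap f, amap = amap g \<circ> amap f\<rparr>"

definition fident :: "('o, 'm, 'o, 'm) ftor" where
  "fident = \<lparr>omap = id, amap = id\<rparr>"

definition nat_iso :: "('o, 'm) category \<Rightarrow> ('p, 'n) category \<Rightarrow>
    ('o, 'm, 'p, 'n) ftor \<Rightarrow> ('o, 'm, 'p, 'n) ftor \<Rightarrow> ('o \<Rightarrow> 'n) \<Rightarrow> bool" where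
  "nat_iso C D f g \<theta> \<longleftrightarrow>
     (\<forall>x \<in> Obj C. \<theta> x \<in> homs D (omap f x) (omap g x) \<and> iso_arrow D (\<theta> x)) \<and>
     (\<forall>h \<in> Arr C. Comp D (\<theta> (Cod C h)) (amap f h) = Comp D (amap g h) (\<theta> (Dom C h)))"

definition equivalent_cats :: "('o, 'm) category \<Rightarrow> ('p, 'n) category \<Rightarrow> bool" where
  "equivalent_cats C D \<longleftrightarrow> (\<exists>f g \<eta> \<epsilon>. cat_functor C D f \<and> cat_functor D C g \<and>
     nat_iso C C fident (g \<circ>\<^sub>F f) \<eta> \<and> nat_iso D D (f \<circ>\<^sub>F g) fident \<epsilon>)"

text \<open>Every finite groupoid is isomorphic to one whose objects and arrows are natural numbers,
  so fixing the types of the finite groupoid below loses nothing.\<close>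

definition ess_finite_groupoid :: "('o, 'm) category \<Rightarrow> bool" where
  "ess_finite_groupoid C \<longleftrightarrow> groupoid C \<and>
     (\<exists>K :: (nat, nat) category.
        groupoid K \<and> finite (Obj K) \<and> finite (Arr K) \<and> equivalent_cats C K)"


section \<open>Vector spaces, direct sums, quotients\<close>

text \<open>The fields \<open>mult\<close> and \<open>one\<close>, which a module record inherits from rings, carry no
  information for a vector space.\<close>

type_synonym 'v vect = "(complex, 'v) module"

definition direct_sum_space :: "'i set \<Rightarrow> ('i \<Rightarrow> 'v vect) \<Rightarrow> ('i \<Rightarrow> 'v) vect" where
  "direct_sum_space I V = \<lparr>
     carrier = {x \<in> (\<Pi>\<^sub>E i\<in>I. carrier (V i)). finite {i \<in> I. x i \<noteq> \<zero>\<^bsub>V i\<^esub>}},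
     mult = undefined, one = undefined,
     zero = (\<lambda>i\<in>I. \<zero>\<^bsub>V i\<^esub>),
     add = (\<lambda>x y. \<lambda>i\<in>I. x i \<oplus>\<^bsub>V i\<^esub> y i),
     smult = (\<lambda>c x. \<lambda>i\<in>I. c \<odot>\<^bsub>V i\<^esub> x i)\<rparr>"

definition direct_sum_incl :: "'i set \<Rightarrow> ('i \<Rightarrow> 'v vect) \<Rightarrow> 'i \<Rightarrow> 'v \<Rightarrow> ('i \<Rightarrow> 'v)" where
  "direct_sum_incl I V j v = (\<lambda>i\<in>I. if i = j then v else \<zero>\<^bsub>V i\<^esub>)"

definition quotient_space :: "'v vect \<Rightarrow> 'v set \<Rightarrow> 'v set vect" where
  "quotient_space V N = \<lparr>
     carrier = a_rcosets\<^bsub>V\<^esub> N,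
     mult = undefined, one = undefined,
     zero = N,
     add = set_add V,
     smult = (\<lambda>c X. \<Union>x\<in>X. N +>\<^bsub>V\<^esub> (c \<odot>\<^bsub>V\<^esub> x))\<rparr>"


section \<open>Functors to finite-dimensional vector spaces and their colimits\<close>

text \<open>A morphism of vector spaces is a function that matters only on the carrier of its source;
  hence the laws below, and equality of natural transformations, are required only on carriers.
  The type \<open>'v\<close> that holds the vectors is arbitrary.\<close>

type_synonym ('o, 'm, 'v) vfunctor = "('o, 'm, 'v vect, 'v \<Rightarrow> 'v) ftor"

definition vect_functor :: "('o, 'm) category \<Rightarrow> ('o, 'm, 'v) vfunctor \<Rightarrow> bool" where
  "vect_functor C F \<longleftrightarrow>
     (\<forall>x \<in> Obj C. vectorspace class_ring (omap F x) \<and>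
        vectorspace.fin_dim class_ring (omap F x)) \<and>
     (\<forall>h \<in> Arr C. linear_map class_ring (omap F (Dom C h)) (omap F (Cod C h)) (amap F h)) \<and>
     (\<forall>x \<in> Obj C. \<forall>v \<in> carrier (omap F x). amap F (Ident C x) v = v) \<and>
     (\<forall>h \<in> Arr C. \<forall>k \<in> Arr C. Cod C h = Dom C k \<longrightarrow>
        (\<forall>v \<in> carrier (omap F (Dom C h)). amap F (Comp C k h) v = amap F k (amap F h v)))"

text \<open>The colimit of \<open>D\<close> is the direct sum of its values modulo the span of all differences
  between \<open>v\<close> in the summand of the source and its image in the summand of the target.\<close>

definition colim_sum :: "('j, 'k) category \<Rightarrow> ('j, 'k, 'v) vfunctor \<Rightarrow> ('j \<Rightarrow> 'v) vect" where
  "colim_sum J D = direct_sum_space (Obj J) (omap D)"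

definition colim_rel :: "('j, 'k) category \<Rightarrow> ('j, 'k, 'v) vfunctor \<Rightarrow> ('j \<Rightarrow> 'v) set" where
  "colim_rel J D = LinearCombinations.module.span class_ring (colim_sum J D)
     {direct_sum_incl (Obj J) (omap D) (Cod J h) (amap D h v)
        \<ominus>\<^bsub>colim_sum J D\<^esub> direct_sum_incl (Obj J) (omap D) (Dom J h) v
      | h v. h \<in> Arr J \<and> v \<in> carrier (omap D (Dom J h))}"

definition colim :: "('j, 'k) category \<Rightarrow> ('j, 'k, 'v) vfunctor \<Rightarrow> ('j \<Rightarrow> 'v) set vect" where
  "colim J D = quotient_space (colim_sum J D) (colim_rel J D)"

definition colim_incl ::
    "('j, 'k) category \<Rightarrow> ('j, 'k, 'v) vfunctor \<Rightarrow> 'j \<Rightarrow> 'v \<Rightarrow> ('j \<Rightarrow> 'v) set" where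
  "colim_incl J D j v =
     colim_rel J D +>\<^bsub>colim_sum J D\<^esub> direct_sum_incl (Obj J) (omap D) j v"

text \<open>The map out of the colimit induced by a cocone \<open>\<phi>\<close> with vertex \<open>W\<close>.\<close>

definition colim_desc :: "('j, 'k) category \<Rightarrow> ('j, 'k, 'v) vfunctor \<Rightarrow> 'w vect \<Rightarrow>
    ('j \<Rightarrow> 'v \<Rightarrow> 'w) \<Rightarrow> ('j \<Rightarrow> 'v) set \<Rightarrow> 'w" where
  "colim_desc J D W \<phi> X =
     the_elem ((\<lambda>x. \<Oplus>\<^bsub>W\<^esub> j \<in> {j \<in> Obj J. x j \<noteq> \<zero>\<^bsub>omap D j\<^esub>}. \<phi> j (x j)) ` X)"


section \<open>Pushforward along a functor\<close>

text \<open>The comma category of \<open>f\<close> over the object \<open>a\<close>; an arrow carries its source, the underlying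
  arrow of \<open>B\<close>, and its target.\<close>

definition comma :: "('b, 'm) category \<Rightarrow> ('a, 'n) category \<Rightarrow> ('b, 'm, 'a, 'n) ftor \<Rightarrow> 'a \<Rightarrow>
    ('b \<times> 'n, ('b \<times> 'n) \<times> 'm \<times> ('b \<times> 'n)) category" where
  "comma B A f a = \<lparr>
     Obj = {(b, g). b \<in> Obj B \<and> g \<in> homs A (omap f b) a},
     Arr = {((b, g), h, (b', g')). b \<in> Obj B \<and> g \<in> homs A (omap f b) a \<and>
              b' \<in> Obj B \<and> g' \<in> homs A (omap f b') a \<and>
              h \<in> homs B b b' \<and> Comp A g' (amap f h) = g},
     Dom = (\<lambda>(p, h, q). p),
     Cod = (\<lambda>(p, h, q). q),
     Ident = (\<lambda>(b, g). ((b, g), Ident B b, (b, g))),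
     Comp = (\<lambda>(p', h', q') (p, h, q). (p, Comp B h' h, q'))\<rparr>"

definition comma_proj :: "('b \<times> 'n, ('b \<times> 'n) \<times> 'm \<times> ('b \<times> 'n), 'b, 'm) ftor" where
  "comma_proj = \<lparr>omap = fst, amap = (\<lambda>(p, h, q). h)\<rparr>"

definition push_obj :: "('b, 'm) category \<Rightarrow> ('a, 'n) category \<Rightarrow> ('b, 'm, 'a, 'n) ftor \<Rightarrow>
    ('b, 'm, 'v) vfunctor \<Rightarrow> 'a \<Rightarrow> ('b \<times> 'n \<Rightarrow> 'v) set vect" where
  "push_obj B A f G a = colim (comma B A f a) (G \<circ>\<^sub>F comma_proj)"

text \<open>\<open>push_incl B A f G a b g v\<close> is the class of \<open>g \<otimes> v\<close>, for \<open>g : f b \<rightarrow> a\<close> and \<open>v\<close> in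
  \<open>G b\<close>; the relations of the colimit read \<open>g' f(h) \<otimes> v = g' \<otimes> G(h) v\<close>.\<close>

definition push_incl :: "('b, 'm) category \<Rightarrow> ('a, 'n) category \<Rightarrow> ('b, 'm, 'a, 'n) ftor \<Rightarrow>
    ('b, 'm, 'v) vfunctor \<Rightarrow> 'a \<Rightarrow> 'b \<Rightarrow> 'n \<Rightarrow> 'v \<Rightarrow> ('b \<times> 'n \<Rightarrow> 'v) set" where
  "push_incl B A f G a b g v = colim_incl (comma B A f a) (G \<circ>\<^sub>F comma_proj) (b, g) v"

definition push_desc :: "('b, 'm) category \<Rightarrow> ('a, 'n) category \<Rightarrow> ('b, 'm, 'a, 'n) ftor \<Rightarrow>
    ('b, 'm, 'v) vfunctor \<Rightarrow> 'a \<Rightarrow> 'w vect \<Rightarrow> ('b \<Rightarrow> 'n \<Rightarrow> 'v \<Rightarrow> 'w) \<Rightarrow>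
    ('b \<times> 'n \<Rightarrow> 'v) set \<Rightarrow> 'w" where
  "push_desc B A f G a W \<phi> =
     colim_desc (comma B A f a) (G \<circ>\<^sub>F comma_proj) W (\<lambda>(b, g). \<phi> b g)"

definition push :: "('b, 'm) category \<Rightarrow> ('a, 'n) category \<Rightarrow> ('b, 'm, 'a, 'n) ftor \<Rightarrow>
    ('b, 'm, 'v) vfunctor \<Rightarrow> ('a, 'n, ('b \<times> 'n \<Rightarrow> 'v) set) vfunctor" where
  "push B A f G = \<lparr>
     omap = push_obj B A f G,
     amap = (\<lambda>k. push_desc B A f G (Dom A k) (push_obj B A f G (Cod A k))
               (\<lambda>b g v. push_incl B A f G (Cod A k) b (Comp A k g) v))\<rparr>"

text \<open>The action of \<open>f\<^sub>*\<close> on a natural transformation \<open>\<theta> : G \<Rightarrow> G'\<close>, at the object \<open>a\<close>.\<close>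

definition push_map :: "('b, 'm) category \<Rightarrow> ('a, 'n) category \<Rightarrow> ('b, 'm, 'a, 'n) ftor \<Rightarrow>
    ('b, 'm, 'v) vfunctor \<Rightarrow> ('b, 'm, 'w) vfunctor \<Rightarrow> ('b \<Rightarrow> 'v \<Rightarrow> 'w) \<Rightarrow>
    'a \<Rightarrow> ('b \<times> 'n \<Rightarrow> 'v) set \<Rightarrow> ('b \<times> 'n \<Rightarrow> 'w) set" where
  "push_map B A f G G' \<theta> a =
     push_desc B A f G a (push_obj B A f G' a) (\<lambda>b g v. push_incl B A f G' a b g (\<theta> b v))"

definition left_counit :: "('b, 'm) category \<Rightarrow> ('a, 'n) category \<Rightarrow> ('b, 'm, 'a, 'n) ftor \<Rightarrow>
    ('a, 'n, 'v) vfunctor \<Rightarrow> 'a \<Rightarrow> ('b \<times> 'n \<Rightarrow> 'v) set \<Rightarrow> 'v" where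
  "left_counit B A f F a =
     push_desc B A f (F \<circ>\<^sub>F f) a (omap F a) (\<lambda>b g v. amap F g v)"

text \<open>The outer sum runs over the isomorphism classes \<open>c\<close> of objects of \<open>B\<close>, each with a chosen
  representative \<open>b\<close>; the value does not depend on that choice.\<close>

definition right_unit :: "('b, 'm) category \<Rightarrow> ('a, 'n) category \<Rightarrow> ('b, 'm, 'a, 'n) ftor \<Rightarrow>
    ('a, 'n, 'v) vfunctor \<Rightarrow> 'a \<Rightarrow> 'v \<Rightarrow> ('b \<times> 'n \<Rightarrow> 'v) set" where
  "right_unit B A f F a v =
     (let V = push_obj B A f (F \<circ>\<^sub>F f) a; rep = (\<lambda>c. SOME b. b \<in> c) in
      \<Oplus>\<^bsub>V\<^esub> c \<in> {c \<in> Obj B // iso_rel B. (omap f (rep c), a) \<in> iso_rel A}.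
        (1 / of_nat (card (auts B (rep c)))) \<odot>\<^bsub>V\<^esub>
        (\<Oplus>\<^bsub>V\<^esub> g \<in> homs A a (omap f (rep c)).
           push_incl B A f (F \<circ>\<^sub>F f) a (rep c) (inv_arrow A g) (amap F g v)))"

text \<open>For functors \<open>g : C \<rightarrow> B\<close> and \<open>f : B \<rightarrow> A\<close>, the canonical isomorphism
  \<open>f\<^sub>* g\<^sub>* \<cong> (f g)\<^sub>*\<close> and its inverse, on generators \<open>h \<otimes> (k \<otimes> v) \<mapsto> h f(k) \<otimes> v\<close> and
  \<open>h \<otimes> v \<mapsto> h \<otimes> (id \<otimes> v)\<close>.\<close>

definition push_merge :: "('c, 'l) category \<Rightarrow> ('b, 'm) category \<Rightarrow> ('a, 'n) category \<Rightarrow>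
    ('c, 'l, 'b, 'm) ftor \<Rightarrow> ('b, 'm, 'a, 'n) ftor \<Rightarrow> ('c, 'l, 'v) vfunctor \<Rightarrow> 'a \<Rightarrow>
    ('b \<times> 'n \<Rightarrow> ('c \<times> 'm \<Rightarrow> 'v) set) set \<Rightarrow> ('c \<times> 'n \<Rightarrow> 'v) set" where
  "push_merge C B A g f G a =
     push_desc B A f (push C B g G) a (push_obj C A (f \<circ>\<^sub>F g) G a)
       (\<lambda>b h. push_desc C B g G b (push_obj C A (f \<circ>\<^sub>F g) G a)
          (\<lambda>c k v. push_incl C A (f \<circ>\<^sub>F g) G a c (Comp A h (amap f k)) v))"

definition push_split :: "('c, 'l) category \<Rightarrow> ('b, 'm) category \<Rightarrow> ('a, 'n) category \<Rightarrow>
    ('c, 'l, 'b, 'm) ftor \<Rightarrow> ('b, 'm, 'a, 'n) ftor \<Rightarrow> ('c, 'l, 'v) vfunctor \<Rightarrow> 'a \<Rightarrow>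
    ('c \<times> 'n \<Rightarrow> 'v) set \<Rightarrow> ('b \<times> 'n \<Rightarrow> ('c \<times> 'm \<Rightarrow> 'v) set) set" where
  "push_split C B A g f G a =
     push_desc C A (f \<circ>\<^sub>F g) G a (push_obj B A f (push C B g G) a)
       (\<lambda>c h v. push_incl B A f (push C B g G) a (omap g c) h
          (push_incl C B g G (omap g c) c (Ident B (omap g c)) v))"


section \<open>Spans and spans of span maps\<close>

record ('x, 'xm, 'a, 'am, 'b, 'bm) span =
  apex :: "('x, 'xm) category"
  sleg :: "('x, 'xm, 'a, 'am) ftor"
  tleg :: "('x, 'xm, 'b, 'bm) ftor"

definition is_span :: "('a, 'am) category \<Rightarrow> ('b, 'bm) category \<Rightarrow>
    ('x, 'xm, 'a, 'am, 'b, 'bm) span \<Rightarrow> bool" where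
  "is_span A1 A2 X \<longleftrightarrow> ess_finite_groupoid (apex X) \<and>
     cat_functor (apex X) A1 (sleg X) \<and> cat_functor (apex X) A2 (tleg X)"

text \<open>A span of span maps is a span between the apexes, extended by the components of
  \<open>\<zeta>\<^sub>s : s\<^sub>1 s \<Rightarrow> s\<^sub>2 t\<close> and \<open>\<zeta>\<^sub>t : t\<^sub>1 s \<Rightarrow> t\<^sub>2 t\<close>.\<close>

record ('y, 'ym, 'x1, 'xm1, 'x2, 'xm2, 'am, 'bm) span2 =
    "('y, 'ym, 'x1, 'xm1, 'x2, 'xm2) span" +
  zeta_s :: "'y \<Rightarrow> 'am"
  zeta_t :: "'y \<Rightarrow> 'bm"

definition is_span2 :: "('a, 'am) category \<Rightarrow> ('b, 'bm) category \<Rightarrow>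
    ('x1, 'xm1, 'a, 'am, 'b, 'bm) span \<Rightarrow> ('x2, 'xm2, 'a, 'am, 'b, 'bm) span \<Rightarrow>
    ('y, 'ym, 'x1, 'xm1, 'x2, 'xm2, 'am, 'bm) span2 \<Rightarrow> bool" where
  "is_span2 A1 A2 X1 X2 Y \<longleftrightarrow> ess_finite_groupoid (apex Y) \<and>
     cat_functor (apex Y) (apex X1) (sleg Y) \<and> cat_functor (apex Y) (apex X2) (tleg Y) \<and>
     nat_iso (apex Y) A1 (sleg X1 \<circ>\<^sub>F sleg Y) (sleg X2 \<circ>\<^sub>F tleg Y) (zeta_s Y) \<and>
     nat_iso (apex Y) A2 (tleg X1 \<circ>\<^sub>F sleg Y) (tleg X2 \<circ>\<^sub>F tleg Y) (zeta_t Y)"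

text \<open>For a span of span maps, identity components force \<open>s\<^sub>1 s = s\<^sub>2 t\<close> and \<open>t\<^sub>1 s = t\<^sub>2 t\<close> on
  objects (by the typing of the components) and on arrows (by naturality).\<close>

definition strictly_commuting :: "('a, 'am) category \<Rightarrow> ('b, 'bm) category \<Rightarrow>
    ('x1, 'xm1, 'a, 'am, 'b, 'bm) span \<Rightarrow>
    ('y, 'ym, 'x1, 'xm1, 'x2, 'xm2, 'am, 'bm) span2 \<Rightarrow> bool" where
  "strictly_commuting A1 A2 X1 Y \<longleftrightarrow> (\<forall>y \<in> Obj (apex Y).
     zeta_s Y y = Ident A1 (omap (sleg X1) (omap (sleg Y) y)) \<and>
     zeta_t Y y = Ident A2 (omap (tleg X1) (omap (sleg Y) y)))"

definition weak_pullback :: "('y, 'ym) category \<Rightarrow> ('z, 'zm) category \<Rightarrow> ('x, 'xm) category \<Rightarrow>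
    ('y, 'ym, 'x, 'xm) ftor \<Rightarrow> ('z, 'zm, 'x, 'xm) ftor \<Rightarrow>
    ('y \<times> 'xm \<times> 'z, ('y \<times> 'xm \<times> 'z) \<times> ('ym \<times> 'zm) \<times> ('y \<times> 'xm \<times> 'z)) category" where
  "weak_pullback Y Z X t s = \<lparr>
     Obj = {(y, g, z). y \<in> Obj Y \<and> z \<in> Obj Z \<and> g \<in> homs X (omap t y) (omap s z)},
     Arr = {((y, g, z), (u, w), (y', g', z')).
              y \<in> Obj Y \<and> z \<in> Obj Z \<and> g \<in> homs X (omap t y) (omap s z) \<and>
              y' \<in> Obj Y \<and> z' \<in> Obj Z \<and> g' \<in> homs X (omap t y') (omap s z') \<and>
              u \<in> homs Y y y' \<and> w \<in> homs Z z z' \<and>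
              Comp X g' (amap t u) = Comp X (amap s w) g},
     Dom = (\<lambda>(p, h, q). p),
     Cod = (\<lambda>(p, h, q). q),
     Ident = (\<lambda>(y, g, z). ((y, g, z), (Ident Y y, Ident Z z), (y, g, z))),
     Comp = (\<lambda>(p', (u', w'), q') (p, (u, w), q). (p, (Comp Y u' u, Comp Z w' w), q'))\<rparr>"

definition wp_fst :: "('y \<times> 'xm \<times> 'z, ('y \<times> 'xm \<times> 'z) \<times> ('ym \<times> 'zm) \<times> ('y \<times> 'xm \<times> 'z),
    'y, 'ym) ftor" where
  "wp_fst = \<lparr>omap = (\<lambda>(y, g, z). y), amap = (\<lambda>(p, (u, w), q). u)\<rparr>"

definition wp_snd :: "('y \<times> 'xm \<times> 'z, ('y \<times> 'xm \<times> 'z) \<times> ('ym \<times> 'zm) \<times> ('y \<times> 'xm \<times> 'z),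
    'z, 'zm) ftor" where
  "wp_snd = \<lparr>omap = (\<lambda>(y, g, z). z), amap = (\<lambda>(p, (u, w), q). w)\<rparr>"

text \<open>The vertical composite \<open>Y' \<circ> Y\<close> of strictly commuting spans of span maps \<open>Y : X\<^sub>1 \<rightarrow> X\<^sub>2\<close> and
  \<open>Y' : X\<^sub>2 \<rightarrow> X\<^sub>3\<close>.\<close>

definition vcomp :: "('x2, 'xm2, 'a, 'am, 'b, 'bm) span \<Rightarrow>
    ('z, 'zm, 'x2, 'xm2, 'x3, 'xm3, 'am, 'bm) span2 \<Rightarrow>
    ('y, 'ym, 'x1, 'xm1, 'x2, 'xm2, 'am, 'bm) span2 \<Rightarrow>
    ('y \<times> 'xm2 \<times> 'z, ('y \<times> 'xm2 \<times> 'z) \<times> ('ym \<times> 'zm) \<times> ('y \<times> 'xm2 \<times> 'z),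
      'x1, 'xm1, 'x3, 'xm3, 'am, 'bm) span2" where
  "vcomp X2 Y' Y = \<lparr>
     apex = weak_pullback (apex Y) (apex Y') (apex X2) (tleg Y) (sleg Y'),
     sleg = sleg Y \<circ>\<^sub>F wp_fst,
     tleg = tleg Y' \<circ>\<^sub>F wp_snd,
     zeta_s = (\<lambda>(y, g, y'). amap (sleg X2) g),
     zeta_t = (\<lambda>(y, g, y'). amap (tleg X2) g)\<rparr>"


section \<open>The 2-linearization\<close>

definition Lambda_span :: "('b, 'bm) category \<Rightarrow> ('x, 'xm, 'a, 'am, 'b, 'bm) span \<Rightarrow>
    ('a, 'am, 'v) vfunctor \<Rightarrow> ('b, 'bm, ('x \<times> 'bm \<Rightarrow> 'v) set) vfunctor" where
  "Lambda_span A2 X F = push (apex X) A2 (tleg X) (F \<circ>\<^sub>F sleg X)"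

text \<open>The isomorphism \<open>(t\<^sub>1 s)\<^sub>* (s\<^sub>1 s)\<^sup>* \<cong> (t\<^sub>2 t)\<^sub>* (s\<^sub>2 t)\<^sup>*\<close> induced by \<open>\<zeta>\<^sub>s\<close> and \<open>\<zeta>\<^sub>t\<close>, on generators
  \<open>h \<otimes> v \<mapsto> h \<zeta>\<^sub>t(y)\<inverse> \<otimes> F(\<zeta>\<^sub>s(y)) v\<close>.\<close>

definition zeta_map :: "('b, 'bm) category \<Rightarrow> ('x1, 'xm1, 'a, 'am, 'b, 'bm) span \<Rightarrow>
    ('x2, 'xm2, 'a, 'am, 'b, 'bm) span \<Rightarrow>
    ('y, 'ym, 'x1, 'xm1, 'x2, 'xm2, 'am, 'bm) span2 \<Rightarrow> ('a, 'am, 'v) vfunctor \<Rightarrow> 'b \<Rightarrow>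
    ('y \<times> 'bm \<Rightarrow> 'v) set \<Rightarrow> ('y \<times> 'bm \<Rightarrow> 'v) set" where
  "zeta_map A2 X1 X2 Y F a =
     push_desc (apex Y) A2 (tleg X1 \<circ>\<^sub>F sleg Y) (F \<circ>\<^sub>F sleg X1 \<circ>\<^sub>F sleg Y) a
       (push_obj (apex Y) A2 (tleg X2 \<circ>\<^sub>F tleg Y) (F \<circ>\<^sub>F sleg X2 \<circ>\<^sub>F tleg Y) a)
       (\<lambda>y h v. push_incl (apex Y) A2 (tleg X2 \<circ>\<^sub>F tleg Y) (F \<circ>\<^sub>F sleg X2 \<circ>\<^sub>F tleg Y) a
          y (Comp A2 h (inv_arrow A2 (zeta_t Y y))) (amap F (zeta_s Y y) v))"

text \<open>\<open>Lambda_span2 A2 X1 X2 Y F a\<close> is the component at \<open>F\<close> and \<open>a\<close> of the natural transformation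
  \<open>\<Lambda>(Y) : \<Lambda>(X\<^sub>1) \<Rightarrow> \<Lambda>(X\<^sub>2)\<close>.\<close>

definition Lambda_span2 :: "('b, 'bm) category \<Rightarrow> ('x1, 'xm1, 'a, 'am, 'b, 'bm) span \<Rightarrow>
    ('x2, 'xm2, 'a, 'am, 'b, 'bm) span \<Rightarrow>
    ('y, 'ym, 'x1, 'xm1, 'x2, 'xm2, 'am, 'bm) span2 \<Rightarrow> ('a, 'am, 'v) vfunctor \<Rightarrow> 'b \<Rightarrow>
    ('x1 \<times> 'bm \<Rightarrow> 'v) set \<Rightarrow> ('x2 \<times> 'bm \<Rightarrow> 'v) set" where
  "Lambda_span2 A2 X1 X2 Y F a =
     (let F1 = F \<circ>\<^sub>F sleg X1; F2 = F \<circ>\<^sub>F sleg X2 in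
        push_map (apex X2) A2 (tleg X2)
          (push (apex Y) (apex X2) (tleg Y) (F2 \<circ>\<^sub>F tleg Y)) F2
          (left_counit (apex Y) (apex X2) (tleg Y) F2) a
      \<circ> push_split (apex Y) (apex X2) A2 (tleg Y) (tleg X2) (F2 \<circ>\<^sub>F tleg Y) a
      \<circ> zeta_map A2 X1 X2 Y F a
      \<circ> push_merge (apex Y) (apex X1) A2 (sleg Y) (tleg X1) (F1 \<circ>\<^sub>F sleg Y) a
      \<circ> push_map (apex X1) A2 (tleg X1)
          F1 (push (apex Y) (apex X1) (sleg Y) (F1 \<circ>\<^sub>F sleg Y))
          (right_unit (apex Y) (apex X1) (sleg Y) F1) a)"

end

theory Submission
  imports Defs
begin

text \<open>On a generator \<open>h \<otimes> v\<close> of \<open>\<Lambda>(X\<^sub>1)(F)(a)\<close>, with \<open>h : t\<^sub>1 x \<rightarrow> a\<close> and \<open>v\<close> in \<open>F (s\<^sub>1 x)\<close>, the map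
  \<open>\<Lambda>(Y)\<close> is the average over \<open>y\<close> in \<open>Y\<close>, with respect to groupoid cardinality, of the sums over
  \<open>g : x \<rightarrow> s y\<close> of \<open>h t\<^sub>1(g)\<inverse> \<zeta>\<^sub>t(y)\<inverse> \<otimes> F(\<zeta>\<^sub>s(y) s\<^sub>1(g)) v\<close>. The integrand is invariant under
  isomorphisms of \<open>y\<close>, so the average may be computed over any finite set \<open>E\<close> of objects that meets
  every isomorphism class, an object \<open>e\<close> being weighted by the inverse of the number of arrows from
  \<open>e\<close> into \<open>E\<close>. If \<open>R\<close> and \<open>R'\<close> are such sets for \<open>Y\<close> and \<open>Y'\<close>, then all triples \<open>(y, k, y')\<close>
  with \<open>y \<in> R\<close> and \<open>y' \<in> R'\<close> form such a set for the weak pullback; an arrow from \<open>(y, k, y')\<close>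
  into it is a pair of arrows from \<open>y\<close> into \<open>R\<close> and from \<open>y'\<close> into \<open>R'\<close>, so the weights multiply
  and the average over the weak pullback is the iterated one.\<close>

section \<open>Complex vector spaces\<close>

text \<open>The obstacle is that \<open>right_unit\<close> sums over isomorphism classes with
  representatives picked by \<open>SOME\<close>, and the picks in the weak pullback are unrelated to
  those in \<open>Y\<close> and \<open>Y'\<close>. The classes of triples over a fixed pair of
  classes are double cosets with varying stabilizers, so matching class by class would need an orbit
  count; weights given by outgoing arrows replace it by a product formula. What remains is to match
  summands. For \<open>g : x \<rightarrow> s y\<close> and
  \<open>k : t y \<rightarrow> s' y'\<close>, both sides contribute \<open>h t\<^sub>1(g)\<inverse>
  t\<^sub>2(k)\<inverse> \<otimes> F(s\<^sub>2(k) s\<^sub>1(g)) v\<close>. In the composite span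
  \<open>k\<close> enters through \<open>zeta_s\<close> and \<open>zeta_t\<close> of
  \<open>vcomp\<close>; in the iterated map it enters through the right unit of \<open>Y'\<close>,
  while the components of \<open>Y\<close> and \<open>Y'\<close> are identities. The sums can be
  exchanged because the range of \<open>g\<close> depends on \<open>y\<close> alone. Comparing
  values on generators proves equality only once every stage of \<open>Lambda_span2\<close> is known
  to descend to the colimit and to be linear there; most of the length goes into this.\<close>

abbreviation cvec :: "'v vect \<Rightarrow> bool" where
  "cvec V \<equiv> Module.module class_ring V"

abbreviation chom :: "'v vect \<Rightarrow> 'w vect \<Rightarrow> ('v \<Rightarrow> 'w) \<Rightarrow> bool" where
  "chom V W f \<equiv> mod_hom class_ring V W f"

lemma cring_class_ring: "cring (class_ring :: complex ring)"
  by unfold_locales (auto simp: field_simps Units_def intro: exI[of _ "- _"])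

text \<open>Additive inverses come from multiplication by \<open>-1\<close>, so the spaces
  constructed below never need a description of their negation.\<close>

lemma cvecI:
  assumes "\<zero>\<^bsub>V\<^esub> \<in> carrier V"
    and "\<And>x y. x \<in> carrier V \<Longrightarrow> y \<in> carrier V \<Longrightarrow> x \<oplus>\<^bsub>V\<^esub> y \<in> carrier V"
    and "\<And>c x. x \<in> carrier V \<Longrightarrow> c \<odot>\<^bsub>V\<^esub> x \<in> carrier V"
    and "\<And>x y. x \<in> carrier V \<Longrightarrow> y \<in> carrier V \<Longrightarrow> x \<oplus>\<^bsub>V\<^esub> y = y \<oplus>\<^bsub>V\<^esub> x"
    and "\<And>x y z. x \<in> carrier V \<Longrightarrow> y \<in> carrier V \<Longrightarrow> z \<in> carrier V \<Longrightarrow>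
      (x \<oplus>\<^bsub>V\<^esub> y) \<oplus>\<^bsub>V\<^esub> z = x \<oplus>\<^bsub>V\<^esub> (y \<oplus>\<^bsub>V\<^esub> z)"
    and "\<And>x. x \<in> carrier V \<Longrightarrow> x \<oplus>\<^bsub>V\<^esub> \<zero>\<^bsub>V\<^esub> = x"
    and "\<And>c d x. x \<in> carrier V \<Longrightarrow> (c * d) \<odot>\<^bsub>V\<^esub> x = c \<odot>\<^bsub>V\<^esub> (d \<odot>\<^bsub>V\<^esub> x)"
    and "\<And>x. x \<in> carrier V \<Longrightarrow> 1 \<odot>\<^bsub>V\<^esub> x = x"
    and "\<And>c d x. x \<in> carrier V \<Longrightarrow> (c + d) \<odot>\<^bsub>V\<^esub> x = c \<odot>\<^bsub>V\<^esub> x \<oplus>\<^bsub>V\<^esub> d \<odot>\<^bsub>V\<^esub> x"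
    and "\<And>c x y. x \<in> carrier V \<Longrightarrow> y \<in> carrier V \<Longrightarrow>
      c \<odot>\<^bsub>V\<^esub> (x \<oplus>\<^bsub>V\<^esub> y) = c \<odot>\<^bsub>V\<^esub> x \<oplus>\<^bsub>V\<^esub> c \<odot>\<^bsub>V\<^esub> y"
    and "\<And>x. x \<in> carrier V \<Longrightarrow> x \<oplus>\<^bsub>V\<^esub> (- 1) \<odot>\<^bsub>V\<^esub> x = \<zero>\<^bsub>V\<^esub>"
  shows "cvec V"
proof (rule moduleI[OF cring_class_ring abelian_groupI])
  show "\<exists>y\<in>carrier V. y \<oplus>\<^bsub>V\<^esub> x = \<zero>\<^bsub>V\<^esub>" if "x \<in> carrier V" for x
    using that assms(3,4,11) by metis
  show "\<zero>\<^bsub>V\<^esub> \<oplus>\<^bsub>V\<^esub> x = x" if "x \<in> carrier V" for x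
    using that assms(1,4,6) by metis
qed (simp_all add: assms(1-3,5-10), rule assms(4))

lemma chomI:
  assumes "cvec V" "cvec W"
    and "\<And>x. x \<in> carrier V \<Longrightarrow> f x \<in> carrier W"
    and "\<And>x y. x \<in> carrier V \<Longrightarrow> y \<in> carrier V \<Longrightarrow> f (x \<oplus>\<^bsub>V\<^esub> y) = f x \<oplus>\<^bsub>W\<^esub> f y"
    and "\<And>c x. x \<in> carrier V \<Longrightarrow> f (c \<odot>\<^bsub>V\<^esub> x) = c \<odot>\<^bsub>W\<^esub> f x"
  shows "chom V W f"
  using assms by (simp add: mod_hom_def mod_hom_axioms_def LinearCombinations.module_hom_def)

lemma chomD:
  assumes "chom V W f"
  shows "cvec V" "cvec W"
    and "\<And>x. x \<in> carrier V \<Longrightarrow> f x \<in> carrier W"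
    and "\<And>x y. x \<in> carrier V \<Longrightarrow> y \<in> carrier V \<Longrightarrow> f (x \<oplus>\<^bsub>V\<^esub> y) = f x \<oplus>\<^bsub>W\<^esub> f y"
    and "\<And>c x. x \<in> carrier V \<Longrightarrow> f (c \<odot>\<^bsub>V\<^esub> x) = c \<odot>\<^bsub>W\<^esub> f x"
    and "f \<zero>\<^bsub>V\<^esub> = \<zero>\<^bsub>W\<^esub>"
proof -
  interpret mod_hom class_ring V W f by fact
  show "cvec V" "cvec W" by unfold_locales
  show "\<And>x. x \<in> carrier V \<Longrightarrow> f x \<in> carrier W"
    "\<And>x y. x \<in> carrier V \<Longrightarrow> y \<in> carrier V \<Longrightarrow> f (x \<oplus>\<^bsub>V\<^esub> y) = f x \<oplus>\<^bsub>W\<^esub> f y"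
    "\<And>c x. x \<in> carrier V \<Longrightarrow> f (c \<odot>\<^bsub>V\<^esub> x) = c \<odot>\<^bsub>W\<^esub> f x"
    "f \<zero>\<^bsub>V\<^esub> = \<zero>\<^bsub>W\<^esub>"
    by auto
qed

lemma chom_comp: "chom V W f \<Longrightarrow> chom U V g \<Longrightarrow> chom U W (f \<circ> g)"
  by (intro chomI) (auto simp: chomD)

text \<open>\<open>A\<close> may be infinite: both sums are then zero by convention, and
  \<open>f\<close> preserves zero.\<close>

lemma chom_finsum:
  assumes "chom V W f" "\<And>a. a \<in> A \<Longrightarrow> g a \<in> carrier V"
  shows "f (\<Oplus>\<^bsub>V\<^esub>a\<in>A. g a) = (\<Oplus>\<^bsub>W\<^esub>a\<in>A. f (g a))"
proof -
  interpret mod_hom class_ring V W f by fact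
  show ?thesis using assms(2)
  proof (induct A rule: infinite_finite_induct)
    case (insert a A)
    then show ?case
      by (subst M.M.finsum_insert N.M.finsum_insert; auto simp: Pi_def)+
  qed auto
qed

lemma chom_smult:
  assumes "cvec V" shows "chom V V (\<lambda>x. c \<odot>\<^bsub>V\<^esub> x)"
proof -
  interpret Module.module class_ring V by fact
  show ?thesis
    by (intro chomI assms) (auto simp: smult_r_distr smult_assoc1[of _ _, symmetric, simplified] mult.commute)
qed

text \<open>Used to see that the right unit, a sum of sums of linear maps, is linear.\<close>

lemma chom_finsum_maps:
  assumes "cvec V" "cvec W" "\<And>a. a \<in> A \<Longrightarrow> chom V W (f a)"
  shows "chom V W (\<lambda>x. \<Oplus>\<^bsub>W\<^esub>a\<in>A. f a x)"
proof -
  interpret W: Module.module class_ring W by fact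
  show ?thesis
  proof (rule chomI[OF assms(1,2)])
    fix x y assume xy: "x \<in> carrier V" "y \<in> carrier V"
    have "(\<Oplus>\<^bsub>W\<^esub>a\<in>A. f a (x \<oplus>\<^bsub>V\<^esub> y)) = (\<Oplus>\<^bsub>W\<^esub>a\<in>A. f a x \<oplus>\<^bsub>W\<^esub> f a y)"
      using xy chomD[OF assms(3)] by (intro W.M.finsum_cong') auto
    also have "\<dots> = (\<Oplus>\<^bsub>W\<^esub>a\<in>A. f a x) \<oplus>\<^bsub>W\<^esub> (\<Oplus>\<^bsub>W\<^esub>a\<in>A. f a y)"
      using xy chomD[OF assms(3)] by (intro W.M.finsum_addf) auto
    finally show "(\<Oplus>\<^bsub>W\<^esub>a\<in>A. f a (x \<oplus>\<^bsub>V\<^esub> y)) = \<dots>" .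
  next
    fix c x assume x: "x \<in> carrier V"
    have "(\<Oplus>\<^bsub>W\<^esub>a\<in>A. f a (c \<odot>\<^bsub>V\<^esub> x)) = (\<Oplus>\<^bsub>W\<^esub>a\<in>A. c \<odot>\<^bsub>W\<^esub> f a x)"
      using x chomD[OF assms(3)] by (intro W.M.finsum_cong') auto
    also have "\<dots> = c \<odot>\<^bsub>W\<^esub> (\<Oplus>\<^bsub>W\<^esub>a\<in>A. f a x)"
      using x chomD[OF assms(3)]
      by (intro chom_finsum[OF chom_smult[OF assms(2)], symmetric]) auto
    finally show "(\<Oplus>\<^bsub>W\<^esub>a\<in>A. f a (c \<odot>\<^bsub>V\<^esub> x)) = \<dots>" .
  qed (use chomD[OF assms(3)] in \<open>auto intro!: W.M.finsum_closed\<close>)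
qed

lemma (in abelian_monoid) finsum_Sigma:
  assumes "finite I" "\<And>i. i \<in> I \<Longrightarrow> finite (A i)"
    and f: "\<And>i j. i \<in> I \<Longrightarrow> j \<in> A i \<Longrightarrow> f i j \<in> carrier G"
  shows "(\<Oplus>p\<in>Sigma I A. f (fst p) (snd p)) = (\<Oplus>i\<in>I. \<Oplus>j\<in>A i. f i j)"
proof -
  have eq: "Sigma I A = (\<Union>i\<in>I. Pair i ` A i)" by auto
  have "(\<Oplus>p\<in>Sigma I A. f (fst p) (snd p)) = (\<Oplus>i\<in>I. \<Oplus>p\<in>Pair i ` A i. f (fst p) (snd p))"
    unfolding eq using assms
    by (intro add.finprod_UN_disjoint) (auto simp: pairwise_def disjnt_def)
  also have "\<dots> = (\<Oplus>i\<in>I. \<Oplus>j\<in>A i. f i j)"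
    using f by (intro finsum_cong' refl, auto intro!: finsum_closed)
      (subst finsum_reindex; auto simp: inj_on_def)
  finally show ?thesis .
qed

lemma (in abelian_monoid) finsum_swap:
  assumes "finite I" "finite J"
    and f: "\<And>i j. i \<in> I \<Longrightarrow> j \<in> J \<Longrightarrow> f i j \<in> carrier G"
  shows "(\<Oplus>i\<in>I. \<Oplus>j\<in>J. f i j) = (\<Oplus>j\<in>J. \<Oplus>i\<in>I. f i j)"
  using assms(1) f
proof (induct I)
  case (insert i I)
  then have "(\<Oplus>j\<in>J. \<Oplus>i\<in>insert i I. f i j) = (\<Oplus>j\<in>J. f i j \<oplus> (\<Oplus>i\<in>I. f i j))"
    by (intro finsum_cong' refl) (auto intro!: finsum_closed simp: Pi_def)
  also have "\<dots> = (\<Oplus>j\<in>J. f i j) \<oplus> (\<Oplus>j\<in>J. \<Oplus>i\<in>I. f i j)"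
    using insert by (intro finsum_addf) (auto intro!: finsum_closed simp: Pi_def)
  finally show ?case
    using insert by (subst finsum_insert) (auto intro!: finsum_closed simp: Pi_def)
qed simp

lemma finsum_scaled_const:
  assumes "cvec V" "finite A" "x \<in> carrier V"
  shows "(\<Oplus>\<^bsub>V\<^esub>a\<in>A. c \<odot>\<^bsub>V\<^esub> x) = (of_nat (card A) * c) \<odot>\<^bsub>V\<^esub> x"
proof -
  interpret V: Module.module class_ring V by fact
  show ?thesis using assms(2)
  proof induct
    case (insert a A)
    then show ?case using assms(3)
      by (subst V.M.finsum_insert)
        (auto simp: Pi_def ring_distribs V.smult_l_distr[simplified])
  qed (use assms(3) V.lmult_0[of x] in simp)
qed

lemma cvecD:
  assumes "cvec V"
  shows "\<zero>\<^bsub>V\<^esub> \<in> carrier V"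
    and "\<And>x y. x \<in> carrier V \<Longrightarrow> y \<in> carrier V \<Longrightarrow> x \<oplus>\<^bsub>V\<^esub> y \<in> carrier V"
    and "\<And>c x. x \<in> carrier V \<Longrightarrow> c \<odot>\<^bsub>V\<^esub> x \<in> carrier V"
    and "\<And>x y. x \<in> carrier V \<Longrightarrow> y \<in> carrier V \<Longrightarrow> x \<oplus>\<^bsub>V\<^esub> y = y \<oplus>\<^bsub>V\<^esub> x"
    and "\<And>x y z. x \<in> carrier V \<Longrightarrow> y \<in> carrier V \<Longrightarrow> z \<in> carrier V \<Longrightarrow>
      (x \<oplus>\<^bsub>V\<^esub> y) \<oplus>\<^bsub>V\<^esub> z = x \<oplus>\<^bsub>V\<^esub> (y \<oplus>\<^bsub>V\<^esub> z)"
    and "\<And>x. x \<in> carrier V \<Longrightarrow> x \<oplus>\<^bsub>V\<^esub> \<zero>\<^bsub>V\<^esub> = x"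
    and "\<And>x. x \<in> carrier V \<Longrightarrow> \<zero>\<^bsub>V\<^esub> \<oplus>\<^bsub>V\<^esub> x = x"
    and "\<And>c d x. x \<in> carrier V \<Longrightarrow> (c * d) \<odot>\<^bsub>V\<^esub> x = c \<odot>\<^bsub>V\<^esub> (d \<odot>\<^bsub>V\<^esub> x)"
    and "\<And>x. x \<in> carrier V \<Longrightarrow> 1 \<odot>\<^bsub>V\<^esub> x = x"
    and "\<And>c d x. x \<in> carrier V \<Longrightarrow> (c + d) \<odot>\<^bsub>V\<^esub> x = c \<odot>\<^bsub>V\<^esub> x \<oplus>\<^bsub>V\<^esub> d \<odot>\<^bsub>V\<^esub> x"
    and "\<And>c x y. x \<in> carrier V \<Longrightarrow> y \<in> carrier V \<Longrightarrow>
      c \<odot>\<^bsub>V\<^esub> (x \<oplus>\<^bsub>V\<^esub> y) = c \<odot>\<^bsub>V\<^esub> x \<oplus>\<^bsub>V\<^esub> c \<odot>\<^bsub>V\<^esub> y"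
    and "\<And>x. x \<in> carrier V \<Longrightarrow> x \<oplus>\<^bsub>V\<^esub> (- 1) \<odot>\<^bsub>V\<^esub> x = \<zero>\<^bsub>V\<^esub>"
    and "\<And>c. c \<odot>\<^bsub>V\<^esub> \<zero>\<^bsub>V\<^esub> = \<zero>\<^bsub>V\<^esub>"
    and "\<And>x. x \<in> carrier V \<Longrightarrow> 0 \<odot>\<^bsub>V\<^esub> x = \<zero>\<^bsub>V\<^esub>"
proof -
  interpret Module.module class_ring V by fact
  show smult_zero: "c \<odot>\<^bsub>V\<^esub> \<zero>\<^bsub>V\<^esub> = \<zero>\<^bsub>V\<^esub>" for c using rmult_0[of c] by simp
  show zero_smult: "0 \<odot>\<^bsub>V\<^esub> x = \<zero>\<^bsub>V\<^esub>" if "x \<in> carrier V" for x using lmult_0[of x] that by simp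
  show one_smult: "1 \<odot>\<^bsub>V\<^esub> x = x" if "x \<in> carrier V" for x using smult_one[of x] that by simp
  show add_smult: "(c + d) \<odot>\<^bsub>V\<^esub> x = c \<odot>\<^bsub>V\<^esub> x \<oplus>\<^bsub>V\<^esub> d \<odot>\<^bsub>V\<^esub> x" if "x \<in> carrier V" for c d x
    using smult_l_distr[of c d x] that by simp
  show "(c * d) \<odot>\<^bsub>V\<^esub> x = c \<odot>\<^bsub>V\<^esub> (d \<odot>\<^bsub>V\<^esub> x)" if "x \<in> carrier V" for c d x
    using smult_assoc1[of c d x] that by simp
  show "x \<oplus>\<^bsub>V\<^esub> (- 1) \<odot>\<^bsub>V\<^esub> x = \<zero>\<^bsub>V\<^esub>" if "x \<in> carrier V" for x
    using add_smult[of x 1 "-1"] zero_smult one_smult that by simp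
  show "x \<oplus>\<^bsub>V\<^esub> y = y \<oplus>\<^bsub>V\<^esub> x" if "x \<in> carrier V" "y \<in> carrier V" for x y
    using that by (rule M.a_comm)
qed (use Module.module.axioms(2)[OF assms] Module.module.smult_closed[OF assms]
      Module.module.smult_r_distr[OF assms]
      in \<open>auto simp: abelian_monoid.a_assoc abelian_group_def abelian_monoid.zero_closed
        abelian_monoid.a_closed abelian_monoid.l_zero abelian_monoid.r_zero\<close>)

section \<open>Direct sums of complex vector spaces\<close>

lemma direct_sum_carrier:
  "x \<in> carrier (direct_sum_space I V) \<longleftrightarrow>
    x \<in> extensional I \<and> (\<forall>i\<in>I. x i \<in> carrier (V i)) \<and> finite {i \<in> I. x i \<noteq> \<zero>\<^bsub>V i\<^esub>}"
  by (auto simp: direct_sum_space_def PiE_def)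

lemma direct_sum_simps:
  "\<zero>\<^bsub>direct_sum_space I V\<^esub> = (\<lambda>i\<in>I. \<zero>\<^bsub>V i\<^esub>)"
  "x \<oplus>\<^bsub>direct_sum_space I V\<^esub> y = (\<lambda>i\<in>I. x i \<oplus>\<^bsub>V i\<^esub> y i)"
  "c \<odot>\<^bsub>direct_sum_space I V\<^esub> x = (\<lambda>i\<in>I. c \<odot>\<^bsub>V i\<^esub> x i)"
  by (auto simp: direct_sum_space_def)

context
  fixes I :: "'i set" and V :: "'i \<Rightarrow> 'v vect"
  assumes V: "\<And>i. i \<in> I \<Longrightarrow> cvec (V i)"
begin

lemmas summand_cvecD = cvecD[OF V]

lemma direct_sum_add_closed:
  assumes "x \<in> carrier (direct_sum_space I V)" "y \<in> carrier (direct_sum_space I V)"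
  shows "x \<oplus>\<^bsub>direct_sum_space I V\<^esub> y \<in> carrier (direct_sum_space I V)"
proof -
  have "{i \<in> I. x i \<oplus>\<^bsub>V i\<^esub> y i \<noteq> \<zero>\<^bsub>V i\<^esub>} \<subseteq> {i \<in> I. x i \<noteq> \<zero>\<^bsub>V i\<^esub>} \<union> {i \<in> I. y i \<noteq> \<zero>\<^bsub>V i\<^esub>}"
    by (auto simp: summand_cvecD(1,6))
  then have "finite {i \<in> I. x i \<oplus>\<^bsub>V i\<^esub> y i \<noteq> \<zero>\<^bsub>V i\<^esub>}"
    by (rule finite_subset) (use assms in \<open>auto simp: direct_sum_carrier\<close>)
  then show ?thesis using assms
    by (auto simp: direct_sum_simps direct_sum_carrier summand_cvecD(2,3) cong: conj_cong)
qed

lemma direct_sum_smult_closed: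
  assumes "x \<in> carrier (direct_sum_space I V)"
  shows "c \<odot>\<^bsub>direct_sum_space I V\<^esub> x \<in> carrier (direct_sum_space I V)"
proof -
  have "{i \<in> I. c \<odot>\<^bsub>V i\<^esub> x i \<noteq> \<zero>\<^bsub>V i\<^esub>} \<subseteq> {i \<in> I. x i \<noteq> \<zero>\<^bsub>V i\<^esub>}"
    by (auto simp: summand_cvecD(13))
  then have "finite {i \<in> I. c \<odot>\<^bsub>V i\<^esub> x i \<noteq> \<zero>\<^bsub>V i\<^esub>}"
    by (rule finite_subset) (use assms in \<open>auto simp: direct_sum_carrier\<close>)
  then show ?thesis using assms
    by (auto simp: direct_sum_simps direct_sum_carrier summand_cvecD(2,3) cong: conj_cong)
qed

lemma cvec_direct_sum: "cvec (direct_sum_space I V)"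
proof -
  let ?D = "direct_sum_space I V"
  have comm: "x \<oplus>\<^bsub>?D\<^esub> y = y \<oplus>\<^bsub>?D\<^esub> x" if "x \<in> carrier ?D" "y \<in> carrier ?D" for x y
    using that summand_cvecD(4)
    by (auto simp: direct_sum_simps direct_sum_carrier intro!: restrict_ext)
  show ?thesis
  proof (rule cvecI)
    show "x \<oplus>\<^bsub>?D\<^esub> y = y \<oplus>\<^bsub>?D\<^esub> x" if "x \<in> carrier ?D" "y \<in> carrier ?D" for x y
      using that by (rule comm)
    show "x \<oplus>\<^bsub>?D\<^esub> y \<in> carrier ?D" if "x \<in> carrier ?D" "y \<in> carrier ?D" for x y
      using that by (rule direct_sum_add_closed)
    show "c \<odot>\<^bsub>?D\<^esub> x \<in> carrier ?D" if "x \<in> carrier ?D" for c x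
      using that by (rule direct_sum_smult_closed)
  qed (auto simp: direct_sum_simps direct_sum_carrier summand_cvecD(1-3,5,6,8-12)
      extensional_def fun_eq_iff restrict_def cong: conj_cong)
qed

lemma direct_sum_incl_hom:
  assumes "i \<in> I"
  shows "chom (V i) (direct_sum_space I V) (direct_sum_incl I V i)"
proof (rule chomI)
  show "direct_sum_incl I V i x \<in> carrier (direct_sum_space I V)" if "x \<in> carrier (V i)" for x
  proof -
    have "{j \<in> I. direct_sum_incl I V i x j \<noteq> \<zero>\<^bsub>V j\<^esub>} \<subseteq> {i}"
      by (auto simp: direct_sum_incl_def)
    then have "finite {j \<in> I. direct_sum_incl I V i x j \<noteq> \<zero>\<^bsub>V j\<^esub>}"
      by (rule finite_subset) auto
    then show ?thesis using that summand_cvecD(1) by (auto simp: direct_sum_carrier direct_sum_incl_def)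
  qed
qed (use assms V in \<open>auto simp: cvec_direct_sum direct_sum_simps direct_sum_incl_def
      summand_cvecD intro!: restrict_ext\<close>)

text \<open>Supports are finite, so every element is reached from zero by adding one coordinate at a
  time. In this form the summands generate the direct sum, which is how linear maps out of a colimit
  are compared later.\<close>

lemma direct_sum_induct:
  assumes "x \<in> carrier (direct_sum_space I V)"
    and "P \<zero>\<^bsub>direct_sum_space I V\<^esub>"
    and "\<And>x i v. x \<in> carrier (direct_sum_space I V) \<Longrightarrow> i \<in> I \<Longrightarrow> v \<in> carrier (V i) \<Longrightarrow> P x \<Longrightarrow>
      P (x \<oplus>\<^bsub>direct_sum_space I V\<^esub> direct_sum_incl I V i v)"
  shows "P x"
proof -
  have z: "\<zero>\<^bsub>V i\<^esub> \<in> carrier (V i)" if "i \<in> I" for i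
    using that by (rule summand_cvecD)
  \<comment> \<open>\<open>F\<close> bounds the support instead of being equal to it, so the index
    treated in the induction step may carry a zero coordinate or even lie outside
    \<open>I\<close>.\<close>
  have "P x" if "finite F" "{i \<in> I. x i \<noteq> \<zero>\<^bsub>V i\<^esub>} \<subseteq> F" "x \<in> carrier (direct_sum_space I V)" for F x
    using that
  proof (induct F arbitrary: x)
    case empty
    then have "x = \<zero>\<^bsub>direct_sum_space I V\<^esub>"
      by (auto simp: direct_sum_simps direct_sum_carrier extensional_def fun_eq_iff)
    then show ?case using assms(2) by simp
  next
    case (insert i F)
    show ?case
    proof (cases "i \<in> I")
      case False
      then show ?thesis using insert by auto
    next
      case True
      define y where "y = x(i := \<zero>\<^bsub>V i\<^esub>)"
      have "{i \<in> I. y i \<noteq> \<zero>\<^bsub>V i\<^esub>} \<subseteq> {i \<in> I. x i \<noteq> \<zero>\<^bsub>V i\<^esub>}" by (auto simp: y_def)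
      then have "finite {i \<in> I. y i \<noteq> \<zero>\<^bsub>V i\<^esub>}"
        by (rule finite_subset) (use insert in \<open>auto simp: direct_sum_carrier\<close>)
      then have y: "y \<in> carrier (direct_sum_space I V)"
        using insert(5) z[OF True] True by (auto simp: direct_sum_carrier y_def extensional_def)
      have "P y" by (rule insert(3)[OF _ y]) (use insert(4) in \<open>auto simp: y_def\<close>)
      moreover have "x = y \<oplus>\<^bsub>direct_sum_space I V\<^esub> direct_sum_incl I V i (x i)"
        using insert(5) True z
        by (auto simp: direct_sum_simps direct_sum_carrier y_def direct_sum_incl_def
            extensional_def fun_eq_iff summand_cvecD)
      ultimately show ?thesis
        using assms(3)[OF y True, of "x i"] insert(5) True by (auto simp: direct_sum_carrier)
    qed
  qed
  then show ?thesis using assms(1) by (auto simp: direct_sum_carrier)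
qed

context
  fixes W :: "'w vect" and \<phi> :: "'i \<Rightarrow> 'v \<Rightarrow> 'w"
  assumes W: "cvec W" and \<phi>: "\<And>i. i \<in> I \<Longrightarrow> chom (V i) W (\<phi> i)"
begin

abbreviation "sum_desc x \<equiv> \<Oplus>\<^bsub>W\<^esub>j\<in>{j \<in> I. x j \<noteq> \<zero>\<^bsub>V j\<^esub>}. \<phi> j (x j)"

text \<open>The support changes when vectors are added or scaled. Enlarging the index set adds only
  zero terms, so linearity can be checked over one finite set containing all supports
  involved.\<close>

lemma sum_desc_eq:
  assumes "x \<in> carrier (direct_sum_space I V)" "finite F" "{j \<in> I. x j \<noteq> \<zero>\<^bsub>V j\<^esub>} \<subseteq> F" "F \<subseteq> I"
  shows "sum_desc x = (\<Oplus>\<^bsub>W\<^esub>j\<in>F. \<phi> j (x j))"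
proof -
  interpret W: Module.module class_ring W by (rule W)
  show ?thesis
    using assms(1,4) chomD[OF \<phi>]
    by (intro W.M.add.finprod_mono_neutral_cong_left assms) (auto simp: direct_sum_carrier)
qed

lemma sum_desc_hom: "chom (direct_sum_space I V) W (\<lambda>x. sum_desc x)"
proof -
  interpret W: Module.module class_ring W by (rule W)
  let ?S = "\<lambda>x. {j \<in> I. x j \<noteq> \<zero>\<^bsub>V j\<^esub>}"
  show ?thesis
  proof (rule chomI[OF cvec_direct_sum W])
    fix x y assume xy: "x \<in> carrier (direct_sum_space I V)" "y \<in> carrier (direct_sum_space I V)"
    define F where "F = ?S x \<union> ?S y"
    have F: "finite F" "?S x \<subseteq> F" "?S y \<subseteq> F" "F \<subseteq> I"
      using xy by (auto simp: F_def direct_sum_carrier)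
    have "?S (x \<oplus>\<^bsub>direct_sum_space I V\<^esub> y) \<subseteq> F"
      by (auto simp: summand_cvecD(1,6) F_def direct_sum_simps)
    then have "sum_desc (x \<oplus>\<^bsub>direct_sum_space I V\<^esub> y) =
        (\<Oplus>\<^bsub>W\<^esub>j\<in>F. \<phi> j ((x \<oplus>\<^bsub>direct_sum_space I V\<^esub> y) j))"
      using F xy by (intro sum_desc_eq direct_sum_add_closed)
    also have "\<dots> = (\<Oplus>\<^bsub>W\<^esub>j\<in>F. \<phi> j (x j) \<oplus>\<^bsub>W\<^esub> \<phi> j (y j))"
      using F xy chomD[OF \<phi>]
      by (intro W.M.finsum_cong') (auto simp: direct_sum_carrier direct_sum_simps)
    also have "\<dots> = sum_desc x \<oplus>\<^bsub>W\<^esub> sum_desc y"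
      using F xy chomD[OF \<phi>]
      by (subst (1 2) sum_desc_eq[where F = F])
        (auto simp: direct_sum_carrier intro!: W.M.finsum_addf)
    finally show "sum_desc (x \<oplus>\<^bsub>direct_sum_space I V\<^esub> y) = sum_desc x \<oplus>\<^bsub>W\<^esub> sum_desc y" .
  next
    fix c x assume x: "x \<in> carrier (direct_sum_space I V)"
    have "?S (c \<odot>\<^bsub>direct_sum_space I V\<^esub> x) \<subseteq> ?S x"
      by (auto simp: summand_cvecD(13) direct_sum_simps)
    then have "sum_desc (c \<odot>\<^bsub>direct_sum_space I V\<^esub> x) =
        (\<Oplus>\<^bsub>W\<^esub>j\<in>?S x. \<phi> j ((c \<odot>\<^bsub>direct_sum_space I V\<^esub> x) j))"
      using x by (intro sum_desc_eq direct_sum_smult_closed) (auto simp: direct_sum_carrier)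
    also have "\<dots> = (\<Oplus>\<^bsub>W\<^esub>j\<in>?S x. c \<odot>\<^bsub>W\<^esub> \<phi> j (x j))"
      using x chomD[OF \<phi>]
      by (intro W.M.finsum_cong') (auto simp: direct_sum_carrier direct_sum_simps)
    also have "\<dots> = c \<odot>\<^bsub>W\<^esub> sum_desc x"
      using x chomD[OF \<phi>] by (intro chom_finsum[OF chom_smult[OF W], symmetric])
        (auto simp: direct_sum_carrier)
    finally show "sum_desc (c \<odot>\<^bsub>direct_sum_space I V\<^esub> x) = c \<odot>\<^bsub>W\<^esub> sum_desc x" .
  qed (use chomD[OF \<phi>] in \<open>auto simp: direct_sum_carrier intro!: W.M.finsum_closed\<close>)
qed

lemma sum_desc_incl:
  assumes "i \<in> I" "v \<in> carrier (V i)"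
  shows "sum_desc (direct_sum_incl I V i v) = \<phi> i v"
proof -
  interpret W: Module.module class_ring W by (rule W)
  have "sum_desc (direct_sum_incl I V i v) = (\<Oplus>\<^bsub>W\<^esub>j\<in>{i}. \<phi> j (direct_sum_incl I V i v j))"
    using assms by (intro sum_desc_eq chomD(3)[OF direct_sum_incl_hom]) (auto simp: direct_sum_incl_def)
  also have "\<dots> = \<phi> i v"
    using assms chomD[OF \<phi>] by (subst W.M.finsum_insert) (auto simp: direct_sum_incl_def)
  finally show ?thesis .
qed

end

end


text \<open>\<open>W\<close> is not known to be a vector space beforehand: its axioms are carried
  over from \<open>V\<close> along the surjection \<open>f\<close>. The intended \<open>f\<close> is
  the map from vectors to cosets.\<close>

lemma chom_onto:
  assumes V: "cvec V" and W: "carrier W = f ` carrier V"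
    and zero: "f \<zero>\<^bsub>V\<^esub> = \<zero>\<^bsub>W\<^esub>"
    and add: "\<And>x y. x \<in> carrier V \<Longrightarrow> y \<in> carrier V \<Longrightarrow> f x \<oplus>\<^bsub>W\<^esub> f y = f (x \<oplus>\<^bsub>V\<^esub> y)"
    and smult: "\<And>c x. x \<in> carrier V \<Longrightarrow> c \<odot>\<^bsub>W\<^esub> f x = f (c \<odot>\<^bsub>V\<^esub> x)"
  shows "chom V W f"
proof -
  note ops = zero[symmetric] add smult cvecD(1-3,5,6,8-12)[OF V]
  have "cvec W"
  proof (rule cvecI)
    show "x \<oplus>\<^bsub>W\<^esub> y = y \<oplus>\<^bsub>W\<^esub> x" if "x \<in> carrier W" "y \<in> carrier W" for x y
      using that cvecD(4)[OF V] by (auto simp: W add intro!: arg_cong[of _ _ f])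
  qed (auto simp: W ops)
  then show ?thesis
    by (intro chomI[OF V]) (auto simp: W ops)
qed

section \<open>Quotients by a submodule\<close>

context
  fixes V :: "'v vect" and N :: "'v set"
  assumes V: "cvec V" and N: "LinearCombinations.submodule class_ring N V"
begin

text \<open>Gives access to the coset calculus of abelian groups. Closure under negation comes from
  closure under multiplication by \<open>-1\<close>.\<close>

lemma abelian_subgroup_submodule: "abelian_subgroup N V"
proof -
  interpret V: Module.module class_ring V by (rule V)
  interpret N: LinearCombinations.submodule class_ring N V by (rule N)
  have "\<ominus>\<^bsub>V\<^esub> x \<in> N" if "x \<in> N" for x
  proof -
    have "(- 1) \<odot>\<^bsub>V\<^esub> x \<in> N" using that N.smult_closed by simp
    moreover have "(- 1) \<odot>\<^bsub>V\<^esub> x = \<ominus>\<^bsub>V\<^esub> x"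
      using V.smult_minus_1[of x] that N.subset by (auto simp: class_ring_simps)
    ultimately show ?thesis by simp
  qed
  moreover have "N \<noteq> {}" using N.zero_closed by blast
  ultimately have "subgroup N (add_monoid V)"
    using N.subset N.m_closed V.M.add.subgroupI[of N]
    by (auto simp: a_inv_def[symmetric])
  then show ?thesis
    by (intro abelian_subgroupI3 additive_subgroupI V.M.abelian_group_axioms)
qed

interpretation V: Module.module class_ring V by (rule V)
interpretation N: abelian_subgroup N V by (rule abelian_subgroup_submodule)

lemma quotient_carrier: "carrier (quotient_space V N) = (\<lambda>x. N +>\<^bsub>V\<^esub> x) ` carrier V"
  by (auto simp: quotient_space_def A_RCOSETS_def')

lemma quotient_zero: "\<zero>\<^bsub>quotient_space V N\<^esub> = N +>\<^bsub>V\<^esub> \<zero>\<^bsub>V\<^esub>"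
  using N.a_rcos_const[of "\<zero>\<^bsub>V\<^esub>"] by (simp add: quotient_space_def)

lemma quotient_add:
  assumes "x \<in> carrier V" "y \<in> carrier V"
  shows "(N +>\<^bsub>V\<^esub> x) \<oplus>\<^bsub>quotient_space V N\<^esub> (N +>\<^bsub>V\<^esub> y) = N +>\<^bsub>V\<^esub> (x \<oplus>\<^bsub>V\<^esub> y)"
  using assms by (simp add: quotient_space_def N.a_rcos_sum)

lemma coset_eqI:
  assumes "x \<in> carrier V" "y \<in> carrier V" "y \<ominus>\<^bsub>V\<^esub> x \<in> N"
  shows "N +>\<^bsub>V\<^esub> x = N +>\<^bsub>V\<^esub> y"
  using assms by (intro N.a_repr_independence') (auto simp: N.a_rcos_module a_minus_def)

text \<open>The scalar action on the quotient is a union over all elements of a coset. All members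
  of this union are the same coset, because a difference lying in \<open>N\<close> stays in
  \<open>N\<close> when scaled.\<close>

lemma quotient_smult:
  assumes "x \<in> carrier V"
  shows "c \<odot>\<^bsub>quotient_space V N\<^esub> (N +>\<^bsub>V\<^esub> x) = N +>\<^bsub>V\<^esub> (c \<odot>\<^bsub>V\<^esub> x)"
proof -
  have "N +>\<^bsub>V\<^esub> (c \<odot>\<^bsub>V\<^esub> y) = N +>\<^bsub>V\<^esub> (c \<odot>\<^bsub>V\<^esub> x)" if "y \<in> N +>\<^bsub>V\<^esub> x" for y
  proof (rule coset_eqI)
    have y: "y \<in> carrier V" using N.a_elemrcos_carrier assms that by blast
    have "x \<ominus>\<^bsub>V\<^esub> y \<in> N"
      using that assms y N.a_repr_independence'[OF that assms] N.a_rcos_self[OF assms]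
      by (metis N.a_rcos_module a_minus_def)
    then have "c \<odot>\<^bsub>V\<^esub> (x \<ominus>\<^bsub>V\<^esub> y) \<in> N"
      using LinearCombinations.submodule.smult_closed[OF N] by simp
    then show "c \<odot>\<^bsub>V\<^esub> x \<ominus>\<^bsub>V\<^esub> c \<odot>\<^bsub>V\<^esub> y \<in> N"
      using assms y V.smult_r_distr[of c] V.smult_r_minus[of c] by (simp add: a_minus_def)
    show "c \<odot>\<^bsub>V\<^esub> y \<in> carrier V" "c \<odot>\<^bsub>V\<^esub> x \<in> carrier V"
      using y assms V.smult_closed by auto
  qed
  then have "(\<Union>y\<in>N +>\<^bsub>V\<^esub> x. N +>\<^bsub>V\<^esub> (c \<odot>\<^bsub>V\<^esub> y)) = N +>\<^bsub>V\<^esub> (c \<odot>\<^bsub>V\<^esub> x)"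
    by (intro UN_constant_eq[OF N.a_rcos_self[OF assms]] ballI)
  then show ?thesis by (simp only: quotient_space_def module.simps)
qed

lemma quotient_hom: "chom V (quotient_space V N) (\<lambda>x. N +>\<^bsub>V\<^esub> x)"
  by (rule chom_onto[OF V quotient_carrier quotient_zero[symmetric] quotient_add quotient_smult])

text \<open>A map that kills \<open>N\<close> is constant on cosets, which is what gives meaning to
  the \<open>the_elem\<close> in \<open>colim_desc\<close>.\<close>

lemma the_elem_image_coset:
  assumes f: "chom V W f" and ker: "\<And>x. x \<in> N \<Longrightarrow> f x = \<zero>\<^bsub>W\<^esub>" and x: "x \<in> carrier V"
  shows "the_elem (f ` (N +>\<^bsub>V\<^esub> x)) = f x"
proof -
  have "f (n \<oplus>\<^bsub>V\<^esub> x) = f x" if "n \<in> N" for n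
    using that x N.a_Hcarr[OF that] chomD(3)[OF f x]
    by (simp add: chomD(4)[OF f] ker cvecD(7)[OF chomD(2)[OF f]])
  then have "f ` (N +>\<^bsub>V\<^esub> x) = {f x}"
    using N.a_rcos_self[OF x] unfolding a_r_coset_def' by blast
  then show ?thesis by simp
qed

end

text \<open>The relations defining a colimit speak of one arrow at a time, so a graph of vector
  spaces and linear maps is the natural level of generality here.\<close>

definition diagram :: "('j, 'k) category \<Rightarrow> ('j, 'k, 'v) vfunctor \<Rightarrow> bool" where
  "diagram J D \<longleftrightarrow> (\<forall>j \<in> Obj J. cvec (omap D j)) \<and>
     (\<forall>h \<in> Arr J. Dom J h \<in> Obj J \<and> Cod J h \<in> Obj J \<and>
        chom (omap D (Dom J h)) (omap D (Cod J h)) (amap D h))"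

section \<open>Colimits and their universal property\<close>

context
  fixes J :: "('j, 'k) category" and D :: "('j, 'k, 'v) vfunctor"
  assumes D: "diagram J D"
begin

lemma diagram_obj: "j \<in> Obj J \<Longrightarrow> cvec (omap D j)"
  using D by (simp add: diagram_def)

lemma diagram_arr:
  assumes "h \<in> Arr J"
  shows "Dom J h \<in> Obj J" "Cod J h \<in> Obj J" "chom (omap D (Dom J h)) (omap D (Cod J h)) (amap D h)"
  using D assms by (auto simp: diagram_def)

abbreviation "rel_gens \<equiv> {direct_sum_incl (Obj J) (omap D) (Cod J h) (amap D h v)
        \<ominus>\<^bsub>colim_sum J D\<^esub> direct_sum_incl (Obj J) (omap D) (Dom J h) v
      | h v. h \<in> Arr J \<and> v \<in> carrier (omap D (Dom J h))}"

lemma colim_sum_cvec: "cvec (colim_sum J D)"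
  unfolding colim_sum_def by (rule cvec_direct_sum[OF diagram_obj])

lemma colim_sum_incl:
  "j \<in> Obj J \<Longrightarrow> chom (omap D j) (colim_sum J D) (direct_sum_incl (Obj J) (omap D) j)"
  unfolding colim_sum_def by (rule direct_sum_incl_hom[OF diagram_obj])

lemma rel_gens_subset: "rel_gens \<subseteq> carrier (colim_sum J D)"
proof -
  interpret Module.module class_ring "colim_sum J D" by (rule colim_sum_cvec)
  show ?thesis
    using chomD(3)[OF diagram_arr(3)] chomD(3)[OF colim_sum_incl] diagram_arr(1,2)
    by (auto intro!: M.minus_closed)
qed

lemma colim_rel_submodule: "LinearCombinations.submodule class_ring (colim_rel J D) (colim_sum J D)"
  unfolding colim_rel_def by (rule LinearCombinations.module.span_is_submodule[OF colim_sum_cvec rel_gens_subset])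

lemma colim_cvec: "cvec (colim J D)"
  unfolding colim_def by (rule chomD(2)[OF quotient_hom[OF colim_sum_cvec colim_rel_submodule]])

lemma colim_incl_hom:
  assumes "j \<in> Obj J" shows "chom (omap D j) (colim J D) (colim_incl J D j)"
proof -
  have "colim_incl J D j = (\<lambda>x. colim_rel J D +>\<^bsub>colim_sum J D\<^esub> x) \<circ> direct_sum_incl (Obj J) (omap D) j"
    by (simp add: colim_incl_def fun_eq_iff)
  then show ?thesis unfolding colim_def
    using chom_comp[OF quotient_hom[OF colim_sum_cvec colim_rel_submodule] colim_sum_incl[OF assms]]
    by simp
qed

lemma colim_incl_arr:
  assumes "h \<in> Arr J" "v \<in> carrier (omap D (Dom J h))"
  shows "colim_incl J D (Cod J h) (amap D h v) = colim_incl J D (Dom J h) v"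
  unfolding colim_incl_def
proof (rule coset_eqI[OF colim_sum_cvec colim_rel_submodule, symmetric])
  show "direct_sum_incl (Obj J) (omap D) (Cod J h) (amap D h v) \<ominus>\<^bsub>colim_sum J D\<^esub>
    direct_sum_incl (Obj J) (omap D) (Dom J h) v \<in> colim_rel J D"
    unfolding colim_rel_def
    using LinearCombinations.module.in_own_span[OF colim_sum_cvec rel_gens_subset] assms by blast
qed (use assms chomD(3)[OF diagram_arr(3)] chomD(3)[OF colim_sum_incl] diagram_arr(1,2) in auto)

text \<open>Existence in the universal property. The cocone condition says that the map on the
  direct sum kills each generating difference, hence their span, so it is constant on
  cosets.\<close>

lemma colim_desc_hom:
  assumes W: "cvec W" and \<phi>: "\<And>j. j \<in> Obj J \<Longrightarrow> chom (omap D j) W (\<phi> j)"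
    and cocone: "\<And>h v. h \<in> Arr J \<Longrightarrow> v \<in> carrier (omap D (Dom J h)) \<Longrightarrow>
      \<phi> (Cod J h) (amap D h v) = \<phi> (Dom J h) v"
  shows "chom (colim J D) W (colim_desc J D W \<phi>)"
    and "\<And>j v. j \<in> Obj J \<Longrightarrow> v \<in> carrier (omap D j) \<Longrightarrow>
      colim_desc J D W \<phi> (colim_incl J D j v) = \<phi> j v"
proof -
  interpret W: Module.module class_ring W by (rule W)
  define f where "f x = (\<Oplus>\<^bsub>W\<^esub>j\<in>{j \<in> Obj J. x j \<noteq> \<zero>\<^bsub>omap D j\<^esub>}. \<phi> j (x j))" for x
  have f: "chom (colim_sum J D) W f"
    unfolding f_def colim_sum_def using diagram_obj W \<phi> by (rule sum_desc_hom)
  have f_incl: "f (direct_sum_incl (Obj J) (omap D) j v) = \<phi> j v"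
    if "j \<in> Obj J" "v \<in> carrier (omap D j)" for j v
    unfolding f_def using diagram_obj W \<phi> that by (rule sum_desc_incl)
  interpret f: mod_hom class_ring "colim_sum J D" W f by (rule f)
  have "f x = \<zero>\<^bsub>W\<^esub>" if "x \<in> rel_gens" for x
    using that chomD(3)[OF diagram_arr(3)] chomD(3)[OF colim_sum_incl] diagram_arr(1,2)
    by (auto simp: f_incl cocone chomD(3)[OF \<phi>] W.M.r_neg a_minus_def)
  then have "rel_gens \<subseteq> f.ker"
    using rel_gens_subset unfolding f.ker_def by blast
  then have "colim_rel J D \<subseteq> f.ker"
    unfolding colim_rel_def by (intro f.M.span_is_subset f.ker_is_submodule)
  then have ker: "f x = \<zero>\<^bsub>W\<^esub>" if "x \<in> colim_rel J D" for x
    using that by (auto simp: f.ker_def)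
  have desc: "colim_desc J D W \<phi> (colim_rel J D +>\<^bsub>colim_sum J D\<^esub> x) = f x"
    if "x \<in> carrier (colim_sum J D)" for x
    unfolding colim_desc_def f_def[symmetric]
    by (rule the_elem_image_coset[OF colim_sum_cvec colim_rel_submodule f ker that])
  note q = quotient_carrier[OF colim_sum_cvec colim_rel_submodule]
    quotient_add[OF colim_sum_cvec colim_rel_submodule]
    quotient_smult[OF colim_sum_cvec colim_rel_submodule]
  show "chom (colim J D) W (colim_desc J D W \<phi>)"
    by (rule chomI[OF colim_cvec W])
      (auto simp: colim_def q desc chomD[OF f] cvecD(2,3)[OF colim_sum_cvec])
  show "colim_desc J D W \<phi> (colim_incl J D j v) = \<phi> j v"
    if "j \<in> Obj J" "v \<in> carrier (omap D j)" for j v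
    using that chomD(3)[OF colim_sum_incl] by (simp add: colim_incl_def desc f_incl)
qed

text \<open>Uniqueness in the universal property: every class comes from the direct sum by a linear
  map, and the direct sum is generated by its summands.\<close>

lemma colim_hom_eqI:
  assumes f: "chom (colim J D) W f" and g: "chom (colim J D) W g"
    and eq: "\<And>j v. j \<in> Obj J \<Longrightarrow> v \<in> carrier (omap D j) \<Longrightarrow>
      f (colim_incl J D j v) = g (colim_incl J D j v)"
    and X: "X \<in> carrier (colim J D)"
  shows "f X = g X"
proof -
  let ?S = "colim_sum J D" and ?q = "\<lambda>x. colim_rel J D +>\<^bsub>colim_sum J D\<^esub> x"
  note q = chomD[OF quotient_hom[OF colim_sum_cvec colim_rel_submodule, folded colim_def]]
  obtain x where x: "x \<in> carrier ?S" "X = ?q x"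
    using X quotient_carrier[OF colim_sum_cvec colim_rel_submodule] by (auto simp: colim_def)
  have "f (?q x) = g (?q x)"
  proof (rule direct_sum_induct[OF diagram_obj x(1)[unfolded colim_sum_def], folded colim_sum_def])
    show "f (?q \<zero>\<^bsub>?S\<^esub>) = g (?q \<zero>\<^bsub>?S\<^esub>)"
      by (simp only: q(6) chomD(6)[OF f] chomD(6)[OF g])
    show "f (?q (x \<oplus>\<^bsub>?S\<^esub> direct_sum_incl (Obj J) (omap D) i v)) =
        g (?q (x \<oplus>\<^bsub>?S\<^esub> direct_sum_incl (Obj J) (omap D) i v))"
      if "x \<in> carrier ?S" "i \<in> Obj J" "v \<in> carrier (omap D i)" "f (?q x) = g (?q x)" for x i v
      using that eq[of i v] q(3) chomD(3)[OF colim_sum_incl[of i], of v]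
      by (simp add: q(4) chomD(4)[OF f] chomD(4)[OF g] colim_incl_def)
  qed auto
  then show ?thesis using x by simp
qed

end

section \<open>Groupoids\<close>

lemma homsD:
  assumes "f \<in> homs C x y"
  shows "f \<in> Arr C" "Dom C f = x" "Cod C f = y"
  using assms by (auto simp: homs_def)

lemma arr_homs: "f \<in> Arr C \<Longrightarrow> f \<in> homs C (Dom C f) (Cod C f)"
  by (simp add: homs_def)

lemma (in category) homs_obj:
  assumes "f \<in> homs C x y"
  shows "x \<in> Obj C" "y \<in> Obj C"
  using assms dom_obj cod_obj by (auto simp: homs_def)

lemma groupoidI_homs:
  assumes "category C"
    and "\<And>x y f. f \<in> homs C x y \<Longrightarrow>
      \<exists>g \<in> homs C y x. Comp C g f = Ident C x \<and> Comp C f g = Ident C y"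
  shows "groupoid C"
proof (intro groupoid.intro groupoid_axioms.intro assms(1))
  fix f assume f: "f \<in> Arr C"
  from assms(2)[OF arr_homs[OF f]] f show "iso_arrow C f"
    unfolding iso_arrow_def inverse_arrows_def by blast
qed

context groupoid
begin

lemma inv_arrow:
  assumes f: "f \<in> homs C x y"
  shows "inv_arrow C f \<in> homs C y x" "Comp C (inv_arrow C f) f = Ident C x"
    "Comp C f (inv_arrow C f) = Ident C y"
proof -
  note fD = homsD[OF f]
  obtain g where g: "inverse_arrows C f g"
    using arr_iso[OF fD(1)] by (auto simp: iso_arrow_def)
  \<comment> \<open>\<open>inv_arrow\<close> is a definite description, so uniqueness of two-sided
    inverses must precede all of its properties.\<close>
  have "g' = g" if "inverse_arrows C f g'" for g'
  proof -
    have h: "g \<in> homs C y x" "g' \<in> homs C y x"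
      using g that fD by (auto simp: inverse_arrows_def)
    have "g' = Comp C g' (Comp C f g)"
      using g fD h comp_ident_right by (simp add: inverse_arrows_def)
    also have "\<dots> = Comp C (Comp C g' f) g"
      by (rule comp_assoc[OF h(1) f h(2)])
    also have "\<dots> = g"
      using that fD h comp_ident_left by (simp add: inverse_arrows_def)
    finally show ?thesis .
  qed
  then have "inv_arrow C f = g"
    unfolding inv_arrow_def using g by blast
  then show "inv_arrow C f \<in> homs C y x" "Comp C (inv_arrow C f) f = Ident C x"
    "Comp C f (inv_arrow C f) = Ident C y"
    using g fD by (auto simp: inverse_arrows_def)
qed

text \<open>In a groupoid a left inverse is already the inverse, so identifying an inverse later
  takes a single equation.\<close>

lemma inv_arrow_unique:
  assumes "f \<in> homs C x y" "g \<in> homs C y x" "Comp C g f = Ident C x"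
  shows "inv_arrow C f = g"
proof -
  have "inv_arrow C f = Comp C (Comp C g f) (inv_arrow C f)"
    using inv_arrow(1)[OF assms(1)] assms(3) comp_ident_left by simp
  also have "\<dots> = Comp C g (Comp C f (inv_arrow C f))"
    by (rule comp_assoc[OF inv_arrow(1)[OF assms(1)] assms(1,2), symmetric])
  also have "\<dots> = g"
    using inv_arrow(3)[OF assms(1)] assms(2) comp_ident_right by simp
  finally show ?thesis .
qed

lemma comp_inv_left:
  assumes "f \<in> homs C x y" "g \<in> homs C w x"
  shows "Comp C (inv_arrow C f) (Comp C f g) = g"
  using comp_assoc[OF assms(2,1) inv_arrow(1)[OF assms(1)]] inv_arrow(2)[OF assms(1)]
    comp_ident_left[OF assms(2)] by simp

lemma comp_inv_left':
  assumes "f \<in> homs C x y" "g \<in> homs C w y"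
  shows "Comp C f (Comp C (inv_arrow C f) g) = g"
  using comp_assoc[OF assms(2) inv_arrow(1)[OF assms(1)] assms(1)] inv_arrow(3)[OF assms(1)]
    comp_ident_left[OF assms(2)] by simp

lemma comp_inv_right:
  assumes "f \<in> homs C x y" "g \<in> homs C y z"
  shows "Comp C (Comp C g f) (inv_arrow C f) = g"
  using comp_assoc[OF inv_arrow(1)[OF assms(1)] assms] inv_arrow(3)[OF assms(1)]
    comp_ident_right[OF assms(2)] by simp

lemma comp_inv_right':
  assumes "f \<in> homs C x y" "g \<in> homs C x z"
  shows "Comp C (Comp C g (inv_arrow C f)) f = g"
  using comp_assoc[OF assms(1) inv_arrow(1)[OF assms(1)] assms(2)] inv_arrow(2)[OF assms(1)]
    comp_ident_right[OF assms(2)] by simp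

lemma inv_arrow_comp:
  assumes f: "f \<in> homs C x y" and g: "g \<in> homs C y z"
  shows "inv_arrow C (Comp C g f) = Comp C (inv_arrow C f) (inv_arrow C g)"
proof (rule inv_arrow_unique[OF comp_hom[OF f g]])
  show "Comp C (inv_arrow C f) (inv_arrow C g) \<in> homs C z x"
    using inv_arrow(1) f g comp_hom by blast
  show "Comp C (Comp C (inv_arrow C f) (inv_arrow C g)) (Comp C g f) = Ident C x"
    using comp_assoc[OF comp_hom[OF f g] inv_arrow(1)[OF g] inv_arrow(1)[OF f]]
      comp_inv_left[OF g f] inv_arrow(2)[OF f] by simp
qed

lemma inv_arrow_ident: "x \<in> Obj C \<Longrightarrow> inv_arrow C (Ident C x) = Ident C x"
  by (rule inv_arrow_unique) (auto intro: ident_hom comp_ident_left[OF ident_hom])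

lemma auts_eq: "auts C x = homs C x x"
  using arr_iso by (auto simp: auts_def homs_def)

lemma iso_rel_iff: "(x, y) \<in> iso_rel C \<longleftrightarrow> homs C x y \<noteq> {}"
  using arr_iso homs_obj by (auto simp: iso_rel_def) (metis homsD(1))

lemma equiv_iso_rel: "equiv (Obj C) (iso_rel C)"
proof (rule equivI)
  show "refl_on (Obj C) (iso_rel C)"
    using ident_hom by (auto simp: refl_on_def iso_rel_iff)
  show "iso_rel C \<subseteq> Obj C \<times> Obj C" by (auto simp: iso_rel_def)
  show "sym (iso_rel C)"
    using inv_arrow(1) by (fastforce simp: sym_def iso_rel_iff)
  show "trans (iso_rel C)"
    using comp_hom by (fastforce simp: trans_def iso_rel_iff)
qed

text \<open>Composition with \<open>f\<close> makes the hom-set a torsor under the automorphisms of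
  \<open>x\<close>.\<close>

lemma card_homs:
  assumes "f \<in> homs C x y"
  shows "card (homs C x y) = card (homs C x x)"
proof -
  have "bij_betw (Comp C f) (homs C x x) (homs C x y)"
    by (rule bij_betw_byWitness[where f' = "Comp C (inv_arrow C f)"])
      (use assms inv_arrow(1)[OF assms] in \<open>auto simp: comp_inv_left comp_inv_left' intro: comp_hom\<close>)
  then show ?thesis by (simp add: bij_betw_same_card)
qed

end

text \<open>Redundancy is deliberate: several triples over the same pair of objects can be
  isomorphic in the weak pullback, and demanding one object per class would bring back the choice of
  representatives.\<close>

definition covers :: "('o, 'm) category \<Rightarrow> 'o set \<Rightarrow> bool" where
  "covers C R \<longleftrightarrow> finite R \<and> R \<subseteq> Obj C \<and> (\<forall>x \<in> Obj C. \<exists>r \<in> R. homs C x r \<noteq> {})"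

text \<open>The part of essential finiteness that averages over a groupoid rely on. The weak pullback is
  seen to have it more directly than to be equivalent to a finite groupoid.\<close>

definition finitary_groupoid :: "('o, 'm) category \<Rightarrow> bool" where
  "finitary_groupoid C \<longleftrightarrow> groupoid C \<and> (\<exists>R. covers C R) \<and> (\<forall>x y. finite (homs C x y))"

text \<open>Let \<open>f\<close> and \<open>g\<close> be the equivalence with a finite
  \<open>K\<close>. The objects \<open>g(j)\<close> form a cover since \<eta> links \<open>x\<close>
  to \<open>g(f(x))\<close>. Hom-sets are finite since \<open>f\<close> is faithful: naturality
  recovers \<open>h\<close> from \<open>f(h)\<close> by cancelling the invertible component of
  \<eta>.\<close>

lemma ess_finite_imp_finitary:
  assumes "ess_finite_groupoid C"
  shows "finitary_groupoid C"
proof -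
  interpret C: groupoid C using assms by (simp add: ess_finite_groupoid_def)
  obtain K :: "(nat, nat) category" and f g \<eta> where K: "finite (Obj K)" "finite (Arr K)"
    and f: "cat_functor C K f" and g: "cat_functor K C g"
    and \<eta>: "nat_iso C C fident (g \<circ>\<^sub>F f) \<eta>"
    using assms by (auto simp: ess_finite_groupoid_def equivalent_cats_def)
  have \<eta>_hom: "\<eta> x \<in> homs C x (omap g (omap f x))" if "x \<in> Obj C" for x
    using \<eta> that by (auto simp: nat_iso_def fident_def fcomp_def)
  have \<eta>_nat: "Comp C (\<eta> y) h = Comp C (amap g (amap f h)) (\<eta> x)" if "h \<in> homs C x y" for x y h
    using \<eta> homsD[OF that] by (auto simp: nat_iso_def fident_def fcomp_def)
  have "covers C (omap g ` Obj K)"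
    using K(1) cat_functor.obj[OF g] cat_functor.obj[OF f] \<eta>_hom by (fastforce simp: covers_def)
  moreover have "finite (homs C x y)" for x y
  proof (rule finite_imageD)
    show "finite (amap f ` homs C x y)"
      by (rule finite_subset[OF _ K(2)]) (use cat_functor.arr[OF f] in \<open>auto simp: homs_def\<close>)
    show "inj_on (amap f) (homs C x y)"
    proof (rule inj_onI)
      fix h k assume h: "h \<in> homs C x y" and k: "k \<in> homs C x y" and eq: "amap f h = amap f k"
      have "Comp C (\<eta> y) h = Comp C (\<eta> y) k"
        using \<eta>_nat[OF h] \<eta>_nat[OF k] eq by simp
      then show "h = k"
        using C.comp_inv_left[OF \<eta>_hom h] C.comp_inv_left[OF \<eta>_hom k] C.homs_obj[OF h] by metis
    qed
  qed
  ultimately show ?thesis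
    using C.groupoid_axioms by (auto simp: finitary_groupoid_def)
qed

lemma fcomp_simps [simp]:
  "omap (g \<circ>\<^sub>F f) x = omap g (omap f x)" "amap (g \<circ>\<^sub>F f) h = amap g (amap f h)"
  by (auto simp: fcomp_def)

lemma cat_functor_comp:
  assumes "cat_functor D E g" "cat_functor C D f"
  shows "cat_functor C E (g \<circ>\<^sub>F f)"
proof -
  interpret g: cat_functor D E g by fact
  interpret f: cat_functor C D f by fact
  show ?thesis
    by unfold_locales (auto simp: f.obj g.obj f.ident g.ident intro: f.arr g.arr
        simp: f.comp g.comp[OF f.arr f.arr])
qed

lemma cat_functor_inv:
  assumes f: "cat_functor C D f" and C: "groupoid C" and D: "groupoid D" and h: "h \<in> homs C x y"
  shows "amap f (inv_arrow C h) = inv_arrow D (amap f h)"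
proof (rule groupoid.inv_arrow_unique[OF D, symmetric])
  interpret f: cat_functor C D f by fact
  show "amap f h \<in> homs D (omap f x) (omap f y)"
    "amap f (inv_arrow C h) \<in> homs D (omap f y) (omap f x)"
    using h groupoid.inv_arrow(1)[OF C h] by (auto intro: f.arr)
  show "Comp D (amap f (inv_arrow C h)) (amap f h) = Ident D (omap f x)"
    using f.comp[OF h groupoid.inv_arrow(1)[OF C h]] groupoid.inv_arrow(2)[OF C h]
      f.ident[OF f.S.homs_obj(1)[OF h]] by simp
qed

section \<open>Functors to vector spaces and their pushforwards\<close>

text \<open>Unlike \<^const>\<open>vect_functor\<close>, this does not ask for finite dimension, which pushforwards
  inherit only by an argument that the theorem does not need.\<close>

definition modf :: "('o, 'm) category \<Rightarrow> ('o, 'm, 'v) vfunctor \<Rightarrow> bool" where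
  "modf C F \<longleftrightarrow>
     (\<forall>x \<in> Obj C. cvec (omap F x)) \<and>
     (\<forall>x y. \<forall>h \<in> homs C x y. chom (omap F x) (omap F y) (amap F h)) \<and>
     (\<forall>x \<in> Obj C. \<forall>v \<in> carrier (omap F x). amap F (Ident C x) v = v) \<and>
     (\<forall>x y z. \<forall>h \<in> homs C x y. \<forall>k \<in> homs C y z. \<forall>v \<in> carrier (omap F x).
        amap F (Comp C k h) v = amap F k (amap F h v))"

lemma modfD:
  assumes "modf C F"
  shows "\<And>x. x \<in> Obj C \<Longrightarrow> cvec (omap F x)"
    and "\<And>h x y. h \<in> homs C x y \<Longrightarrow> chom (omap F x) (omap F y) (amap F h)"
    and "\<And>x v. x \<in> Obj C \<Longrightarrow> v \<in> carrier (omap F x) \<Longrightarrow> amap F (Ident C x) v = v"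
    and "\<And>x y z h k v. h \<in> homs C x y \<Longrightarrow> k \<in> homs C y z \<Longrightarrow> v \<in> carrier (omap F x) \<Longrightarrow>
        amap F (Comp C k h) v = amap F k (amap F h v)"
    and "\<And>x y h v. h \<in> homs C x y \<Longrightarrow> v \<in> carrier (omap F x) \<Longrightarrow> amap F h v \<in> carrier (omap F y)"
  using assms unfolding modf_def by (blast, blast, blast, blast, blast intro: chomD(3))

lemma vect_functor_imp_modf: "vect_functor C F \<Longrightarrow> modf C F"
  by (auto simp: vect_functor_def modf_def homs_def vectorspace_def linear_map_def)

lemma modf_comp:
  assumes F: "modf A F" and f: "cat_functor B A f"
  shows "modf B (F \<circ>\<^sub>F f)"
proof -
  interpret f: cat_functor B A f by fact
  show ?thesis
    unfolding modf_def
    by (auto simp: f.obj f.ident f.comp modfD(1,3)[OF F] intro: modfD(2)[OF F] f.arr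
        modfD(4)[OF F])
qed

lemma omap_push [simp]: "omap (push B A f G) a = push_obj B A f G a"
  by (simp add: push_def)

section \<open>The pushforward along one functor, in terms of generators\<close>

context
  fixes B :: "('b, 'm) category" and A :: "('a, 'n) category" and f :: "('b, 'm, 'a, 'n) ftor"
    and G :: "('b, 'm, 'v) vfunctor"
  assumes f: "cat_functor B A f" and G: "modf B G"
begin

interpretation f: cat_functor B A f by (rule f)

lemma comma_diagram: "diagram (comma B A f a) (G \<circ>\<^sub>F comma_proj)"
  using modfD(1,2)[OF G] by (auto simp: diagram_def comma_def comma_proj_def)

lemma push_cvec: "cvec (push_obj B A f G a)"
  unfolding push_obj_def by (rule colim_cvec[OF comma_diagram])

lemma push_incl_hom:
  assumes "b \<in> Obj B" "g \<in> homs A (omap f b) a"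
  shows "chom (omap G b) (push_obj B A f G a) (push_incl B A f G a b g)"
proof -
  have "(b, g) \<in> Obj (comma B A f a)" using assms by (simp add: comma_def)
  from colim_incl_hom[OF comma_diagram this] show ?thesis
    by (simp add: push_obj_def push_incl_def[abs_def] comma_proj_def)
qed

lemma push_incl_rel:
  assumes h: "h \<in> homs B b b'" and g: "g \<in> homs A (omap f b') a" and v: "v \<in> carrier (omap G b)"
  shows "push_incl B A f G a b' g (amap G h v) = push_incl B A f G a b (Comp A g (amap f h)) v"
proof -
  \<comment> \<open>The arrow of the comma category over \<open>h\<close> with target
    \<open>(b', g)\<close>; commutation over \<open>a\<close> forces its source to carry the
    composite of \<open>g\<close> with \<open>f(h)\<close>.\<close>
  let ?h = "((b, Comp A g (amap f h)), h, (b', g))"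
  have "?h \<in> Arr (comma B A f a)"
    using f.S.homs_obj[OF h] f.T.comp_hom[OF f.arr[OF h] g] g h by (auto simp: comma_def)
  from colim_incl_arr[OF comma_diagram this] v show ?thesis
    by (simp add: push_incl_def comma_proj_def comma_def)
qed

text \<open>The universal property of the colimit, read as that of a tensor product: a cocone on the
  comma category is a family of linear maps balanced over the arrows of \<open>B\<close>. Every map
  out of a pushforward below is constructed and evaluated through it.\<close>

lemma push_desc_hom:
  assumes W: "cvec W"
    and \<phi>: "\<And>b g. b \<in> Obj B \<Longrightarrow> g \<in> homs A (omap f b) a \<Longrightarrow> chom (omap G b) W (\<phi> b g)"
    and cocone: "\<And>b b' h g v. h \<in> homs B b b' \<Longrightarrow> g \<in> homs A (omap f b') a \<Longrightarrow>
      v \<in> carrier (omap G b) \<Longrightarrow> \<phi> b' g (amap G h v) = \<phi> b (Comp A g (amap f h)) v"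
  shows "chom (push_obj B A f G a) W (push_desc B A f G a W \<phi>)"
    and "\<And>b g v. b \<in> Obj B \<Longrightarrow> g \<in> homs A (omap f b) a \<Longrightarrow> v \<in> carrier (omap G b) \<Longrightarrow>
      push_desc B A f G a W \<phi> (push_incl B A f G a b g v) = \<phi> b g v"
proof -
  let ?J = "comma B A f a" and ?D = "G \<circ>\<^sub>F comma_proj"
  have obj: "chom (omap ?D j) W ((\<lambda>(b, g). \<phi> b g) j)" if "j \<in> Obj ?J" for j
    using that \<phi> by (auto simp: comma_def comma_proj_def)
  have arr: "(\<lambda>(b, g). \<phi> b g) (Cod ?J h) (amap ?D h v) = (\<lambda>(b, g). \<phi> b g) (Dom ?J h) v"
    if "h \<in> Arr ?J" "v \<in> carrier (omap ?D (Dom ?J h))" for h v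
    using that cocone by (auto simp: comma_def comma_proj_def)
  note desc = colim_desc_hom[OF comma_diagram W obj arr]
  show "chom (push_obj B A f G a) W (push_desc B A f G a W \<phi>)"
    using desc(1) by (simp add: push_obj_def push_desc_def)
  show "push_desc B A f G a W \<phi> (push_incl B A f G a b g v) = \<phi> b g v"
    if "b \<in> Obj B" "g \<in> homs A (omap f b) a" "v \<in> carrier (omap G b)" for b g v
    using desc(2)[of "(b, g)" v] that
    by (simp add: push_incl_def push_desc_def comma_proj_def comma_def)
qed

text \<open>The classes \<open>g \<otimes> v\<close> generate the pushforward, so this serves as
  extensionality for linear maps out of it.\<close>

lemma push_hom_eqI:
  assumes "chom (push_obj B A f G a) W p" "chom (push_obj B A f G a) W q"
    and "\<And>b g v. b \<in> Obj B \<Longrightarrow> g \<in> homs A (omap f b) a \<Longrightarrow> v \<in> carrier (omap G b) \<Longrightarrow>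
      p (push_incl B A f G a b g v) = q (push_incl B A f G a b g v)"
    and "X \<in> carrier (push_obj B A f G a)"
  shows "p X = q X"
  using comma_diagram assms(1,2)[unfolded push_obj_def] _ assms(4)[unfolded push_obj_def]
proof (rule colim_hom_eqI)
  fix j v assume "j \<in> Obj (comma B A f a)" "v \<in> carrier (omap (G \<circ>\<^sub>F comma_proj) j)"
  then show "p (colim_incl (comma B A f a) (G \<circ>\<^sub>F comma_proj) j v) =
      q (colim_incl (comma B A f a) (G \<circ>\<^sub>F comma_proj) j v)"
    using assms(3)[of "fst j" "snd j" v] by (auto simp: comma_def comma_proj_def push_incl_def)
qed

lemma push_amap:
  assumes k: "k \<in> homs A a a'"
  shows "chom (push_obj B A f G a) (push_obj B A f G a') (amap (push B A f G) k)"
    and "\<And>b g v. b \<in> Obj B \<Longrightarrow> g \<in> homs A (omap f b) a \<Longrightarrow> v \<in> carrier (omap G b) \<Longrightarrow>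
      amap (push B A f G) k (push_incl B A f G a b g v) = push_incl B A f G a' b (Comp A k g) v"
proof -
  have 1: "chom (omap G b) (push_obj B A f G a') (push_incl B A f G a' b (Comp A k g))"
    if "b \<in> Obj B" "g \<in> homs A (omap f b) a" for b g
    using that k by (intro push_incl_hom) (auto intro: f.T.comp_hom)
  have 2: "push_incl B A f G a' b' (Comp A k g) (amap G h v) =
      push_incl B A f G a' b (Comp A k (Comp A g (amap f h))) v"
    if "h \<in> homs B b b'" "g \<in> homs A (omap f b') a" "v \<in> carrier (omap G b)" for b b' h g v
    using that k push_incl_rel[OF that(1) f.T.comp_hom[OF that(2) k] that(3)]
      f.T.comp_assoc[OF f.arr[OF that(1)] that(2) k] by simp
  have eq: "amap (push B A f G) k = push_desc B A f G a (push_obj B A f G a')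
      (\<lambda>b g v. push_incl B A f G a' b (Comp A k g) v)"
    using homsD[OF k] by (simp add: push_def)
  show "chom (push_obj B A f G a) (push_obj B A f G a') (amap (push B A f G) k)"
    unfolding eq by (rule push_desc_hom(1)[OF push_cvec]) (erule (1) 1, erule (2) 2)
  show "amap (push B A f G) k (push_incl B A f G a b g v) = push_incl B A f G a' b (Comp A k g) v"
    if "b \<in> Obj B" "g \<in> homs A (omap f b) a" "v \<in> carrier (omap G b)" for b g v
    unfolding eq by (rule push_desc_hom(2)[OF push_cvec _ _ that]) (erule (1) 1, erule (2) 2)
qed

lemma chom_id: "cvec V \<Longrightarrow> chom V V (\<lambda>x. x)"
  by (intro chomI) auto

text \<open>On generators the functor laws become the identity and associativity laws of
  \<open>A\<close>. The result is needed so that a pushforward can be pushed forward again.\<close>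

lemma push_modf: "modf A (push B A f G)"
  unfolding modf_def
proof (intro conjI ballI allI)
  show "cvec (omap (push B A f G) x)" for x by (simp add: push_cvec)
  show "chom (omap (push B A f G) x) (omap (push B A f G) y) (amap (push B A f G) h)"
    if "h \<in> homs A x y" for x y h
    using push_amap(1)[OF that] by simp
  show "amap (push B A f G) (Ident A x) v = v"
    if x: "x \<in> Obj A" and v: "v \<in> carrier (omap (push B A f G) x)" for x v
    using push_amap(1)[OF f.T.ident_hom[OF x]] chom_id[OF push_cvec] _ v[simplified]
  proof (rule push_hom_eqI)
    show "amap (push B A f G) (Ident A x) (push_incl B A f G x b g v) = push_incl B A f G x b g v"
      if "b \<in> Obj B" "g \<in> homs A (omap f b) x" "v \<in> carrier (omap G b)" for b g v
      using push_amap(2)[OF f.T.ident_hom[OF x] that] f.T.comp_ident_left[OF that(2)] by simp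
  qed
  show "amap (push B A f G) (Comp A k h) v = amap (push B A f G) k (amap (push B A f G) h v)"
    if h: "h \<in> homs A x y" and k: "k \<in> homs A y z" and v: "v \<in> carrier (omap (push B A f G) x)"
    for x y z h k v
  proof -
    have "amap (push B A f G) (Comp A k h) v = (amap (push B A f G) k \<circ> amap (push B A f G) h) v"
      using push_amap(1)[OF f.T.comp_hom[OF h k]] chom_comp[OF push_amap(1)[OF k] push_amap(1)[OF h]]
        _ v[simplified]
    proof (rule push_hom_eqI)
      show "amap (push B A f G) (Comp A k h) (push_incl B A f G x b g v) =
          (amap (push B A f G) k \<circ> amap (push B A f G) h) (push_incl B A f G x b g v)"
        if "b \<in> Obj B" "g \<in> homs A (omap f b) x" "v \<in> carrier (omap G b)" for b g v
        using push_amap(2)[OF f.T.comp_hom[OF h k] that] push_amap(2)[OF h that]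
          push_amap(2)[OF k that(1) f.T.comp_hom[OF that(2) h] that(3)]
          f.T.comp_assoc[OF that(2) h k] by simp
    qed
    then show ?thesis by simp
  qed
qed

end

text \<open>Naturality of \<theta> turns the relation for \<open>G\<close> at an arrow
  \<open>h\<close> into the relation for \<open>G'\<close> at the same arrow, so the family is
  balanced.\<close>

lemma push_map_hom:
  fixes B :: "('b, 'm) category" and A :: "('a, 'n) category" and f :: "('b, 'm, 'a, 'n) ftor"
    and G :: "('b, 'm, 'v) vfunctor" and G' :: "('b, 'm, 'w) vfunctor"
  assumes f: "cat_functor B A f" and G: "modf B G" and G': "modf B G'"
    and \<theta>: "\<And>b. b \<in> Obj B \<Longrightarrow> chom (omap G b) (omap G' b) (\<theta> b)"
    and nat: "\<And>b b' h v. h \<in> homs B b b' \<Longrightarrow> v \<in> carrier (omap G b) \<Longrightarrow>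
      \<theta> b' (amap G h v) = amap G' h (\<theta> b v)"
  shows "chom (push_obj B A f G a) (push_obj B A f G' a) (push_map B A f G G' \<theta> a)"
    and "\<And>b g v. b \<in> Obj B \<Longrightarrow> g \<in> homs A (omap f b) a \<Longrightarrow> v \<in> carrier (omap G b) \<Longrightarrow>
      push_map B A f G G' \<theta> a (push_incl B A f G a b g v) = push_incl B A f G' a b g (\<theta> b v)"
proof -
  interpret f: cat_functor B A f by (rule f)
  have 1: "chom (omap G b) (push_obj B A f G' a) (\<lambda>v. push_incl B A f G' a b g (\<theta> b v))"
    if "b \<in> Obj B" "g \<in> homs A (omap f b) a" for b g
    using chom_comp[OF push_incl_hom[OF f G' that] \<theta>[OF that(1)]] by (simp add: comp_def)
  have 2: "push_incl B A f G' a b' g (\<theta> b' (amap G h v)) =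
      push_incl B A f G' a b (Comp A g (amap f h)) (\<theta> b v)"
    if "h \<in> homs B b b'" "g \<in> homs A (omap f b') a" "v \<in> carrier (omap G b)" for b b' h g v
    using push_incl_rel[OF f G' that(1,2) chomD(3)[OF \<theta> that(3)]] f.S.homs_obj(1)[OF that(1)]
      nat[OF that(1,3)] by simp
  show "chom (push_obj B A f G a) (push_obj B A f G' a) (push_map B A f G G' \<theta> a)"
    unfolding push_map_def
    by (rule push_desc_hom(1)[OF f G push_cvec[OF f G']]) (erule (1) 1, erule (2) 2)
  show "push_map B A f G G' \<theta> a (push_incl B A f G a b g v) = push_incl B A f G' a b g (\<theta> b v)"
    if "b \<in> Obj B" "g \<in> homs A (omap f b) a" "v \<in> carrier (omap G b)" for b g v
    unfolding push_map_def
    by (rule push_desc_hom(2)[OF f G push_cvec[OF f G'] _ _ that]) (erule (1) 1, erule (2) 2)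
qed

lemma left_counit_hom:
  fixes B :: "('b, 'm) category" and A :: "('a, 'n) category" and F :: "('a, 'n, 'v) vfunctor"
  assumes f: "cat_functor B A f" and F: "modf A F" and a: "a \<in> Obj A"
  shows "chom (push_obj B A f (F \<circ>\<^sub>F f) a) (omap F a) (left_counit B A f F a)"
    and "\<And>b g v. b \<in> Obj B \<Longrightarrow> g \<in> homs A (omap f b) a \<Longrightarrow> v \<in> carrier (omap F (omap f b)) \<Longrightarrow>
      left_counit B A f F a (push_incl B A f (F \<circ>\<^sub>F f) a b g v) = amap F g v"
proof -
  interpret f: cat_functor B A f by (rule f)
  note modf_Ff = modf_comp[OF F f]
  have 1: "chom (omap (F \<circ>\<^sub>F f) b) (omap F a) (amap F g)" if "g \<in> homs A (omap f b) a" for b g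
    using modfD(2)[OF F that] by simp
  have 2: "amap F g (amap (F \<circ>\<^sub>F f) h v) = amap F (Comp A g (amap f h)) v"
    if "h \<in> homs B b b'" "g \<in> homs A (omap f b') a" "v \<in> carrier (omap (F \<circ>\<^sub>F f) b)" for b b' h g v
    using modfD(4)[OF F f.arr[OF that(1)] that(2)] that(3) by simp
  show "chom (push_obj B A f (F \<circ>\<^sub>F f) a) (omap F a) (left_counit B A f F a)"
    unfolding left_counit_def
    by (rule push_desc_hom(1)[OF f modf_Ff modfD(1)[OF F a]]) (erule 1, erule (2) 2)
  show "left_counit B A f F a (push_incl B A f (F \<circ>\<^sub>F f) a b g v) = amap F g v"
    if "b \<in> Obj B" "g \<in> homs A (omap f b) a" "v \<in> carrier (omap F (omap f b))" for b g v
    unfolding left_counit_def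
    by (rule push_desc_hom(2)[OF f modf_Ff modfD(1)[OF F a] _ _ that(1,2)])
      (erule 1, erule (2) 2, use that in simp)
qed

text \<open>Required by \<open>push_map_hom\<close> when the counit is whiskered with the
  pushforward along a target leg.\<close>

lemma left_counit_natural:
  fixes B :: "('b, 'm) category" and A :: "('a, 'n) category" and F :: "('a, 'n, 'v) vfunctor"
  assumes f: "cat_functor B A f" and F: "modf A F" and k: "k \<in> homs A a a'"
    and X: "X \<in> carrier (push_obj B A f (F \<circ>\<^sub>F f) a)"
  shows "left_counit B A f F a' (amap (push B A f (F \<circ>\<^sub>F f)) k X) =
    amap F k (left_counit B A f F a X)"
proof -
  interpret f: cat_functor B A f by (rule f)
  note modf_Ff = modf_comp[OF F f]
  note aa = f.T.homs_obj[OF k]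
  have "(left_counit B A f F a' \<circ> amap (push B A f (F \<circ>\<^sub>F f)) k) X =
      (amap F k \<circ> left_counit B A f F a) X"
    using chom_comp[OF left_counit_hom(1)[OF f F aa(2)] push_amap(1)[OF f modf_Ff k]]
      chom_comp[OF modfD(2)[OF F k] left_counit_hom(1)[OF f F aa(1)]] _ X
  proof (rule push_hom_eqI[OF f modf_Ff])
    fix b g v assume b: "b \<in> Obj B" and g: "g \<in> homs A (omap f b) a"
      and v: "v \<in> carrier (omap (F \<circ>\<^sub>F f) b)"
    show "(left_counit B A f F a' \<circ> amap (push B A f (F \<circ>\<^sub>F f)) k)
          (push_incl B A f (F \<circ>\<^sub>F f) a b g v) =
        (amap F k \<circ> left_counit B A f F a) (push_incl B A f (F \<circ>\<^sub>F f) a b g v)"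
      using b g v f.T.comp_hom[OF g k]
      by (simp add: push_amap(2)[OF f modf_Ff k] left_counit_hom(2)[OF f F] aa modfD(4)[OF F g k])
  qed
  then show ?thesis by simp
qed

section \<open>The comparison of iterated pushforward and pushforward along a composite\<close>

context
  fixes C :: "('c, 'l) category" and B :: "('b, 'm) category" and A :: "('a, 'n) category"
    and g :: "('c, 'l, 'b, 'm) ftor" and f :: "('b, 'm, 'a, 'n) ftor"
    and G :: "('c, 'l, 'v) vfunctor"
  assumes g: "cat_functor C B g" and f: "cat_functor B A f" and G: "modf C G"
begin

interpretation f: cat_functor B A f by (rule f)
interpretation g: cat_functor C B g by (rule g)

lemmas functor_fg = cat_functor_comp[OF f g]

text \<open>\<open>push_merge\<close> is a descent whose values are again descents; here the outer
  arrow \<open>h\<close> is held fixed and the inner one is treated.\<close>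

lemma push_merge_inner:
  fixes a b h
  defines "\<psi> \<equiv> push_desc C B g G b (push_obj C A (f \<circ>\<^sub>F g) G a)
          (\<lambda>c k v. push_incl C A (f \<circ>\<^sub>F g) G a c (Comp A h (amap f k)) v)"
  assumes h: "h \<in> homs A (omap f b) a"
  shows "chom (push_obj C B g G b) (push_obj C A (f \<circ>\<^sub>F g) G a) \<psi>"
    and "\<And>c k v. c \<in> Obj C \<Longrightarrow> k \<in> homs B (omap g c) b \<Longrightarrow> v \<in> carrier (omap G c) \<Longrightarrow>
      \<psi> (push_incl C B g G b c k v) = push_incl C A (f \<circ>\<^sub>F g) G a c (Comp A h (amap f k)) v"
proof -
  have 1: "chom (omap G c) (push_obj C A (f \<circ>\<^sub>F g) G a)
      (\<lambda>v. push_incl C A (f \<circ>\<^sub>F g) G a c (Comp A h (amap f k)) v)"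
    if "c \<in> Obj C" "k \<in> homs B (omap g c) b" for c k
    using that f.T.comp_hom[OF f.arr[OF that(2)] h] by (intro push_incl_hom[OF functor_fg G]) auto
  have 2: "push_incl C A (f \<circ>\<^sub>F g) G a c' (Comp A h (amap f k)) (amap G l v) =
      push_incl C A (f \<circ>\<^sub>F g) G a c (Comp A h (amap f (Comp B k (amap g l)))) v"
    if "l \<in> homs C c c'" "k \<in> homs B (omap g c') b" "v \<in> carrier (omap G c)" for c c' l k v
  proof -
    have "Comp A h (amap f k) \<in> homs A (omap (f \<circ>\<^sub>F g) c') a"
      using f.T.comp_hom[OF f.arr[OF that(2)] h] by simp
    from push_incl_rel[OF functor_fg G that(1) this that(3)] show ?thesis
      using f.comp[OF g.arr[OF that(1)] that(2)]
        f.T.comp_assoc[OF f.arr[OF g.arr[OF that(1)]] f.arr[OF that(2)] h] by simp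
  qed
  show "chom (push_obj C B g G b) (push_obj C A (f \<circ>\<^sub>F g) G a) \<psi>"
    unfolding \<psi>_def
    by (rule push_desc_hom(1)[OF g G push_cvec[OF functor_fg G]]) (erule (1) 1, erule (2) 2)
  show "\<psi> (push_incl C B g G b c k v) = push_incl C A (f \<circ>\<^sub>F g) G a c (Comp A h (amap f k)) v"
    if "c \<in> Obj C" "k \<in> homs B (omap g c) b" "v \<in> carrier (omap G c)" for c k v
    unfolding \<psi>_def
    by (rule push_desc_hom(2)[OF g G push_cvec[OF functor_fg G] _ _ that]) (erule (1) 1, erule (2) 2)
qed

lemma push_merge_hom:
  shows "chom (push_obj B A f (push C B g G) a) (push_obj C A (f \<circ>\<^sub>F g) G a)
      (push_merge C B A g f G a)"
    and "\<And>b h c k v. b \<in> Obj B \<Longrightarrow> h \<in> homs A (omap f b) a \<Longrightarrow> c \<in> Obj C \<Longrightarrow>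
      k \<in> homs B (omap g c) b \<Longrightarrow> v \<in> carrier (omap G c) \<Longrightarrow>
      push_merge C B A g f G a
        (push_incl B A f (push C B g G) a b h (push_incl C B g G b c k v)) =
      push_incl C A (f \<circ>\<^sub>F g) G a c (Comp A h (amap f k)) v"
proof -
  note pG = push_modf[OF g G]
  define \<psi> where "\<psi> b h = push_desc C B g G b (push_obj C A (f \<circ>\<^sub>F g) G a)
          (\<lambda>c k v. push_incl C A (f \<circ>\<^sub>F g) G a c (Comp A h (amap f k)) v)" for b h
  note \<psi> = push_merge_inner[of _ _ a, folded \<psi>_def]
  have 1: "chom (omap (push C B g G) b) (push_obj C A (f \<circ>\<^sub>F g) G a) (\<psi> b h)"
    if "h \<in> homs A (omap f b) a" for b h
    using \<psi>(1)[OF that] by (simp add: omap_push)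
  have 2: "\<psi> b' h (amap (push C B g G) l X) = \<psi> b (Comp A h (amap f l)) X"
    if l: "l \<in> homs B b b'" and h: "h \<in> homs A (omap f b') a"
      and X: "X \<in> carrier (omap (push C B g G) b)" for b b' l h X
  proof -
    note hl = f.T.comp_hom[OF f.arr[OF l] h]
    \<comment> \<open>The arguments of the outer cocone are elements of a pushforward, so its
      balancing condition is an equality of maps on that pushforward and is in turn checked on
      generators.\<close>
    have "(\<psi> b' h \<circ> amap (push C B g G) l) X = \<psi> b (Comp A h (amap f l)) X"
      using chom_comp[OF \<psi>(1)[OF h] push_amap(1)[OF g G l]] \<psi>(1)[OF hl] _ X[unfolded omap_push]
    proof (rule push_hom_eqI[OF g G])
      fix c k v assume c: "c \<in> Obj C" and k: "k \<in> homs B (omap g c) b" and v: "v \<in> carrier (omap G c)"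
      show "(\<psi> b' h \<circ> amap (push C B g G) l) (push_incl C B g G b c k v) =
          \<psi> b (Comp A h (amap f l)) (push_incl C B g G b c k v)"
        using push_amap(2)[OF g G l c k v] \<psi>(2)[OF h c f.S.comp_hom[OF k l] v] \<psi>(2)[OF hl c k v]
          f.comp[OF k l] f.T.comp_assoc[OF f.arr[OF k] f.arr[OF l] h] by simp
    qed
    then show ?thesis by simp
  qed
  show "chom (push_obj B A f (push C B g G) a) (push_obj C A (f \<circ>\<^sub>F g) G a)
      (push_merge C B A g f G a)"
    unfolding push_merge_def \<psi>_def[symmetric]
    by (rule push_desc_hom(1)[OF f pG push_cvec[OF functor_fg G]]) (erule 1, erule (2) 2)
  show "push_merge C B A g f G a
        (push_incl B A f (push C B g G) a b h (push_incl C B g G b c k v)) =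
      push_incl C A (f \<circ>\<^sub>F g) G a c (Comp A h (amap f k)) v"
    if "b \<in> Obj B" "h \<in> homs A (omap f b) a" "c \<in> Obj C"
      "k \<in> homs B (omap g c) b" "v \<in> carrier (omap G c)" for b h c k v
    unfolding push_merge_def \<psi>_def[symmetric]
  proof (subst push_desc_hom(2)[OF f pG push_cvec[OF functor_fg G] _ _ that(1,2)])
    show "push_incl C B g G b c k v \<in> carrier (omap (push C B g G) b)"
      using chomD(3)[OF push_incl_hom[OF g G that(3,4)] that(5)] by (simp add: omap_push)
    show "\<psi> b h (push_incl C B g G b c k v) =
        push_incl C A (f \<circ>\<^sub>F g) G a c (Comp A h (amap f k)) v"
      by (rule \<psi>(2)[OF that(2-5)])
  qed (erule 1, erule (2) 2)
qed

text \<open>An arrow \<open>f(g c) \<rightarrow> a\<close> has the trivial factorization with an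
  identity in the inner slot, and the two layers of relations make this choice compatible with
  arrows of \<open>C\<close>.\<close>

lemma push_split_hom:
  shows "chom (push_obj C A (f \<circ>\<^sub>F g) G a) (push_obj B A f (push C B g G) a)
      (push_split C B A g f G a)"
    and "\<And>c h v. c \<in> Obj C \<Longrightarrow> h \<in> homs A (omap f (omap g c)) a \<Longrightarrow> v \<in> carrier (omap G c) \<Longrightarrow>
      push_split C B A g f G a (push_incl C A (f \<circ>\<^sub>F g) G a c h v) =
      push_incl B A f (push C B g G) a (omap g c) h
        (push_incl C B g G (omap g c) c (Ident B (omap g c)) v)"
proof -
  note pG = push_modf[OF g G]
  have 1: "chom (omap G c) (push_obj B A f (push C B g G) a)
      (\<lambda>v. push_incl B A f (push C B g G) a (omap g c) h
        (push_incl C B g G (omap g c) c (Ident B (omap g c)) v))"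
    if "c \<in> Obj C" "h \<in> homs A (omap (f \<circ>\<^sub>F g) c) a" for c h
  proof -
    have "h \<in> homs A (omap f (omap g c)) a" using that by simp
    from chom_comp[OF push_incl_hom[OF f pG g.obj[OF that(1)] this, unfolded omap_push]
        push_incl_hom[OF g G that(1) f.S.ident_hom[OF g.obj[OF that(1)]]]]
    show ?thesis by (simp add: comp_def)
  qed
  have 2: "push_incl B A f (push C B g G) a (omap g c') h
        (push_incl C B g G (omap g c') c' (Ident B (omap g c')) (amap G l v)) =
      push_incl B A f (push C B g G) a (omap g c) (Comp A h (amap (f \<circ>\<^sub>F g) l))
        (push_incl C B g G (omap g c) c (Ident B (omap g c)) v)"
    if l: "l \<in> homs C c c'" and h: "h \<in> homs A (omap (f \<circ>\<^sub>F g) c') a" and v: "v \<in> carrier (omap G c)"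
    for c c' l h v
  proof -
    note c = g.S.homs_obj[OF l]
    note i = f.S.ident_hom[OF g.obj[OF c(1)]] and i' = f.S.ident_hom[OF g.obj[OF c(2)]]
    \<comment> \<open>\<open>g(l)\<close> travels from the inner tensor to the outer one: the inner
      relation turns \<open>id \<otimes> G(l) v\<close> into \<open>g(l) \<otimes> v\<close>, which
      is the action of \<open>g(l)\<close> on \<open>id \<otimes> v\<close>; the outer relation then
      absorbs this action into \<open>h\<close>.\<close>
    have "push_incl C B g G (omap g c') c' (Ident B (omap g c')) (amap G l v) =
        push_incl C B g G (omap g c') c (amap g l) v"
      using push_incl_rel[OF g G l i' v] f.S.comp_ident_left[OF g.arr[OF l]] by simp
    also have "\<dots> = amap (push C B g G) (amap g l)
        (push_incl C B g G (omap g c) c (Ident B (omap g c)) v)"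
      using push_amap(2)[OF g G g.arr[OF l] c(1) i v] f.S.comp_ident_right[OF g.arr[OF l]] by simp
    finally show ?thesis
      using push_incl_rel[OF f pG g.arr[OF l], unfolded omap_push] h
        chomD(3)[OF push_incl_hom[OF g G c(1) i] v] by simp
  qed
  show "chom (push_obj C A (f \<circ>\<^sub>F g) G a) (push_obj B A f (push C B g G) a)
      (push_split C B A g f G a)"
    unfolding push_split_def
    by (rule push_desc_hom(1)[OF functor_fg G push_cvec[OF f pG]]) (erule (1) 1, erule (2) 2)
  show "push_split C B A g f G a (push_incl C A (f \<circ>\<^sub>F g) G a c h v) =
      push_incl B A f (push C B g G) a (omap g c) h
        (push_incl C B g G (omap g c) c (Ident B (omap g c)) v)"
    if "c \<in> Obj C" "h \<in> homs A (omap f (omap g c)) a" "v \<in> carrier (omap G c)" for c h v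
    unfolding push_split_def
    by (rule push_desc_hom(2)[OF functor_fg G push_cvec[OF f pG] _ _ that(1) _ that(3)])
      (erule (1) 1, erule (2) 2, use that in simp)
qed

end

section \<open>Averages over a finite groupoid\<close>

definition outs :: "('o, 'm) category \<Rightarrow> 'o set \<Rightarrow> 'o \<Rightarrow> 'm set" where
  "outs C E x = {h \<in> Arr C. Dom C h = x \<and> Cod C h \<in> E}"

text \<open>Inversion matches arrows in the two directions, so the count by automorphisms of the
  source also holds with those of the target.\<close>

lemma (in groupoid) card_homs':
  assumes "f \<in> homs C x y"
  shows "card (homs C x y) = card (homs C y y)"
proof -
  have "bij_betw (inv_arrow C) (homs C x y) (homs C y x)"
  proof (rule bij_betw_byWitness[where f' = "inv_arrow C"])
    have "inv_arrow C (inv_arrow C h) = h" if "h \<in> homs C x y" for h x y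
      using inv_arrow[OF that] that by (intro inv_arrow_unique) auto
    then show "\<forall>h\<in>homs C x y. inv_arrow C (inv_arrow C h) = h"
      "\<forall>h\<in>homs C y x. inv_arrow C (inv_arrow C h) = h" by auto
  qed (auto intro: inv_arrow(1))
  then show ?thesis
    using card_homs[OF inv_arrow(1)[OF assms]] by (simp add: bij_betw_same_card)
qed

text \<open>The orbit of \<open>b\<close> meets \<open>E\<close> in \<open>#(outs E b) / #Aut(b)\<close> objects, so weighting the elements
  of \<open>E\<close> by \<open>1 / #(outs E b)\<close> gives each isomorphism class the weight \<open>1 / #Aut(b)\<close>.\<close>

lemma sum_iso_classes_eq_sum_cover:
  fixes V :: "'v vect"
  assumes B: "finitary_groupoid B" and E: "covers B E" and V: "cvec V"
    and \<Phi>: "\<And>b. b \<in> Obj B \<Longrightarrow> \<Phi> b \<in> carrier V"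
    and inv: "\<And>b b' h. h \<in> homs B b b' \<Longrightarrow> \<Phi> b' = \<Phi> b"
    and rep: "\<And>c. c \<in> Obj B // iso_rel B \<Longrightarrow> rep c \<in> c"
  shows "finite (Obj B // iso_rel B)"
    and "(\<Oplus>\<^bsub>V\<^esub>c \<in> Obj B // iso_rel B. (1 / of_nat (card (auts B (rep c)))) \<odot>\<^bsub>V\<^esub> \<Phi> (rep c)) =
      (\<Oplus>\<^bsub>V\<^esub>b\<in>E. (1 / of_nat (card (outs B E b))) \<odot>\<^bsub>V\<^esub> \<Phi> b)"
proof -
  interpret B: groupoid B using B by (simp add: finitary_groupoid_def)
  interpret V: Module.module class_ring V by (rule V)
  note fin = B[unfolded finitary_groupoid_def, THEN conjunct2, THEN conjunct2, rule_format]
  let ?Q = "Obj B // iso_rel B"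
  have finE: "finite E" and EB: "E \<subseteq> Obj B" using E by (auto simp: covers_def)
  have QB: "c \<subseteq> Obj B" if "c \<in> ?Q" for c
    using in_quotient_imp_subset[OF B.equiv_iso_rel that] .
  have QI: "homs B x y \<noteq> {}" if "c \<in> ?Q" "x \<in> c" "y \<in> c" for c x y
    using quotient_eq_iff[OF B.equiv_iso_rel that(1,1) that(2,3)] by (simp add: B.iso_rel_iff)
  have Q_closed: "y \<in> c" if "c \<in> ?Q" "x \<in> c" "h \<in> homs B x y" for c x y h
    using in_quotient_imp_closed[OF B.equiv_iso_rel that(1,2)] that(3) by (auto simp: B.iso_rel_iff)
  have QE: "E \<inter> c \<noteq> {}" if c: "c \<in> ?Q" for c
  proof -
    obtain x where x: "x \<in> c" "x \<in> Obj B" using rep[OF c] QB[OF c] by blast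
    then obtain e h where "e \<in> E" "h \<in> homs B x e" using E by (fastforce simp: covers_def)
    then show ?thesis using Q_closed[OF c x(1)] by blast
  qed
  \<comment> \<open>Every class contains an element of the finite set \<open>E\<close>. Finiteness
    of the set of classes matters, because a sum over an infinite set is zero by convention.\<close>
  have "?Q \<subseteq> (\<lambda>e. iso_rel B `` {e}) ` E"
  proof
    fix c assume c: "c \<in> ?Q"
    obtain e where e: "e \<in> E" "e \<in> c" using QE[OF c] by blast
    then have "c = iso_rel B `` {e}"
      using B.equiv_iso_rel c by (metis Image_singleton_iff equiv_class_eq_iff quotientE)
    then show "c \<in> (\<lambda>e. iso_rel B `` {e}) ` E" using e by blast
  qed
  then show finQ: "finite ?Q" using finE finite_surj by blast
  have cl: "1 / of_nat k \<odot>\<^bsub>V\<^esub> \<Phi> b \<in> carrier V" if "b \<in> Obj B" for k b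
    using \<Phi>[OF that] cvecD(3)[OF V] by blast
  \<comment> \<open>An arrow from \<open>e\<close> into \<open>E\<close> ends in
    \<open>E \<inter> c\<close>, and all hom-sets inside one class have the size of the automorphism
    group of \<open>rep c\<close>.\<close>
  have card_outs: "card (outs B E e) = card (E \<inter> c) * card (auts B (rep c))"
    if c: "c \<in> ?Q" and e: "e \<in> E \<inter> c" for c e
  proof -
    have "outs B E e = (\<Union>e'\<in>E \<inter> c. homs B e e')"
      using Q_closed[OF c] e by (auto simp: outs_def homs_def)
    also have "card \<dots> = (\<Sum>e'\<in>E \<inter> c. card (homs B e e'))"
      using finE fin by (intro card_UN_disjoint) (auto simp: homs_def)
    also have "\<dots> = (\<Sum>e'\<in>E \<inter> c. card (auts B (rep c)))"
    proof (rule sum.cong[OF refl])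
      fix e' assume e': "e' \<in> E \<inter> c"
      obtain h k where h: "h \<in> homs B e e'" and k: "k \<in> homs B e (rep c)"
        using QI[OF c, of e e'] QI[OF c, of e "rep c"] e e' rep[OF c] by blast
      show "card (homs B e e') = card (auts B (rep c))"
        using B.card_homs[OF h] B.card_homs[OF k] B.card_homs'[OF k] by (simp add: B.auts_eq)
    qed
    finally show ?thesis by simp
  qed
  have disj: "pairwise (\<lambda>c d. disjnt (E \<inter> c) (E \<inter> d)) ?Q"
    using quotient_disj[OF B.equiv_iso_rel] unfolding pairwise_def disjnt_def by blast
  have eq: "E = (\<Union>c\<in>?Q. E \<inter> c)"
    using Union_quotient[OF B.equiv_iso_rel] EB by blast
  have "(\<Oplus>\<^bsub>V\<^esub>b\<in>E. (1 / of_nat (card (outs B E b))) \<odot>\<^bsub>V\<^esub> \<Phi> b) =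
      (\<Oplus>\<^bsub>V\<^esub>c\<in>?Q. \<Oplus>\<^bsub>V\<^esub>b\<in>E \<inter> c. (1 / of_nat (card (outs B E b))) \<odot>\<^bsub>V\<^esub> \<Phi> b)"
    using finQ finE cl EB disj by (subst (1) eq, intro V.M.add.finprod_UN_disjoint) auto
  also have "\<dots> = (\<Oplus>\<^bsub>V\<^esub>c \<in> ?Q. (1 / of_nat (card (auts B (rep c)))) \<odot>\<^bsub>V\<^esub> \<Phi> (rep c))"
  proof (intro V.M.finsum_cong' refl)
    show "(\<lambda>c. (1 / of_nat (card (auts B (rep c)))) \<odot>\<^bsub>V\<^esub> \<Phi> (rep c)) \<in> ?Q \<rightarrow> carrier V"
      using rep QB cl by blast
    fix c assume c: "c \<in> ?Q"
    let ?n = "card (E \<inter> c)" and ?m = "card (auts B (rep c))"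
    have rc: "rep c \<in> Obj B" using rep[OF c] QB[OF c] by blast
    have "(\<Oplus>\<^bsub>V\<^esub>b\<in>E \<inter> c. (1 / of_nat (card (outs B E b))) \<odot>\<^bsub>V\<^esub> \<Phi> b) =
        (\<Oplus>\<^bsub>V\<^esub>b\<in>E \<inter> c. (1 / of_nat (?n * ?m)) \<odot>\<^bsub>V\<^esub> \<Phi> (rep c))"
    proof (intro V.M.finsum_cong' refl)
      show "(\<lambda>b. (1 / of_nat (?n * ?m)) \<odot>\<^bsub>V\<^esub> \<Phi> (rep c)) \<in> E \<inter> c \<rightarrow> carrier V"
        using cl[OF rc] by blast
      fix b assume b: "b \<in> E \<inter> c"
      obtain h where "h \<in> homs B b (rep c)" using QI[OF c] rep[OF c] b by blast
      then show "(1 / of_nat (card (outs B E b))) \<odot>\<^bsub>V\<^esub> \<Phi> b =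
          (1 / of_nat (?n * ?m)) \<odot>\<^bsub>V\<^esub> \<Phi> (rep c)"
        using inv card_outs[OF c b] by simp
    qed
    also have "\<dots> = (of_nat ?n * (1 / of_nat (?n * ?m))) \<odot>\<^bsub>V\<^esub> \<Phi> (rep c)"
      using finE by (intro finsum_scaled_const[OF V _ \<Phi>[OF rc]]) auto
    \<comment> \<open>The class meets \<open>E\<close>, so \<open>?n\<close> is nonzero and
      cancels.\<close>
    also have "of_nat ?n * (1 / of_nat (?n * ?m)) = (1 / of_nat ?m :: complex)"
      using QE[OF c] finE by (simp add: field_simps)
    finally show "(\<Oplus>\<^bsub>V\<^esub>b\<in>E \<inter> c. (1 / of_nat (card (outs B E b))) \<odot>\<^bsub>V\<^esub> \<Phi> b) =
        (1 / of_nat ?m) \<odot>\<^bsub>V\<^esub> \<Phi> (rep c)" .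
  qed
  finally show "(\<Oplus>\<^bsub>V\<^esub>c \<in> ?Q. (1 / of_nat (card (auts B (rep c)))) \<odot>\<^bsub>V\<^esub> \<Phi> (rep c)) =
      (\<Oplus>\<^bsub>V\<^esub>b\<in>E. (1 / of_nat (card (outs B E b))) \<odot>\<^bsub>V\<^esub> \<Phi> b)" by simp
qed

section \<open>The right unit\<close>

lemma chom_cong:
  assumes f: "chom V W f" and eq: "\<And>x. x \<in> carrier V \<Longrightarrow> g x = f x"
  shows "chom V W g"
  by (rule chomI[OF chomD(1,2)[OF f]])
    (simp_all add: eq chomD[OF f] cvecD(2,3)[OF chomD(1)[OF f]])

text \<open>A unit evaluated over a cover is a weighted double sum; with this, the linear stages
  that follow it act on the individual terms.\<close>

lemma chom_weighted_sum:
  assumes L: "chom U W L" and p: "\<And>y g. y \<in> E \<Longrightarrow> g \<in> H y \<Longrightarrow> p y g \<in> carrier U"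
  shows "L (\<Oplus>\<^bsub>U\<^esub>y\<in>E. c y \<odot>\<^bsub>U\<^esub> (\<Oplus>\<^bsub>U\<^esub>g\<in>H y. p y g)) =
    (\<Oplus>\<^bsub>W\<^esub>y\<in>E. c y \<odot>\<^bsub>W\<^esub> (\<Oplus>\<^bsub>W\<^esub>g\<in>H y. L (p y g)))"
proof -
  interpret U: Module.module class_ring U by (rule chomD(1)[OF L])
  interpret W: Module.module class_ring W by (rule chomD(2)[OF L])
  have s: "(\<Oplus>\<^bsub>U\<^esub>g\<in>H y. p y g) \<in> carrier U" if "y \<in> E" for y
    using p[OF that] by (intro U.M.finsum_closed) blast
  have s': "(\<Oplus>\<^bsub>W\<^esub>g\<in>H y. L (p y g)) \<in> carrier W" if "y \<in> E" for y
    using chomD(3)[OF L p[OF that]] by (intro W.M.finsum_closed) blast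
  have "L (\<Oplus>\<^bsub>U\<^esub>y\<in>E. c y \<odot>\<^bsub>U\<^esub> (\<Oplus>\<^bsub>U\<^esub>g\<in>H y. p y g)) =
      (\<Oplus>\<^bsub>W\<^esub>y\<in>E. L (c y \<odot>\<^bsub>U\<^esub> (\<Oplus>\<^bsub>U\<^esub>g\<in>H y. p y g)))"
    by (rule chom_finsum[OF L cvecD(3)[OF chomD(1)[OF L] s]])
  also have "\<dots> = (\<Oplus>\<^bsub>W\<^esub>y\<in>E. c y \<odot>\<^bsub>W\<^esub> (\<Oplus>\<^bsub>W\<^esub>g\<in>H y. L (p y g)))"
  proof (intro W.M.finsum_cong' refl)
    show "(\<lambda>y. c y \<odot>\<^bsub>W\<^esub> (\<Oplus>\<^bsub>W\<^esub>g\<in>H y. L (p y g))) \<in> E \<rightarrow> carrier W"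
      using cvecD(3)[OF chomD(2)[OF L] s'] by blast
    show "L (c y \<odot>\<^bsub>U\<^esub> (\<Oplus>\<^bsub>U\<^esub>g\<in>H y. p y g)) = c y \<odot>\<^bsub>W\<^esub> (\<Oplus>\<^bsub>W\<^esub>g\<in>H y. L (p y g))"
      if "y \<in> E" for y
    proof -
      have "L (\<Oplus>\<^bsub>U\<^esub>g\<in>H y. p y g) = (\<Oplus>\<^bsub>W\<^esub>g\<in>H y. L (p y g))"
        by (rule chom_finsum[OF L p[OF that]])
      then show ?thesis using chomD(5)[OF L s[OF that]] by simp
    qed
  qed
  finally show ?thesis .
qed

lemma weighted_sum_cong:
  assumes W: "cvec W" and q: "\<And>y g. y \<in> E \<Longrightarrow> g \<in> H y \<Longrightarrow> q y g \<in> carrier W"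
    and "\<And>y g. y \<in> E \<Longrightarrow> g \<in> H y \<Longrightarrow> p y g = q y g"
  shows "(\<Oplus>\<^bsub>W\<^esub>y\<in>E. c y \<odot>\<^bsub>W\<^esub> (\<Oplus>\<^bsub>W\<^esub>g\<in>H y. p y g)) =
    (\<Oplus>\<^bsub>W\<^esub>y\<in>E. c y \<odot>\<^bsub>W\<^esub> (\<Oplus>\<^bsub>W\<^esub>g\<in>H y. q y g))"
proof -
  interpret W: Module.module class_ring W by (rule W)
  have s: "(\<Oplus>\<^bsub>W\<^esub>g\<in>H y. q y g) \<in> carrier W" if "y \<in> E" for y
    using q[OF that] by (intro W.M.finsum_closed) blast
  have "(\<Oplus>\<^bsub>W\<^esub>g\<in>H y. p y g) = (\<Oplus>\<^bsub>W\<^esub>g\<in>H y. q y g)" if "y \<in> E" for y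
    using q[OF that] assms(3)[OF that] by (intro W.M.finsum_cong' refl) blast+
  then show ?thesis
    using cvecD(3)[OF W s] by (intro W.M.finsum_cong' refl) auto
qed

context
  fixes B :: "('b, 'm) category" and A :: "('a, 'n) category" and f :: "('b, 'm, 'a, 'n) ftor"
    and F :: "('a, 'n, 'v) vfunctor"
  assumes f: "cat_functor B A f" and B: "finitary_groupoid B" and A: "finitary_groupoid A"
    and F: "modf A F"
begin

interpretation f: cat_functor B A f by (rule f)
interpretation A: groupoid A using A by (simp add: finitary_groupoid_def)
interpretation B: groupoid B using B by (simp add: finitary_groupoid_def)

lemmas modf_Ff = modf_comp[OF F f]

abbreviation "unit_space a \<equiv> push_obj B A f (F \<circ>\<^sub>F f) a"
abbreviation "unit_term a v b g \<equiv> push_incl B A f (F \<circ>\<^sub>F f) a b (inv_arrow A g) (amap F g v)"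
abbreviation "unit_sum a v b \<equiv> \<Oplus>\<^bsub>unit_space a\<^esub>g \<in> homs A a (omap f b). unit_term a v b g"

lemma unit_term_hom:
  assumes "b \<in> Obj B" "g \<in> homs A a (omap f b)"
  shows "chom (omap F a) (unit_space a) (\<lambda>v. unit_term a v b g)"
proof -
  have "chom (omap (F \<circ>\<^sub>F f) b) (unit_space a) (push_incl B A f (F \<circ>\<^sub>F f) a b (inv_arrow A g))"
    using assms by (intro push_incl_hom[OF f modf_Ff] A.inv_arrow(1))
  then have "chom (omap F (omap f b)) (unit_space a) (push_incl B A f (F \<circ>\<^sub>F f) a b (inv_arrow A g))"
    by simp
  from chom_comp[OF this modfD(2)[OF F assms(2)]] show ?thesis by (simp add: comp_def)
qed

lemma unit_sum_closed:
  assumes "b \<in> Obj B" "v \<in> carrier (omap F a)"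
  shows "unit_sum a v b \<in> carrier (unit_space a)"
proof -
  interpret U: Module.module class_ring "unit_space a" by (rule push_cvec[OF f modf_Ff])
  show ?thesis
    using chomD(3)[OF unit_term_hom[OF assms(1)] assms(2)] by (intro U.M.finsum_closed) blast
qed

text \<open>Reindex by \<open>g \<mapsto> f(h) g\<close>. The relation of the pushforward moves
  \<open>f(h)\<close> across the tensor sign, where it cancels: \<open>g\<inverse> f(h)\<inverse>
  \<otimes> F(f(h)) F(g) v = g\<inverse> \<otimes> F(g) v\<close>.\<close>

lemma unit_sum_iso:
  assumes h: "h \<in> homs B b b'" and v: "v \<in> carrier (omap F a)"
  shows "unit_sum a v b' = unit_sum a v b"
proof -
  interpret U: Module.module class_ring "unit_space a" by (rule push_cvec[OF f modf_Ff])
  note bb = f.S.homs_obj[OF h] and fh = f.arr[OF h]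
  let ?k = "\<lambda>g. Comp A (amap f h) g"
  have bij: "bij_betw ?k (homs A a (omap f b)) (homs A a (omap f b'))"
    by (rule bij_betw_byWitness[where f' = "Comp A (inv_arrow A (amap f h))"])
      (use A.comp_inv_left[OF fh] A.comp_inv_left'[OF fh] f.T.comp_hom[OF _ fh]
        f.T.comp_hom[OF _ A.inv_arrow(1)[OF fh]] in auto)
  have "unit_sum a v b' = (\<Oplus>\<^bsub>unit_space a\<^esub>g \<in> ?k ` homs A a (omap f b). unit_term a v b' g)"
    using bij by (simp add: bij_betw_def)
  also have "\<dots> = (\<Oplus>\<^bsub>unit_space a\<^esub>g \<in> homs A a (omap f b). unit_term a v b' (?k g))"
    using bij chomD(3)[OF unit_term_hom[OF bb(2)] v]
    by (intro U.M.finsum_reindex) (auto simp: bij_betw_def)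
  also have "\<dots> = unit_sum a v b"
  proof (intro U.M.finsum_cong' refl)
    show "unit_term a v b \<in> homs A a (omap f b) \<rightarrow> carrier (unit_space a)"
      using chomD(3)[OF unit_term_hom[OF bb(1)] v] by blast
    fix g assume g: "g \<in> homs A a (omap f b)"
    have i: "inv_arrow A (?k g) \<in> homs A (omap f b') a"
      using A.inv_arrow(1)[OF f.T.comp_hom[OF g fh]] .
    have "unit_term a v b' (?k g) = push_incl B A f (F \<circ>\<^sub>F f) a b' (inv_arrow A (?k g))
        (amap (F \<circ>\<^sub>F f) h (amap F g v))"
      using modfD(4)[OF F g fh v] by simp
    also have "\<dots> = push_incl B A f (F \<circ>\<^sub>F f) a b (Comp A (inv_arrow A (?k g)) (amap f h)) (amap F g v)"
      using modfD(5)[OF F g v] by (intro push_incl_rel[OF f modf_Ff h i]) simp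
    also have "Comp A (inv_arrow A (?k g)) (amap f h) = inv_arrow A g"
      using A.inv_arrow_comp[OF g fh] A.comp_inv_right'[OF fh A.inv_arrow(1)[OF g]]
        A.inv_arrow by (simp add: A.comp_inv_right'[OF fh])
    finally show "unit_term a v b' (?k g) = unit_term a v b g" .
  qed
  finally show ?thesis .
qed

text \<open>By \<open>unit_sum_iso\<close> the summands depend only on the isomorphism class, so the
  passage from classes to a cover applies. From here on the representatives chosen by
  \<open>SOME\<close> no longer appear outside this argument.\<close>

lemma right_unit_eq:
  assumes E: "covers B E" and v: "v \<in> carrier (omap F a)"
  shows "right_unit B A f F a v =
    (\<Oplus>\<^bsub>unit_space a\<^esub>b\<in>E. (1 / of_nat (card (outs B E b))) \<odot>\<^bsub>unit_space a\<^esub> unit_sum a v b)"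
proof -
  interpret U: Module.module class_ring "unit_space a" by (rule push_cvec[OF f modf_Ff])
  define rep :: "'b set \<Rightarrow> 'b" where "rep c = (SOME b. b \<in> c)" for c
  let ?Q = "Obj B // iso_rel B"
  have rep: "rep c \<in> c" if "c \<in> ?Q" for c
    using in_quotient_imp_non_empty[OF B.equiv_iso_rel that] by (simp add: rep_def some_in_eq)
  have rep_obj: "rep c \<in> Obj B" if "c \<in> ?Q" for c
    using rep[OF that] in_quotient_imp_subset[OF B.equiv_iso_rel that] by blast
  note sum = sum_iso_classes_eq_sum_cover[OF B E U.module_axioms unit_sum_closed[OF _ v]
      unit_sum_iso[OF _ v] rep]
  have "right_unit B A f F a v = (\<Oplus>\<^bsub>unit_space a\<^esub>c \<in> {c \<in> ?Q. (omap f (rep c), a) \<in> iso_rel A}.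
      (1 / of_nat (card (auts B (rep c)))) \<odot>\<^bsub>unit_space a\<^esub> unit_sum a v (rep c))"
    by (simp add: right_unit_def rep_def Let_def)
  also have "\<dots> = (\<Oplus>\<^bsub>unit_space a\<^esub>c \<in> ?Q.
      (1 / of_nat (card (auts B (rep c)))) \<odot>\<^bsub>unit_space a\<^esub> unit_sum a v (rep c))"
  \<comment> \<open>\<open>right_unit\<close> keeps only the classes whose image is isomorphic to
    \<open>a\<close>. For all others the inner sum is over an empty hom-set, so including them
    changes nothing.\<close>
  proof (rule U.M.add.finprod_mono_neutral_cong_left)
    show "finite ?Q" by (rule sum(1))
    fix c assume c: "c \<in> ?Q - {c \<in> ?Q. (omap f (rep c), a) \<in> iso_rel A}"
    have "homs A a (omap f (rep c)) = {}"
      using c A.inv_arrow(1) unfolding A.iso_rel_iff by fastforce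
    then show "(1 / of_nat (card (auts B (rep c)))) \<odot>\<^bsub>unit_space a\<^esub> unit_sum a v (rep c) =
        \<zero>\<^bsub>unit_space a\<^esub>"
      using cvecD(13)[OF U.module_axioms] by (simp del: U.smult_r_null)
  qed (use cvecD(3)[OF U.module_axioms unit_sum_closed[OF rep_obj v]] in auto)
  also have "\<dots> = (\<Oplus>\<^bsub>unit_space a\<^esub>b\<in>E. (1 / of_nat (card (outs B E b))) \<odot>\<^bsub>unit_space a\<^esub> unit_sum a v b)"
    by (rule sum(2))
  finally show ?thesis .
qed

lemma right_unit_hom:
  assumes a: "a \<in> Obj A"
  shows "chom (omap F a) (unit_space a) (right_unit B A f F a)"
proof -
  obtain E where E: "covers B E" using B by (auto simp: finitary_groupoid_def)
  then have EB: "E \<subseteq> Obj B" by (simp add: covers_def)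
  note U = push_cvec[OF f modf_Ff] and Fa = modfD(1)[OF F a]
  have "chom (omap F a) (unit_space a) (\<lambda>v. \<Oplus>\<^bsub>unit_space a\<^esub>b\<in>E.
      (1 / of_nat (card (outs B E b))) \<odot>\<^bsub>unit_space a\<^esub> unit_sum a v b)"
  proof (rule chom_finsum_maps[OF Fa U])
    fix b assume "b \<in> E"
    then have b: "b \<in> Obj B" using EB by blast
    have "chom (omap F a) (unit_space a) (\<lambda>v. unit_sum a v b)"
      by (rule chom_finsum_maps[OF Fa U unit_term_hom[OF b]])
    from chom_comp[OF chom_smult[OF U] this]
    show "chom (omap F a) (unit_space a)
        (\<lambda>v. (1 / of_nat (card (outs B E b))) \<odot>\<^bsub>unit_space a\<^esub> unit_sum a v b)"
      by (simp add: comp_def)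
  qed
  then show ?thesis
    by (rule chom_cong) (rule right_unit_eq[OF E])
qed

text \<open>Reindex by \<open>g \<mapsto> g k\<close> and use
  \<open>k (g k)\<inverse> = g\<inverse>\<close>. The cover and its weights live in
  \<open>B\<close>, so they are the same at \<open>a\<close> and \<open>a'\<close>.\<close>

lemma right_unit_natural:
  assumes k: "k \<in> homs A a a'" and v: "v \<in> carrier (omap F a)"
  shows "amap (push B A f (F \<circ>\<^sub>F f)) k (right_unit B A f F a v) =
    right_unit B A f F a' (amap F k v)"
proof -
  obtain E where E: "covers B E" using B by (auto simp: finitary_groupoid_def)
  then have EB: "b \<in> Obj B" if "b \<in> E" for b using that by (auto simp: covers_def)
  interpret U: Module.module class_ring "unit_space a'" by (rule push_cvec[OF f modf_Ff])
  note kv = modfD(5)[OF F k v]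
  let ?P = "amap (push B A f (F \<circ>\<^sub>F f)) k"
  have sum: "(\<Oplus>\<^bsub>unit_space a'\<^esub>g \<in> homs A a (omap f b). ?P (unit_term a v b g)) =
      unit_sum a' (amap F k v) b" if "b \<in> E" for b
  proof -
    note b = EB[OF that]
    let ?k = "\<lambda>g. Comp A g k"
    have bij: "bij_betw ?k (homs A a' (omap f b)) (homs A a (omap f b))"
      by (rule bij_betw_byWitness[where f' = "\<lambda>g. Comp A g (inv_arrow A k)"])
        (use A.comp_inv_right[OF k] A.comp_inv_right'[OF k] f.T.comp_hom[OF k]
          f.T.comp_hom[OF A.inv_arrow(1)[OF k]] in auto)
    have cl: "?P (unit_term a v b g) \<in> carrier (unit_space a')" if "g \<in> homs A a (omap f b)" for g
      using chomD(3)[OF push_amap(1)[OF f modf_Ff k] chomD(3)[OF unit_term_hom[OF b that] v]] .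
    have "(\<Oplus>\<^bsub>unit_space a'\<^esub>g \<in> homs A a (omap f b). ?P (unit_term a v b g)) =
        (\<Oplus>\<^bsub>unit_space a'\<^esub>g \<in> ?k ` homs A a' (omap f b). ?P (unit_term a v b g))"
      using bij by (simp add: bij_betw_def)
    also have "\<dots> = (\<Oplus>\<^bsub>unit_space a'\<^esub>g \<in> homs A a' (omap f b). ?P (unit_term a v b (?k g)))"
      using bij cl by (intro U.M.finsum_reindex) (auto simp: bij_betw_def)
    also have "\<dots> = unit_sum a' (amap F k v) b"
    proof (intro U.M.finsum_cong' refl)
      show "unit_term a' (amap F k v) b \<in> homs A a' (omap f b) \<rightarrow> carrier (unit_space a')"
        using chomD(3)[OF unit_term_hom[OF b] kv] by blast
      fix g assume g: "g \<in> homs A a' (omap f b)"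
      note gk = f.T.comp_hom[OF k g]
      have "Comp A k (inv_arrow A (Comp A g k)) = inv_arrow A g"
        using A.inv_arrow_comp[OF k g] A.comp_inv_left'[OF k A.inv_arrow(1)[OF g]] by simp
      then show "?P (unit_term a v b (?k g)) = unit_term a' (amap F k v) b g"
        using push_amap(2)[OF f modf_Ff k b A.inv_arrow(1)[OF gk], of "amap F (Comp A g k) v"]
          modfD(4)[OF F k g v] modfD(5)[OF F gk v] by simp
    qed
    finally show ?thesis .
  qed
  have "?P (right_unit B A f F a v) = (\<Oplus>\<^bsub>unit_space a'\<^esub>b\<in>E.
      (1 / of_nat (card (outs B E b))) \<odot>\<^bsub>unit_space a'\<^esub>
      (\<Oplus>\<^bsub>unit_space a'\<^esub>g \<in> homs A a (omap f b). ?P (unit_term a v b g)))"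
    unfolding right_unit_eq[OF E v]
    by (rule chom_weighted_sum[OF push_amap(1)[OF f modf_Ff k]])
      (rule chomD(3)[OF unit_term_hom v], auto intro: EB)
  also have "\<dots> = right_unit B A f F a' (amap F k v)"
    unfolding right_unit_eq[OF E kv]
    using sum cvecD(3)[OF U.module_axioms unit_sum_closed[OF EB kv]]
    by (intro U.M.finsum_cong' refl) auto
  finally show ?thesis .
qed

end

section \<open>Spans of span maps on generators\<close>

definition finitary_span :: "('a, 'am) category \<Rightarrow> ('b, 'bm) category \<Rightarrow>
    ('x, 'xm, 'a, 'am, 'b, 'bm) span \<Rightarrow> bool" where
  "finitary_span A1 A2 X \<longleftrightarrow> finitary_groupoid (apex X) \<and>
     cat_functor (apex X) A1 (sleg X) \<and> cat_functor (apex X) A2 (tleg X)"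

text \<open>\<open>is_span2\<close> with \<open>finitary_groupoid\<close> in place of essential
  finiteness. The vertical composite is shown to satisfy this version, and so the formula on
  generators can be applied to it.\<close>

definition finitary_span2 :: "('a, 'am) category \<Rightarrow> ('b, 'bm) category \<Rightarrow>
    ('x1, 'xm1, 'a, 'am, 'b, 'bm) span \<Rightarrow> ('x2, 'xm2, 'a, 'am, 'b, 'bm) span \<Rightarrow>
    ('y, 'ym, 'x1, 'xm1, 'x2, 'xm2, 'am, 'bm) span2 \<Rightarrow> bool" where
  "finitary_span2 A1 A2 X1 X2 Y \<longleftrightarrow> finitary_groupoid (apex Y) \<and>
     cat_functor (apex Y) (apex X1) (sleg Y) \<and> cat_functor (apex Y) (apex X2) (tleg Y) \<and>
     nat_iso (apex Y) A1 (sleg X1 \<circ>\<^sub>F sleg Y) (sleg X2 \<circ>\<^sub>F tleg Y) (zeta_s Y) \<and>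
     nat_iso (apex Y) A2 (tleg X1 \<circ>\<^sub>F sleg Y) (tleg X2 \<circ>\<^sub>F tleg Y) (zeta_t Y)"

lemma zeta_s_hom:
  assumes Y: "finitary_span2 A1 A2 X1 X2 Y" and "y \<in> Obj (apex Y)"
  shows "zeta_s Y y \<in> homs A1 (omap (sleg X1) (omap (sleg Y) y)) (omap (sleg X2) (omap (tleg Y) y))"
  using assms Y by (simp add: finitary_span2_def nat_iso_def)

lemma zeta_t_hom:
  assumes Y: "finitary_span2 A1 A2 X1 X2 Y" and "y \<in> Obj (apex Y)"
  shows "zeta_t Y y \<in> homs A2 (omap (tleg X1) (omap (sleg Y) y)) (omap (tleg X2) (omap (tleg Y) y))"
  using assms Y by (simp add: finitary_span2_def nat_iso_def)

lemma zeta_s_natural: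
  assumes Y: "finitary_span2 A1 A2 X1 X2 Y" and "u \<in> homs (apex Y) y y'"
  shows "Comp A1 (zeta_s Y y') (amap (sleg X1) (amap (sleg Y) u)) =
    Comp A1 (amap (sleg X2) (amap (tleg Y) u)) (zeta_s Y y)"
  using homsD[OF assms(2)] Y by (auto simp: finitary_span2_def nat_iso_def)

lemma zeta_t_natural:
  assumes Y: "finitary_span2 A1 A2 X1 X2 Y" and "u \<in> homs (apex Y) y y'"
  shows "Comp A2 (zeta_t Y y') (amap (tleg X1) (amap (sleg Y) u)) =
    Comp A2 (amap (tleg X2) (amap (tleg Y) u)) (zeta_t Y y)"
  using homsD[OF assms(2)] Y by (auto simp: finitary_span2_def nat_iso_def)

context
  fixes A1 :: "('a, 'am) category" and A2 :: "('b, 'bm) category"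
    and X1 :: "('x1, 'xm1, 'a, 'am, 'b, 'bm) span"
    and X2 :: "('x2, 'xm2, 'a, 'am, 'b, 'bm) span"
    and Y :: "('y, 'ym, 'x1, 'xm1, 'x2, 'xm2, 'am, 'bm) span2"
    and F :: "('a, 'am, 'v) vfunctor"
  assumes A2: "groupoid A2" and X1: "finitary_span A1 A2 X1" and X2: "finitary_span A1 A2 X2"
    and Y: "finitary_span2 A1 A2 X1 X2 Y" and F: "modf A1 F"
begin

interpretation A2: groupoid A2 by (rule A2)
interpretation s1: cat_functor "apex X1" A1 "sleg X1" using X1 by (simp add: finitary_span_def)
interpretation t1: cat_functor "apex X1" A2 "tleg X1" using X1 by (simp add: finitary_span_def)
interpretation s2: cat_functor "apex X2" A1 "sleg X2" using X2 by (simp add: finitary_span_def)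
interpretation t2: cat_functor "apex X2" A2 "tleg X2" using X2 by (simp add: finitary_span_def)
interpretation s: cat_functor "apex Y" "apex X1" "sleg Y" using Y by (simp add: finitary_span2_def)
interpretation t: cat_functor "apex Y" "apex X2" "tleg Y" using Y by (simp add: finitary_span2_def)
interpretation gX1: groupoid "apex X1"
  using X1 by (simp add: finitary_span_def finitary_groupoid_def)

abbreviation "F1 \<equiv> F \<circ>\<^sub>F sleg X1"
abbreviation "F2 \<equiv> F \<circ>\<^sub>F sleg X2"

lemma modf_F1: "modf (apex X1) F1" by (rule modf_comp[OF F s1.cat_functor_axioms])
lemma modf_F2: "modf (apex X2) F2" by (rule modf_comp[OF F s2.cat_functor_axioms])
lemma modf_F1s: "modf (apex Y) (F1 \<circ>\<^sub>F sleg Y)" by (rule modf_comp[OF modf_F1 s.cat_functor_axioms])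
lemma modf_F2t: "modf (apex Y) (F2 \<circ>\<^sub>F tleg Y)" by (rule modf_comp[OF modf_F2 t.cat_functor_axioms])

lemmas functor_t1s = cat_functor_comp[OF t1.cat_functor_axioms s.cat_functor_axioms]
lemmas functor_t2t = cat_functor_comp[OF t2.cat_functor_axioms t.cat_functor_axioms]

text \<open>The cocone condition uses both naturality squares: that of \<open>zeta_s\<close> moves
  \<open>F(s\<^sub>2 t(u))\<close> to the outside, where the relation of the target turns it into
  the arrow \<open>t\<^sub>2 t(u)\<close> on the left of the tensor, and that of
  \<open>zeta_t\<close> moves this arrow past the inverse component.\<close>

lemma zeta_map_hom:
  shows "chom (push_obj (apex Y) A2 (tleg X1 \<circ>\<^sub>F sleg Y) (F1 \<circ>\<^sub>F sleg Y) a)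
      (push_obj (apex Y) A2 (tleg X2 \<circ>\<^sub>F tleg Y) (F2 \<circ>\<^sub>F tleg Y) a) (zeta_map A2 X1 X2 Y F a)"
    and "\<And>y h v. y \<in> Obj (apex Y) \<Longrightarrow> h \<in> homs A2 (omap (tleg X1) (omap (sleg Y) y)) a \<Longrightarrow>
      v \<in> carrier (omap F1 (omap (sleg Y) y)) \<Longrightarrow>
      zeta_map A2 X1 X2 Y F a
        (push_incl (apex Y) A2 (tleg X1 \<circ>\<^sub>F sleg Y) (F1 \<circ>\<^sub>F sleg Y) a y h v) =
      push_incl (apex Y) A2 (tleg X2 \<circ>\<^sub>F tleg Y) (F2 \<circ>\<^sub>F tleg Y) a
          y (Comp A2 h (inv_arrow A2 (zeta_t Y y))) (amap F (zeta_s Y y) v)"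
proof -
  let ?I = "push_incl (apex Y) A2 (tleg X2 \<circ>\<^sub>F tleg Y) (F2 \<circ>\<^sub>F tleg Y) a"
  let ?W = "push_obj (apex Y) A2 (tleg X2 \<circ>\<^sub>F tleg Y) (F2 \<circ>\<^sub>F tleg Y) a"
  have 1: "chom (omap (F1 \<circ>\<^sub>F sleg Y) y) ?W
      (\<lambda>v. ?I y (Comp A2 h (inv_arrow A2 (zeta_t Y y))) (amap F (zeta_s Y y) v))"
    if y: "y \<in> Obj (apex Y)" and h: "h \<in> homs A2 (omap (tleg X1 \<circ>\<^sub>F sleg Y) y) a" for y h
  proof -
    have "Comp A2 h (inv_arrow A2 (zeta_t Y y)) \<in> homs A2 (omap (tleg X2 \<circ>\<^sub>F tleg Y) y) a"
      using A2.comp_hom[OF A2.inv_arrow(1)[OF zeta_t_hom[OF Y y]]] h by simp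
    moreover have "chom (omap (F1 \<circ>\<^sub>F sleg Y) y) (omap (F2 \<circ>\<^sub>F tleg Y) y) (amap F (zeta_s Y y))"
      using modfD(2)[OF F zeta_s_hom[OF Y y]] by simp
    ultimately show ?thesis
      using chom_comp[OF push_incl_hom[OF functor_t2t modf_F2t y]] by (simp add: comp_def)
  qed
  have 2: "?I y' (Comp A2 h (inv_arrow A2 (zeta_t Y y')))
        (amap F (zeta_s Y y') (amap (F1 \<circ>\<^sub>F sleg Y) u v)) =
      ?I y (Comp A2 (Comp A2 h (amap (tleg X1 \<circ>\<^sub>F sleg Y) u)) (inv_arrow A2 (zeta_t Y y)))
        (amap F (zeta_s Y y) v)"
    if u: "u \<in> homs (apex Y) y y'" and h: "h \<in> homs A2 (omap (tleg X1 \<circ>\<^sub>F sleg Y) y') a"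
      and v: "v \<in> carrier (omap (F1 \<circ>\<^sub>F sleg Y) y)" for y y' u h v
  proof -
    note y = s.S.homs_obj[OF u]
    note su = s.arr[OF u] and tu = t.arr[OF u]
    note zy = zeta_t_hom[OF Y y(1)] and zy' = zeta_t_hom[OF Y y(2)]
    have h': "h \<in> homs A2 (omap (tleg X1) (omap (sleg Y) y')) a" using h by simp
    have v': "v \<in> carrier (omap F (omap (sleg X1) (omap (sleg Y) y)))" using v by simp
    have hz: "Comp A2 h (inv_arrow A2 (zeta_t Y y')) \<in> homs A2 (omap (tleg X2 \<circ>\<^sub>F tleg Y) y') a"
      using A2.comp_hom[OF A2.inv_arrow(1)[OF zy'] h'] by simp
    have "amap F (zeta_s Y y') (amap (F1 \<circ>\<^sub>F sleg Y) u v) =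
        amap F (Comp A1 (zeta_s Y y') (amap (sleg X1) (amap (sleg Y) u))) v"
      using modfD(4)[OF F s1.arr[OF su] zeta_s_hom[OF Y y(2)] v'] by simp
    also have "\<dots> = amap (F2 \<circ>\<^sub>F tleg Y) u (amap F (zeta_s Y y) v)"
      using modfD(4)[OF F zeta_s_hom[OF Y y(1)] s2.arr[OF tu] v'] zeta_s_natural[OF Y u] by simp
    finally have "?I y' (Comp A2 h (inv_arrow A2 (zeta_t Y y')))
          (amap F (zeta_s Y y') (amap (F1 \<circ>\<^sub>F sleg Y) u v)) =
        ?I y (Comp A2 (Comp A2 h (inv_arrow A2 (zeta_t Y y'))) (amap (tleg X2 \<circ>\<^sub>F tleg Y) u))
          (amap F (zeta_s Y y) v)"
      using push_incl_rel[OF functor_t2t modf_F2t u hz, of "amap F (zeta_s Y y) v"]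
        modfD(5)[OF F zeta_s_hom[OF Y y(1)] v'] by simp
    \<comment> \<open>Naturality of \<open>zeta_t\<close> solved for inverses:
      \<open>\<zeta>\<^sub>t(y')\<inverse> t\<^sub>2 t(u) = t\<^sub>1 s(u)
      \<zeta>\<^sub>t(y)\<inverse>\<close>.\<close>
    moreover have "Comp A2 (Comp A2 h (inv_arrow A2 (zeta_t Y y'))) (amap (tleg X2 \<circ>\<^sub>F tleg Y) u) =
        Comp A2 (Comp A2 h (amap (tleg X1 \<circ>\<^sub>F sleg Y) u)) (inv_arrow A2 (zeta_t Y y))"
    proof -
      note Tu = t2.arr[OF tu] and Su = t1.arr[OF su]
      have "Comp A2 (inv_arrow A2 (zeta_t Y y')) (amap (tleg X2) (amap (tleg Y) u)) =
          Comp A2 (Comp A2 (Comp A2 (inv_arrow A2 (zeta_t Y y')) (amap (tleg X2) (amap (tleg Y) u)))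
            (zeta_t Y y)) (inv_arrow A2 (zeta_t Y y))"
        using A2.comp_inv_right[OF zy A2.comp_hom[OF Tu A2.inv_arrow(1)[OF zy']]] by simp
      also have "Comp A2 (Comp A2 (inv_arrow A2 (zeta_t Y y')) (amap (tleg X2) (amap (tleg Y) u)))
            (zeta_t Y y) = amap (tleg X1) (amap (sleg Y) u)"
        using A2.comp_assoc[OF zy Tu A2.inv_arrow(1)[OF zy']] zeta_t_natural[OF Y u]
          A2.comp_inv_left[OF zy' Su] by simp
      finally show ?thesis
        using A2.comp_assoc[OF Tu A2.inv_arrow(1)[OF zy'] h']
          A2.comp_assoc[OF A2.inv_arrow(1)[OF zy] Su h'] by simp
    qed
    ultimately show ?thesis by simp
  qed
  note eq = zeta_map_def[of A2 X1 X2 Y F a]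
  show "chom (push_obj (apex Y) A2 (tleg X1 \<circ>\<^sub>F sleg Y) (F1 \<circ>\<^sub>F sleg Y) a) ?W
      (zeta_map A2 X1 X2 Y F a)"
    unfolding eq by (rule push_desc_hom(1)[OF functor_t1s modf_F1s push_cvec[OF functor_t2t modf_F2t]])
      (erule (1) 1, erule (2) 2)
  show "zeta_map A2 X1 X2 Y F a
        (push_incl (apex Y) A2 (tleg X1 \<circ>\<^sub>F sleg Y) (F1 \<circ>\<^sub>F sleg Y) a y h v) =
      ?I y (Comp A2 h (inv_arrow A2 (zeta_t Y y))) (amap F (zeta_s Y y) v)"
    if "y \<in> Obj (apex Y)" "h \<in> homs A2 (omap (tleg X1) (omap (sleg Y) y)) a"
      "v \<in> carrier (omap F1 (omap (sleg Y) y))" for y h v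
    unfolding eq
    by (rule push_desc_hom(2)[OF functor_t1s modf_F1s push_cvec[OF functor_t2t modf_F2t] _ _ that(1)])
      (erule (1) 1, erule (2) 2, use that in simp_all)
qed

text \<open>All stages after the right unit. They are separated off because they send a generator to
  a single generator; only the right unit introduces sums.\<close>

abbreviation "Lambda_tail a \<equiv>
  push_map (apex X2) A2 (tleg X2) (push (apex Y) (apex X2) (tleg Y) (F2 \<circ>\<^sub>F tleg Y)) F2
      (left_counit (apex Y) (apex X2) (tleg Y) F2) a
    \<circ> push_split (apex Y) (apex X2) A2 (tleg Y) (tleg X2) (F2 \<circ>\<^sub>F tleg Y) a
    \<circ> zeta_map A2 X1 X2 Y F a
    \<circ> push_merge (apex Y) (apex X1) A2 (sleg Y) (tleg X1) (F1 \<circ>\<^sub>F sleg Y) a"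

lemmas modf_push_s = push_modf[OF s.cat_functor_axioms modf_F1s]
lemmas modf_push_t = push_modf[OF t.cat_functor_axioms modf_F2t]

lemma counit_map:
  shows "chom (push_obj (apex X2) A2 (tleg X2) (push (apex Y) (apex X2) (tleg Y) (F2 \<circ>\<^sub>F tleg Y)) a)
      (push_obj (apex X2) A2 (tleg X2) F2 a)
      (push_map (apex X2) A2 (tleg X2) (push (apex Y) (apex X2) (tleg Y) (F2 \<circ>\<^sub>F tleg Y)) F2
        (left_counit (apex Y) (apex X2) (tleg Y) F2) a)"
    and "\<And>x h v. x \<in> Obj (apex X2) \<Longrightarrow> h \<in> homs A2 (omap (tleg X2) x) a \<Longrightarrow>
      v \<in> carrier (push_obj (apex Y) (apex X2) (tleg Y) (F2 \<circ>\<^sub>F tleg Y) x) \<Longrightarrow>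
      push_map (apex X2) A2 (tleg X2) (push (apex Y) (apex X2) (tleg Y) (F2 \<circ>\<^sub>F tleg Y)) F2
        (left_counit (apex Y) (apex X2) (tleg Y) F2) a
        (push_incl (apex X2) A2 (tleg X2) (push (apex Y) (apex X2) (tleg Y) (F2 \<circ>\<^sub>F tleg Y)) a x h v) =
      push_incl (apex X2) A2 (tleg X2) F2 a x h (left_counit (apex Y) (apex X2) (tleg Y) F2 x v)"
proof -
  note * = left_counit_hom(1)[OF t.cat_functor_axioms modf_F2]
    left_counit_natural[OF t.cat_functor_axioms modf_F2]
  show "chom (push_obj (apex X2) A2 (tleg X2) (push (apex Y) (apex X2) (tleg Y) (F2 \<circ>\<^sub>F tleg Y)) a)
      (push_obj (apex X2) A2 (tleg X2) F2 a)
      (push_map (apex X2) A2 (tleg X2) (push (apex Y) (apex X2) (tleg Y) (F2 \<circ>\<^sub>F tleg Y)) F2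
        (left_counit (apex Y) (apex X2) (tleg Y) F2) a)"
    using * by (intro push_map_hom(1)[OF t2.cat_functor_axioms modf_push_t modf_F2]) auto
  show "push_map (apex X2) A2 (tleg X2) (push (apex Y) (apex X2) (tleg Y) (F2 \<circ>\<^sub>F tleg Y)) F2
        (left_counit (apex Y) (apex X2) (tleg Y) F2) a
        (push_incl (apex X2) A2 (tleg X2) (push (apex Y) (apex X2) (tleg Y) (F2 \<circ>\<^sub>F tleg Y)) a x h v) =
      push_incl (apex X2) A2 (tleg X2) F2 a x h (left_counit (apex Y) (apex X2) (tleg Y) F2 x v)"
    if "x \<in> Obj (apex X2)" "h \<in> homs A2 (omap (tleg X2) x) a"
      "v \<in> carrier (push_obj (apex Y) (apex X2) (tleg Y) (F2 \<circ>\<^sub>F tleg Y) x)" for x h v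
    using * that by (intro push_map_hom(2)[OF t2.cat_functor_axioms modf_push_t modf_F2]) auto
qed

lemma Lambda_tail_hom:
  "chom (push_obj (apex X1) A2 (tleg X1) (push (apex Y) (apex X1) (sleg Y) (F1 \<circ>\<^sub>F sleg Y)) a)
    (push_obj (apex X2) A2 (tleg X2) F2 a) (Lambda_tail a)"
  by (intro chom_comp[OF _ push_merge_hom(1)[OF s.cat_functor_axioms t1.cat_functor_axioms modf_F1s]]
      chom_comp[OF _ zeta_map_hom(1)] counit_map(1)
      chom_comp[OF _ push_split_hom(1)[OF t.cat_functor_axioms t2.cat_functor_axioms modf_F2t]])

text \<open>Merging multiplies \<open>h\<close> by \<open>t\<^sub>1(g)\<close>, the middle
  isomorphism applies the two components at \<open>y\<close>, and splitting inserts an identity that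
  the counit evaluates away.\<close>

lemma Lambda_tail_incl:
  assumes x: "x \<in> Obj (apex X1)" and h: "h \<in> homs A2 (omap (tleg X1) x) a"
    and y: "y \<in> Obj (apex Y)" and g: "g \<in> homs (apex X1) (omap (sleg Y) y) x"
    and v: "v \<in> carrier (omap F1 (omap (sleg Y) y))"
  shows "Lambda_tail a
      (push_incl (apex X1) A2 (tleg X1) (push (apex Y) (apex X1) (sleg Y) (F1 \<circ>\<^sub>F sleg Y)) a x h
        (push_incl (apex Y) (apex X1) (sleg Y) (F1 \<circ>\<^sub>F sleg Y) x y g v)) =
    push_incl (apex X2) A2 (tleg X2) F2 a (omap (tleg Y) y)
      (Comp A2 (Comp A2 h (amap (tleg X1) g)) (inv_arrow A2 (zeta_t Y y)))
      (amap F (zeta_s Y y) v)"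
proof -
  note hg = A2.comp_hom[OF t1.arr[OF g] h]
  note hz = A2.comp_hom[OF A2.inv_arrow(1)[OF zeta_t_hom[OF Y y]] hg]
  note i = s2.S.ident_hom[OF t.obj[OF y]]
  have w: "amap F (zeta_s Y y) v \<in> carrier (omap (F2 \<circ>\<^sub>F tleg Y) y)"
    using modfD(5)[OF F zeta_s_hom[OF Y y]] v by simp
  have i': "push_incl (apex Y) (apex X2) (tleg Y) (F2 \<circ>\<^sub>F tleg Y) (omap (tleg Y) y) y
      (Ident (apex X2) (omap (tleg Y) y)) (amap F (zeta_s Y y) v)
      \<in> carrier (push_obj (apex Y) (apex X2) (tleg Y) (F2 \<circ>\<^sub>F tleg Y) (omap (tleg Y) y))"
    by (rule chomD(3)[OF push_incl_hom[OF t.cat_functor_axioms modf_F2t y i] w])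
  have "left_counit (apex Y) (apex X2) (tleg Y) F2 (omap (tleg Y) y)
      (push_incl (apex Y) (apex X2) (tleg Y) (F2 \<circ>\<^sub>F tleg Y) (omap (tleg Y) y) y
      (Ident (apex X2) (omap (tleg Y) y)) (amap F (zeta_s Y y) v)) = amap F (zeta_s Y y) v"
    using left_counit_hom(2)[OF t.cat_functor_axioms modf_F2 t.obj[OF y] y i, of "amap F (zeta_s Y y) v"]
      modfD(3)[OF modf_F2 t.obj[OF y], of "amap F (zeta_s Y y) v"] w by simp
  then show ?thesis
    using push_merge_hom(2)[OF s.cat_functor_axioms t1.cat_functor_axioms modf_F1s x h y g] v
      zeta_map_hom(2)[OF y hg v]
      push_split_hom(2)[OF t.cat_functor_axioms t2.cat_functor_axioms modf_F2t y hz w]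
      counit_map(2)[OF t.obj[OF y] hz i']
    by simp
qed

lemma unit_map:
  shows "chom (push_obj (apex X1) A2 (tleg X1) F1 a)
      (push_obj (apex X1) A2 (tleg X1) (push (apex Y) (apex X1) (sleg Y) (F1 \<circ>\<^sub>F sleg Y)) a)
      (push_map (apex X1) A2 (tleg X1) F1 (push (apex Y) (apex X1) (sleg Y) (F1 \<circ>\<^sub>F sleg Y))
        (right_unit (apex Y) (apex X1) (sleg Y) F1) a)"
    and "\<And>x h v. x \<in> Obj (apex X1) \<Longrightarrow> h \<in> homs A2 (omap (tleg X1) x) a \<Longrightarrow>
      v \<in> carrier (omap F1 x) \<Longrightarrow>
      push_map (apex X1) A2 (tleg X1) F1 (push (apex Y) (apex X1) (sleg Y) (F1 \<circ>\<^sub>F sleg Y))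
        (right_unit (apex Y) (apex X1) (sleg Y) F1) a
        (push_incl (apex X1) A2 (tleg X1) F1 a x h v) =
      push_incl (apex X1) A2 (tleg X1) (push (apex Y) (apex X1) (sleg Y) (F1 \<circ>\<^sub>F sleg Y)) a x h
        (right_unit (apex Y) (apex X1) (sleg Y) F1 x v)"
proof -
  have fin: "finitary_groupoid (apex Y)" "finitary_groupoid (apex X1)"
    using X1 Y by (simp_all add: finitary_span_def finitary_span2_def)
  note * = right_unit_hom[OF s.cat_functor_axioms fin modf_F1]
    right_unit_natural[OF s.cat_functor_axioms fin modf_F1, symmetric]
  show "chom (push_obj (apex X1) A2 (tleg X1) F1 a)
      (push_obj (apex X1) A2 (tleg X1) (push (apex Y) (apex X1) (sleg Y) (F1 \<circ>\<^sub>F sleg Y)) a)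
      (push_map (apex X1) A2 (tleg X1) F1 (push (apex Y) (apex X1) (sleg Y) (F1 \<circ>\<^sub>F sleg Y))
        (right_unit (apex Y) (apex X1) (sleg Y) F1) a)"
    by (rule push_map_hom(1)[OF t1.cat_functor_axioms modf_F1 modf_push_s, unfolded omap_push]) (erule *)+
  show "push_map (apex X1) A2 (tleg X1) F1 (push (apex Y) (apex X1) (sleg Y) (F1 \<circ>\<^sub>F sleg Y))
        (right_unit (apex Y) (apex X1) (sleg Y) F1) a
        (push_incl (apex X1) A2 (tleg X1) F1 a x h v) =
      push_incl (apex X1) A2 (tleg X1) (push (apex Y) (apex X1) (sleg Y) (F1 \<circ>\<^sub>F sleg Y)) a x h
        (right_unit (apex Y) (apex X1) (sleg Y) F1 x v)"
    if "x \<in> Obj (apex X1)" "h \<in> homs A2 (omap (tleg X1) x) a" "v \<in> carrier (omap F1 x)" for x h v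
    by (rule push_map_hom(2)[OF t1.cat_functor_axioms modf_F1 modf_push_s _ _ that, unfolded omap_push])
      (erule (1) * | erule *)+
qed

lemma Lambda_span2_eq: "Lambda_span2 A2 X1 X2 Y F a = Lambda_tail a \<circ>
    push_map (apex X1) A2 (tleg X1) F1 (push (apex Y) (apex X1) (sleg Y) (F1 \<circ>\<^sub>F sleg Y))
      (right_unit (apex Y) (apex X1) (sleg Y) F1) a"
  by (simp add: Lambda_span2_def Let_def)

lemma Lambda_span2_hom:
  "chom (push_obj (apex X1) A2 (tleg X1) F1 a) (push_obj (apex X2) A2 (tleg X2) F2 a)
    (Lambda_span2 A2 X1 X2 Y F a)"
  unfolding Lambda_span2_eq by (rule chom_comp[OF Lambda_tail_hom unit_map(1)])

text \<open>Expand the right unit over the cover and push the linear remainder through the sum. The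
  freedom in \<open>E\<close> is the point: the composite span will be evaluated on a cover
  assembled from covers of its two factors.\<close>

lemma Lambda_span2_incl:
  fixes a
  defines "W \<equiv> push_obj (apex X2) A2 (tleg X2) F2 a"
  assumes E: "covers (apex Y) E"
    and x: "x \<in> Obj (apex X1)" and h: "h \<in> homs A2 (omap (tleg X1) x) a"
    and v: "v \<in> carrier (omap F1 x)"
  shows "Lambda_span2 A2 X1 X2 Y F a (push_incl (apex X1) A2 (tleg X1) F1 a x h v) =
    (\<Oplus>\<^bsub>W\<^esub>y\<in>E. (1 / of_nat (card (outs (apex Y) E y))) \<odot>\<^bsub>W\<^esub>
      (\<Oplus>\<^bsub>W\<^esub>g\<in>homs (apex X1) x (omap (sleg Y) y).
        push_incl (apex X2) A2 (tleg X2) F2 a (omap (tleg Y) y)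
          (Comp A2 (Comp A2 h (amap (tleg X1) (inv_arrow (apex X1) g))) (inv_arrow A2 (zeta_t Y y)))
          (amap F (zeta_s Y y) (amap F1 g v))))"
proof -
  have fin: "finitary_groupoid (apex Y)" "finitary_groupoid (apex X1)"
    using X1 Y by (simp_all add: finitary_span_def finitary_span2_def)
  let ?U = "push_obj (apex Y) (apex X1) (sleg Y) (F1 \<circ>\<^sub>F sleg Y) x"
  let ?T = "Lambda_tail a"
  let ?u = "\<lambda>y g. push_incl (apex Y) (apex X1) (sleg Y) (F1 \<circ>\<^sub>F sleg Y) x y
      (inv_arrow (apex X1) g) (amap F1 g v)"
  let ?L = "?T \<circ> push_incl (apex X1) A2 (tleg X1)
      (push (apex Y) (apex X1) (sleg Y) (F1 \<circ>\<^sub>F sleg Y)) a x h"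
  have L: "chom ?U W ?L"
    unfolding W_def
    using chom_comp[OF Lambda_tail_hom push_incl_hom[OF t1.cat_functor_axioms modf_push_s x h]] by simp
  have yO: "y \<in> Obj (apex Y)" if "y \<in> E" for y
    using that E by (auto simp: covers_def)
  have uL: "?L (?u y g) = push_incl (apex X2) A2 (tleg X2) F2 a (omap (tleg Y) y)
      (Comp A2 (Comp A2 h (amap (tleg X1) (inv_arrow (apex X1) g))) (inv_arrow A2 (zeta_t Y y)))
      (amap F (zeta_s Y y) (amap F1 g v))"
    if "y \<in> E" "g \<in> homs (apex X1) x (omap (sleg Y) y)" for y g
    using Lambda_tail_incl[OF x h yO[OF that(1)] gX1.inv_arrow(1)[OF that(2)]
      modfD(5)[OF modf_F1 that(2) v]] by simp
  have u: "?u y g \<in> carrier ?U"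
    if "y \<in> E" "g \<in> homs (apex X1) x (omap (sleg Y) y)" for y g
    by (rule chomD(3)[OF unit_term_hom[OF s.cat_functor_axioms fin modf_F1 yO[OF that(1)] that(2)] v])
  have "Lambda_span2 A2 X1 X2 Y F a (push_incl (apex X1) A2 (tleg X1) F1 a x h v) =
      ?L (right_unit (apex Y) (apex X1) (sleg Y) F1 x v)"
    using unit_map(2)[OF x h v] by (simp add: Lambda_span2_eq)
  also have "right_unit (apex Y) (apex X1) (sleg Y) F1 x v =
      (\<Oplus>\<^bsub>?U\<^esub>y\<in>E. (1 / of_nat (card (outs (apex Y) E y))) \<odot>\<^bsub>?U\<^esub>
        (\<Oplus>\<^bsub>?U\<^esub>g\<in>homs (apex X1) x (omap (sleg Y) y). ?u y g))"
    by (rule right_unit_eq[OF s.cat_functor_axioms fin modf_F1 E v])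
  also have "?L \<dots> = (\<Oplus>\<^bsub>W\<^esub>y\<in>E. (1 / of_nat (card (outs (apex Y) E y))) \<odot>\<^bsub>W\<^esub>
        (\<Oplus>\<^bsub>W\<^esub>g\<in>homs (apex X1) x (omap (sleg Y) y). ?L (?u y g)))"
    by (rule chom_weighted_sum[OF L u])
  also have "\<dots> = (\<Oplus>\<^bsub>W\<^esub>y\<in>E. (1 / of_nat (card (outs (apex Y) E y))) \<odot>\<^bsub>W\<^esub>
      (\<Oplus>\<^bsub>W\<^esub>g\<in>homs (apex X1) x (omap (sleg Y) y).
        push_incl (apex X2) A2 (tleg X2) F2 a (omap (tleg Y) y)
          (Comp A2 (Comp A2 h (amap (tleg X1) (inv_arrow (apex X1) g))) (inv_arrow A2 (zeta_t Y y)))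
          (amap F (zeta_s Y y) (amap F1 g v))))"
    using chomD(3)[OF L u] uL by (intro weighted_sum_cong[OF chomD(2)[OF L]]) auto
  finally show ?thesis .
qed

end

section \<open>The weak pullback\<close>

lemma weak_pullback_obj:
  "(y, g, z) \<in> Obj (weak_pullback Y Z X t s) \<longleftrightarrow> y \<in> Obj Y \<and> z \<in> Obj Z \<and> g \<in> homs X (omap t y) (omap s z)"
  by (auto simp: weak_pullback_def)

lemma weak_pullback_homs:
  "h \<in> homs (weak_pullback Y Z X t s) p q \<longleftrightarrow> p \<in> Obj (weak_pullback Y Z X t s) \<and> q \<in> Obj (weak_pullback Y Z X t s) \<and>
    (\<exists>u w. h = (p, (u, w), q) \<and> u \<in> homs Y (fst p) (fst q) \<and> w \<in> homs Z (snd (snd p)) (snd (snd q)) \<and>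
      Comp X (fst (snd q)) (amap t u) = Comp X (amap s w) (fst (snd p)))"
  by (cases p; cases q) (auto simp: weak_pullback_def homs_def)

lemma weak_pullback_comp: "Comp (weak_pullback Y Z X t s) (q, (u', w'), r) (p, (u, w), q') = (p, (Comp Y u' u, Comp Z w' w), r)"
  by (simp add: weak_pullback_def)

lemma weak_pullback_ident: "Ident (weak_pullback Y Z X t s) p = (p, (Ident Y (fst p), Ident Z (snd (snd p))), p)"
  by (cases p) (simp add: weak_pullback_def)

text \<open>Written as a reindexed dependent sum over pairs, which is exactly the index set in
  \<open>weighted_sum_fubini\<close>.\<close>

definition pullback_cover :: "('x, 'xm) category \<Rightarrow> ('y, 'ym, 'x, 'xm) ftor \<Rightarrow>
    ('z, 'zm, 'x, 'xm) ftor \<Rightarrow> 'y set \<Rightarrow> 'z set \<Rightarrow> ('y \<times> 'xm \<times> 'z) set" where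
  "pullback_cover X t s R R' = (\<lambda>((y, z), k). (y, k, z)) `
     (SIGMA q:R \<times> R'. homs X (omap t (fst q)) (omap s (snd q)))"

lemma mem_pullback_cover:
  "(y, k, z) \<in> pullback_cover X t s R R' \<longleftrightarrow>
    y \<in> R \<and> z \<in> R' \<and> k \<in> homs X (omap t y) (omap s z)"
  by (force simp: pullback_cover_def image_iff)

context
  fixes Y :: "('y, 'ym) category" and Z :: "('z, 'zm) category" and X :: "('x, 'xm) category"
    and t :: "('y, 'ym, 'x, 'xm) ftor" and s :: "('z, 'zm, 'x, 'xm) ftor"
  assumes t: "cat_functor Y X t" and s: "cat_functor Z X s"
    and Y: "finitary_groupoid Y" and Z: "finitary_groupoid Z" and X: "finitary_groupoid X"
begin

interpretation t: cat_functor Y X t by (rule t)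
interpretation s: cat_functor Z X s by (rule s)
interpretation gX: groupoid X using X by (simp add: finitary_groupoid_def)
interpretation gY: groupoid Y using Y by (simp add: finitary_groupoid_def)
interpretation gZ: groupoid Z using Z by (simp add: finitary_groupoid_def)

abbreviation "pullback \<equiv> weak_pullback Y Z X t s"

lemma weak_pullback_category: "category pullback"
proof
  show "Dom pullback f \<in> Obj pullback" "Cod pullback f \<in> Obj pullback" if "f \<in> Arr pullback" for f
    using that by (auto simp: weak_pullback_def)
  show "Ident pullback p \<in> homs pullback p p" if "p \<in> Obj pullback" for p
    using that t.S.ident_hom s.S.ident_hom t.T.comp_ident_right t.T.comp_ident_left t.ident s.ident
    by (cases p) (auto simp: weak_pullback_homs weak_pullback_obj weak_pullback_ident)
  show "Comp pullback k h \<in> homs pullback p r" if h: "h \<in> homs pullback p q" and k: "k \<in> homs pullback q r" for p q r h k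
  proof -
    obtain u w where h': "h = (p, (u, w), q)" "u \<in> homs Y (fst p) (fst q)"
      "w \<in> homs Z (snd (snd p)) (snd (snd q))"
      "Comp X (fst (snd q)) (amap t u) = Comp X (amap s w) (fst (snd p))" "p \<in> Obj pullback" "q \<in> Obj pullback"
      using h by (auto simp: weak_pullback_homs)
    obtain u' w' where k': "k = (q, (u', w'), r)" "u' \<in> homs Y (fst q) (fst r)"
      "w' \<in> homs Z (snd (snd q)) (snd (snd r))"
      "Comp X (fst (snd r)) (amap t u') = Comp X (amap s w') (fst (snd q))" "r \<in> Obj pullback"
      using k by (auto simp: weak_pullback_homs)
    have g: "fst (snd o') \<in> homs X (omap t (fst o')) (omap s (snd (snd o')))" if "o' \<in> Obj pullback" for o'
      using that by (cases o') (auto simp: weak_pullback_obj)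
    \<comment> \<open>The two commuting squares are pasted along their common edge, the middle
      component of \<open>q\<close>.\<close>
    have "Comp X (fst (snd r)) (amap t (Comp Y u' u)) = Comp X (amap s (Comp Z w' w)) (fst (snd p))"
      using t.comp[OF h'(2) k'(2)] s.comp[OF h'(3) k'(3)] h'(4) k'(4)
        t.T.comp_assoc[OF t.arr[OF h'(2)] t.arr[OF k'(2)] g[OF k'(5)]]
        t.T.comp_assoc[OF t.arr[OF h'(2)] g[OF h'(6)] s.arr[OF k'(3)]]
        t.T.comp_assoc[OF g[OF h'(5)] s.arr[OF h'(3)] s.arr[OF k'(3)]] by simp
    then show ?thesis
      using h' k' t.S.comp_hom[OF h'(2) k'(2)] s.S.comp_hom[OF h'(3) k'(3)]
      by (auto simp: weak_pullback_homs weak_pullback_comp)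
  qed
  show "Comp pullback h (Ident pullback p) = h" "Comp pullback (Ident pullback q) h = h" if "h \<in> homs pullback p q" for p q h
    using that t.S.comp_ident_right s.S.comp_ident_right t.S.comp_ident_left s.S.comp_ident_left
    by (auto simp: weak_pullback_homs weak_pullback_ident weak_pullback_comp)
  show "Comp pullback h (Comp pullback g f) = Comp pullback (Comp pullback h g) f"
    if "f \<in> homs pullback p q" "g \<in> homs pullback q r" "h \<in> homs pullback r o'" for p q r o' f g h
    using that by (auto simp: weak_pullback_homs weak_pullback_comp
        intro: t.S.comp_assoc s.S.comp_assoc)
qed

text \<open>\<open>t(u)\<close> is invertible, so the square can be solved for the middle component
  of the target. This makes the target of an arrow a function of its source and of the pair
  \<open>(u, w)\<close>.\<close>

lemma weak_pullback_square_inv: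
  assumes u: "u \<in> homs Y y y'" and w: "w \<in> homs Z z z'"
    and g: "g \<in> homs X (omap t y) (omap s z)" and g': "g' \<in> homs X (omap t y') (omap s z')"
  shows "Comp X g' (amap t u) = Comp X (amap s w) g \<longleftrightarrow>
    g' = Comp X (Comp X (amap s w) g) (inv_arrow X (amap t u))"
  using gX.comp_inv_right[OF t.arr[OF u] g'] gX.comp_inv_right'[OF t.arr[OF u]]
    t.T.comp_hom[OF g s.arr[OF w]] by auto

lemma weak_pullback_groupoid: "groupoid pullback"
proof (rule groupoidI_homs[OF weak_pullback_category])
  fix p q f assume "f \<in> homs pullback p q"
  then obtain u w where f: "f = (p, (u, w), q)" and u: "u \<in> homs Y (fst p) (fst q)"
    and w: "w \<in> homs Z (snd (snd p)) (snd (snd q))"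
    and eq: "Comp X (fst (snd q)) (amap t u) = Comp X (amap s w) (fst (snd p))"
    and pq: "p \<in> Obj pullback" "q \<in> Obj pullback"
    by (auto simp: weak_pullback_homs)
  have g: "fst (snd p) \<in> homs X (omap t (fst p)) (omap s (snd (snd p)))"
    "fst (snd q) \<in> homs X (omap t (fst q)) (omap s (snd (snd q)))"
    using pq by (cases p; cases q; auto simp: weak_pullback_obj)+
  let ?f = "(q, (inv_arrow Y u, inv_arrow Z w), p)"
  \<comment> \<open>The square for the inverse pair arises from the given one by cancelling
    \<open>s(w)\<close> on the left and \<open>t(u)\<close> on the right.\<close>
  have "Comp X (amap s (inv_arrow Z w)) (fst (snd q)) =
      Comp X (Comp X (inv_arrow X (amap s w)) (Comp X (fst (snd q)) (amap t u))) (inv_arrow X (amap t u))"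
    using cat_functor_inv[OF s gZ.groupoid_axioms gX.groupoid_axioms w]
      t.T.comp_assoc[OF t.arr[OF u] g(2) gX.inv_arrow(1)[OF s.arr[OF w]]]
      gX.comp_inv_right[OF t.arr[OF u] t.T.comp_hom[OF g(2) gX.inv_arrow(1)[OF s.arr[OF w]]]]
    by simp
  also have "\<dots> = Comp X (fst (snd p)) (amap t (inv_arrow Y u))"
    using eq gX.comp_inv_left[OF s.arr[OF w] g(1)]
      cat_functor_inv[OF t gY.groupoid_axioms gX.groupoid_axioms u] by simp
  finally have "?f \<in> homs pullback q p"
    using pq gY.inv_arrow(1)[OF u] gZ.inv_arrow(1)[OF w] by (auto simp: weak_pullback_homs)
  then show "\<exists>g\<in>homs pullback q p. Comp pullback g f = Ident pullback p \<and> Comp pullback f g = Ident pullback q"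
    using gY.inv_arrow[OF u] gZ.inv_arrow[OF w]
    by (intro bexI[of _ ?f]) (auto simp: f weak_pullback_comp weak_pullback_ident)
qed

lemma wp_fst_functor: "cat_functor pullback Y wp_fst"
  by (intro cat_functor.intro weak_pullback_category t.S.category_axioms cat_functor_axioms.intro)
    (auto simp: wp_fst_def weak_pullback_homs weak_pullback_obj weak_pullback_ident weak_pullback_comp)

lemma wp_snd_functor: "cat_functor pullback Z wp_snd"
  by (intro cat_functor.intro weak_pullback_category s.S.category_axioms cat_functor_axioms.intro)
    (auto simp: wp_snd_def weak_pullback_homs weak_pullback_obj weak_pullback_ident weak_pullback_comp)

text \<open>Arrows out of the two outer components always lift to an arrow of the weak pullback, by
  conjugating the middle component. Both the covering property and the count of outgoing arrows rest
  on this lift.\<close>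

lemma transport_square:
  assumes "(y, k, z) \<in> Obj pullback" "u \<in> homs Y y y'" "w \<in> homs Z z z'"
  shows "Comp X (Comp X (amap s w) k) (inv_arrow X (amap t u)) \<in> homs X (omap t y') (omap s z')"
    and "((y, k, z), (u, w), (y', Comp X (Comp X (amap s w) k) (inv_arrow X (amap t u)), z'))
      \<in> homs pullback (y, k, z) (y', Comp X (Comp X (amap s w) k) (inv_arrow X (amap t u)), z')"
proof -
  have k: "k \<in> homs X (omap t y) (omap s z)" using assms(1) by (simp add: weak_pullback_obj)
  show k': "Comp X (Comp X (amap s w) k) (inv_arrow X (amap t u)) \<in> homs X (omap t y') (omap s z')"
    by (rule t.T.comp_hom[OF gX.inv_arrow(1)[OF t.arr[OF assms(2)]]
          t.T.comp_hom[OF k s.arr[OF assms(3)]]])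
  show "((y, k, z), (u, w), (y', Comp X (Comp X (amap s w) k) (inv_arrow X (amap t u)), z'))
      \<in> homs pullback (y, k, z) (y', Comp X (Comp X (amap s w) k) (inv_arrow X (amap t u)), z')"
    using assms k k' t.S.homs_obj[OF assms(2)] s.S.homs_obj[OF assms(3)]
      weak_pullback_square_inv[OF assms(2,3) k k']
    by (auto simp: weak_pullback_homs weak_pullback_obj)
qed

lemma covers_pullback_cover:
  assumes R: "covers Y R" and R': "covers Z R'"
  shows "covers pullback (pullback_cover X t s R R')"
  unfolding covers_def
proof (intro conjI ballI)
  have fin: "finite (homs X x x')" for x x' using X by (simp add: finitary_groupoid_def)
  show "finite (pullback_cover X t s R R')"
    using R R' fin by (auto simp: pullback_cover_def covers_def)
  show "pullback_cover X t s R R' \<subseteq> Obj pullback"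
    using R R' by (auto simp: mem_pullback_cover weak_pullback_obj covers_def)
  fix p assume p: "p \<in> Obj pullback"
  obtain y k z where pk: "p = (y, k, z)" by (cases p)
  have "y \<in> Obj Y" "z \<in> Obj Z" using p by (auto simp: pk weak_pullback_obj)
  then obtain y' u z' w where u: "y' \<in> R" "u \<in> homs Y y y'" and w: "z' \<in> R'" "w \<in> homs Z z z'"
    using R R' by (fastforce simp: covers_def)
  show "\<exists>r\<in>pullback_cover X t s R R'. homs pullback p r \<noteq> {}"
    using transport_square[OF p[unfolded pk] u(2) w(2)] u(1) w(1) unfolding pk
    by (intro bexI[of _ "(y', Comp X (Comp X (amap s w) k) (inv_arrow X (amap t u)), z')"])
      (auto simp: mem_pullback_cover)
qed

lemma weak_pullback_finitary: "finitary_groupoid pullback"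
  unfolding finitary_groupoid_def
proof (intro conjI allI)
  obtain R R' where "covers Y R" "covers Z R'"
    using Y Z by (auto simp: finitary_groupoid_def)
  then show "\<exists>R. covers pullback R" using covers_pullback_cover by blast
  fix p q :: "'y \<times> 'xm \<times> 'z"
  have "finite (homs Y y y')" "finite (homs Z z z')" for y y' z z'
    using Y Z by (auto simp: finitary_groupoid_def)
  then have "finite ((\<lambda>(u, w). (p, (u, w), q)) `
      (homs Y (fst p) (fst q) \<times> homs Z (snd (snd p)) (snd (snd q))))" by blast
  moreover have "homs pullback p q \<subseteq> (\<lambda>(u, w). (p, (u, w), q)) `
      (homs Y (fst p) (fst q) \<times> homs Z (snd (snd p)) (snd (snd q)))"
    by (auto simp: weak_pullback_homs)
  ultimately show "finite (homs pullback p q)" by (rule finite_subset[rotated])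
qed (rule weak_pullback_groupoid)

text \<open>An arrow of the weak pullback out of \<open>(y, k, z)\<close> is an arbitrary pair of arrows out of \<open>y\<close>
  and \<open>z\<close>: the middle component of its target is then forced.\<close>

lemma card_outs_pullback:
  assumes p: "(y, k, z) \<in> Obj pullback"
  shows "card (outs pullback (pullback_cover X t s R R') (y, k, z)) = card (outs Y R y) * card (outs Z R' z)"
proof -
  let ?\<phi> = "\<lambda>(u, w). ((y, k, z), (u, w),
      (Cod Y u, Comp X (Comp X (amap s w) k) (inv_arrow X (amap t u)), Cod Z w))"
  have k: "k \<in> homs X (omap t y) (omap s z)" using p by (simp add: weak_pullback_obj)
  have "bij_betw ?\<phi> (outs Y R y \<times> outs Z R' z) (outs pullback (pullback_cover X t s R R') (y, k, z))"
  proof (rule bij_betw_byWitness[where f' = "\<lambda>h. fst (snd h)"])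
    show "?\<phi> ` (outs Y R y \<times> outs Z R' z) \<subseteq> outs pullback (pullback_cover X t s R R') (y, k, z)"
    proof (rule image_subsetI, elim SigmaE2 SigmaE, hypsubst)
      fix u w assume uw: "u \<in> outs Y R y" "w \<in> outs Z R' z"
      then have u: "u \<in> homs Y y (Cod Y u)" "Cod Y u \<in> R" and w: "w \<in> homs Z z (Cod Z w)" "Cod Z w \<in> R'"
        by (auto simp: outs_def homs_def)
      show "?\<phi> (u, w) \<in> outs pullback (pullback_cover X t s R R') (y, k, z)"
        using homsD[OF transport_square(2)[OF p u(1) w(1)]] transport_square(1)[OF p u(1) w(1)] u(2) w(2)
        by (simp add: outs_def mem_pullback_cover)
    qed
    \<comment> \<open>The pair determines \<open>h\<close>: the outer components of its target are
      the codomains of \<open>u\<close> and \<open>w\<close>, and the middle one is recovered from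
      the square.\<close>
    have out: "fst (snd h) \<in> outs Y R y \<times> outs Z R' z \<and> ?\<phi> (fst (snd h)) = h"
      if h: "h \<in> outs pullback (pullback_cover X t s R R') (y, k, z)" for h
    proof -
      obtain y' k' z' where q: "Cod pullback h = (y', k', z')" by (cases "Cod pullback h")
      have "h \<in> homs pullback (y, k, z) (y', k', z')" and q': "(y', k', z') \<in> pullback_cover X t s R R'"
        using h q by (auto simp: outs_def homs_def)
      then obtain u w where h': "h = ((y, k, z), (u, w), (y', k', z'))" and u: "u \<in> homs Y y y'"
        and w: "w \<in> homs Z z z'" and eq: "Comp X k' (amap t u) = Comp X (amap s w) k"
        by (auto simp: weak_pullback_homs)
      have k': "k' \<in> homs X (omap t y') (omap s z')" "y' \<in> R" "z' \<in> R'"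
        using q' by (auto simp: mem_pullback_cover)
      show ?thesis
        using weak_pullback_square_inv[OF u w k k'(1)] eq homsD[OF u] homsD[OF w] k'(2,3)
        by (simp add: h' outs_def)
    qed
    then show "(\<lambda>h. fst (snd h)) ` outs pullback (pullback_cover X t s R R') (y, k, z) \<subseteq> outs Y R y \<times> outs Z R' z"
      "\<forall>h\<in>outs pullback (pullback_cover X t s R R') (y, k, z). ?\<phi> (fst (snd h)) = h" by blast+
    show "\<forall>a\<in>outs Y R y \<times> outs Z R' z. fst (snd (?\<phi> a)) = a"
      by (simp add: split_beta)
  qed
  from bij_betw_same_card[OF this] show ?thesis by (simp add: card_cartesian_product)
qed

end

text \<open>The range \<open>H y\<close> depends on neither \<open>z\<close> nor \<open>k\<close>,
  so the sum over \<open>g\<close> can be moved outside both, and the product weight splits into a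
  factor for each level. In the application \<open>H y\<close> is the set of arrows
  \<open>x \<rightarrow> s y\<close> and \<open>K y z\<close> that of arrows
  \<open>t y \<rightarrow> s' z\<close>.\<close>

lemma weighted_sum_fubini:
  fixes W :: "'w vect" and T :: "'y \<Rightarrow> 'g \<Rightarrow> 'z \<Rightarrow> 'k \<Rightarrow> 'w"
  assumes W: "cvec W" and R: "finite R" "finite R'"
    and H: "\<And>y. y \<in> R \<Longrightarrow> finite (H y)" and K: "\<And>y z. y \<in> R \<Longrightarrow> z \<in> R' \<Longrightarrow> finite (K y z)"
    and T: "\<And>y g z k. y \<in> R \<Longrightarrow> g \<in> H y \<Longrightarrow> z \<in> R' \<Longrightarrow> k \<in> K y z \<Longrightarrow> T y g z k \<in> carrier W"
  shows "(\<Oplus>\<^bsub>W\<^esub>p\<in>(\<lambda>((y, z), k). (y, k, z)) ` (SIGMA q:R \<times> R'. K (fst q) (snd q)).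
      (c (fst p) * d (snd (snd p))) \<odot>\<^bsub>W\<^esub>
        (\<Oplus>\<^bsub>W\<^esub>g\<in>H (fst p). T (fst p) g (snd (snd p)) (fst (snd p)))) =
    (\<Oplus>\<^bsub>W\<^esub>y\<in>R. c y \<odot>\<^bsub>W\<^esub> (\<Oplus>\<^bsub>W\<^esub>g\<in>H y. \<Oplus>\<^bsub>W\<^esub>z\<in>R'. d z \<odot>\<^bsub>W\<^esub> (\<Oplus>\<^bsub>W\<^esub>k\<in>K y z. T y g z k)))"
proof -
  interpret W: Module.module class_ring W by (rule W)
  note sm = cvecD(3)[OF W] and smult_sum = chom_finsum[OF chom_smult[OF W]]
  let ?S = "\<lambda>y z k. \<Oplus>\<^bsub>W\<^esub>g\<in>H y. T y g z k"
  let ?t = "\<lambda>q k. (c (fst q) * d (snd q)) \<odot>\<^bsub>W\<^esub> ?S (fst q) (snd q) k"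
  have S: "?S y z k \<in> carrier W" if "y \<in> R" "z \<in> R'" "k \<in> K y z" for y z k
    using T that by (intro W.M.finsum_closed) blast
  have t: "?t q k \<in> carrier W" if "q \<in> R \<times> R'" "k \<in> K (fst q) (snd q)" for q k
    using that S by (intro sm) auto
  have Tk: "(\<Oplus>\<^bsub>W\<^esub>k\<in>K y z. T y g z k) \<in> carrier W" if "y \<in> R" "z \<in> R'" "g \<in> H y" for y z g
    using T that by (intro W.M.finsum_closed) blast
  have "(\<Oplus>\<^bsub>W\<^esub>p\<in>(\<lambda>((y, z), k). (y, k, z)) ` (SIGMA q:R \<times> R'. K (fst q) (snd q)).
      (c (fst p) * d (snd (snd p))) \<odot>\<^bsub>W\<^esub> ?S (fst p) (snd (snd p)) (fst (snd p))) =
      (\<Oplus>\<^bsub>W\<^esub>p\<in>(SIGMA q:R \<times> R'. K (fst q) (snd q)). ?t (fst p) (snd p))"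
    using S sm by (subst W.M.finsum_reindex) (auto simp: inj_on_def split_beta)
  also have "\<dots> = (\<Oplus>\<^bsub>W\<^esub>q\<in>R \<times> R'. \<Oplus>\<^bsub>W\<^esub>k\<in>K (fst q) (snd q). ?t q k)"
    using R K t by (intro W.M.finsum_Sigma) auto
  also have "\<dots> = (\<Oplus>\<^bsub>W\<^esub>y\<in>R. \<Oplus>\<^bsub>W\<^esub>z\<in>R'. \<Oplus>\<^bsub>W\<^esub>k\<in>K y z. ?t (y, z) k)"
  proof -
    have "(\<Oplus>\<^bsub>W\<^esub>k\<in>K y z. ?t (y, z) k) \<in> carrier W" if "y \<in> R" "z \<in> R'" for y z
      using t[of "(y, z)"] that by (intro W.M.finsum_closed) auto
    then show ?thesis
      using W.M.finsum_Sigma[of R "\<lambda>_. R'" "\<lambda>y z. \<Oplus>\<^bsub>W\<^esub>k\<in>K y z. ?t (y, z) k"] R by simp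
  qed
  also have "\<dots> = (\<Oplus>\<^bsub>W\<^esub>y\<in>R. c y \<odot>\<^bsub>W\<^esub>
      (\<Oplus>\<^bsub>W\<^esub>g\<in>H y. \<Oplus>\<^bsub>W\<^esub>z\<in>R'. d z \<odot>\<^bsub>W\<^esub> (\<Oplus>\<^bsub>W\<^esub>k\<in>K y z. T y g z k)))"
  proof (intro W.M.finsum_cong' refl)
    have inner: "(\<Oplus>\<^bsub>W\<^esub>g\<in>H y. \<Oplus>\<^bsub>W\<^esub>z\<in>R'. d z \<odot>\<^bsub>W\<^esub> (\<Oplus>\<^bsub>W\<^esub>k\<in>K y z. T y g z k)) \<in> carrier W"
      if "y \<in> R" for y
      using that Tk sm by (intro W.M.finsum_closed Pi_I) auto
    show "(\<lambda>y. c y \<odot>\<^bsub>W\<^esub> (\<Oplus>\<^bsub>W\<^esub>g\<in>H y. \<Oplus>\<^bsub>W\<^esub>z\<in>R'. d z \<odot>\<^bsub>W\<^esub> (\<Oplus>\<^bsub>W\<^esub>k\<in>K y z. T y g z k)))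
        \<in> R \<rightarrow> carrier W"
      using sm inner by blast
    fix y assume y: "y \<in> R"
    have z: "(\<Oplus>\<^bsub>W\<^esub>g\<in>H y. d z \<odot>\<^bsub>W\<^esub> (\<Oplus>\<^bsub>W\<^esub>k\<in>K y z. T y g z k)) =
        d z \<odot>\<^bsub>W\<^esub> (\<Oplus>\<^bsub>W\<^esub>k\<in>K y z. ?S y z k)" if "z \<in> R'" for z
    proof -
      have "(\<Oplus>\<^bsub>W\<^esub>g\<in>H y. d z \<odot>\<^bsub>W\<^esub> (\<Oplus>\<^bsub>W\<^esub>k\<in>K y z. T y g z k)) =
          d z \<odot>\<^bsub>W\<^esub> (\<Oplus>\<^bsub>W\<^esub>g\<in>H y. \<Oplus>\<^bsub>W\<^esub>k\<in>K y z. T y g z k)"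
        by (rule smult_sum[OF Tk[OF y that], symmetric])
      also have "(\<Oplus>\<^bsub>W\<^esub>g\<in>H y. \<Oplus>\<^bsub>W\<^esub>k\<in>K y z. T y g z k) = (\<Oplus>\<^bsub>W\<^esub>k\<in>K y z. ?S y z k)"
        using H K T y that by (intro W.M.finsum_swap) auto
      finally show ?thesis .
    qed
    have kz: "(\<Oplus>\<^bsub>W\<^esub>k\<in>K y z. ?S y z k) \<in> carrier W" if "z \<in> R'" for z
      using S[OF y that] by (intro W.M.finsum_closed) blast
    have "(\<Oplus>\<^bsub>W\<^esub>g\<in>H y. \<Oplus>\<^bsub>W\<^esub>z\<in>R'. d z \<odot>\<^bsub>W\<^esub> (\<Oplus>\<^bsub>W\<^esub>k\<in>K y z. T y g z k)) =
        (\<Oplus>\<^bsub>W\<^esub>z\<in>R'. \<Oplus>\<^bsub>W\<^esub>g\<in>H y. d z \<odot>\<^bsub>W\<^esub> (\<Oplus>\<^bsub>W\<^esub>k\<in>K y z. T y g z k))"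
      using H R y Tk sm by (intro W.M.finsum_swap) auto
    also have "\<dots> = (\<Oplus>\<^bsub>W\<^esub>z\<in>R'. d z \<odot>\<^bsub>W\<^esub> (\<Oplus>\<^bsub>W\<^esub>k\<in>K y z. ?S y z k))"
      using z sm kz by (intro W.M.finsum_cong' refl) auto
    finally have "c y \<odot>\<^bsub>W\<^esub> (\<Oplus>\<^bsub>W\<^esub>g\<in>H y. \<Oplus>\<^bsub>W\<^esub>z\<in>R'. d z \<odot>\<^bsub>W\<^esub> (\<Oplus>\<^bsub>W\<^esub>k\<in>K y z. T y g z k)) =
        c y \<odot>\<^bsub>W\<^esub> (\<Oplus>\<^bsub>W\<^esub>z\<in>R'. d z \<odot>\<^bsub>W\<^esub> (\<Oplus>\<^bsub>W\<^esub>k\<in>K y z. ?S y z k))" by simp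
    also have "\<dots> = (\<Oplus>\<^bsub>W\<^esub>z\<in>R'. c y \<odot>\<^bsub>W\<^esub> (d z \<odot>\<^bsub>W\<^esub> (\<Oplus>\<^bsub>W\<^esub>k\<in>K y z. ?S y z k)))"
      by (rule smult_sum[OF sm[OF kz]])
    also have "\<dots> = (\<Oplus>\<^bsub>W\<^esub>z\<in>R'. \<Oplus>\<^bsub>W\<^esub>k\<in>K y z. ?t (y, z) k)"
    proof (intro W.M.finsum_cong' refl)
      show "(\<lambda>z. \<Oplus>\<^bsub>W\<^esub>k\<in>K y z. ?t (y, z) k) \<in> R' \<rightarrow> carrier W"
        using t y by (intro Pi_I W.M.finsum_closed) auto
      fix z assume z: "z \<in> R'"
      have "(c y * d z) \<odot>\<^bsub>W\<^esub> (\<Oplus>\<^bsub>W\<^esub>k\<in>K y z. ?S y z k) = (\<Oplus>\<^bsub>W\<^esub>k\<in>K y z. ?t (y, z) k)"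
        using smult_sum[OF S[OF y z]] by simp
      then show "c y \<odot>\<^bsub>W\<^esub> (d z \<odot>\<^bsub>W\<^esub> (\<Oplus>\<^bsub>W\<^esub>k\<in>K y z. ?S y z k)) = (\<Oplus>\<^bsub>W\<^esub>k\<in>K y z. ?t (y, z) k)"
        using cvecD(8)[OF W kz[OF z]] by simp
    qed
    finally show "(\<Oplus>\<^bsub>W\<^esub>z\<in>R'. \<Oplus>\<^bsub>W\<^esub>k\<in>K y z. ?t (y, z) k) = c y \<odot>\<^bsub>W\<^esub>
        (\<Oplus>\<^bsub>W\<^esub>g\<in>H y. \<Oplus>\<^bsub>W\<^esub>z\<in>R'. d z \<odot>\<^bsub>W\<^esub> (\<Oplus>\<^bsub>W\<^esub>k\<in>K y z. T y g z k))" by simp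
  qed
  finally show ?thesis .
qed

section \<open>Vertical composites\<close>

lemma nat_iso_ident:
  fixes B :: "('p, 'q) category" and A :: "('r, 'l) category"
  assumes B: "category B" and A: "category A" and f: "cat_functor B A f" and g: "cat_functor B A g"
    and \<zeta>: "nat_iso B A f g \<zeta>" "\<And>y. y \<in> Obj B \<Longrightarrow> \<zeta> y = Ident A (omap f y)"
  shows "\<And>y. y \<in> Obj B \<Longrightarrow> omap f y = omap g y" and "\<And>u. u \<in> Arr B \<Longrightarrow> amap f u = amap g u"
proof -
  show o: "omap f y = omap g y" if "y \<in> Obj B" for y
  proof -
    \<comment> \<open>Hom-sets record the ends of their arrows, so an identity typed from
      \<open>f y\<close> to \<open>g y\<close> forces the two objects to coincide.\<close>
    have "Ident A (omap f y) \<in> homs A (omap f y) (omap g y)"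
      using \<zeta> that by (auto simp: nat_iso_def)
    moreover have "Ident A (omap f y) \<in> homs A (omap f y) (omap f y)"
      by (rule category.ident_hom[OF A cat_functor.obj[OF f that]])
    ultimately show ?thesis by (simp add: homs_def)
  qed
  show "amap f u = amap g u" if u: "u \<in> Arr B" for u
  proof -
    note du = category.dom_obj[OF B u] category.cod_obj[OF B u]
    have "Comp A (Ident A (omap f (Cod B u))) (amap f u) =
        Comp A (amap g u) (Ident A (omap f (Dom B u)))"
      using \<zeta> u du by (auto simp: nat_iso_def)
    then show ?thesis
      using category.comp_ident_left[OF A cat_functor.arr[OF f arr_homs[OF u]]]
        category.comp_ident_right[OF A cat_functor.arr[OF g arr_homs[OF u]]] o[OF du(1)] by simp
  qed
qed

lemma is_span_imp_finitary: "is_span A1 A2 X \<Longrightarrow> finitary_span A1 A2 X"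
  by (simp add: is_span_def finitary_span_def ess_finite_imp_finitary)

lemma is_span2_imp_finitary: "is_span2 A1 A2 X1 X2 Y \<Longrightarrow> finitary_span2 A1 A2 X1 X2 Y"
  by (simp add: is_span2_def finitary_span2_def ess_finite_imp_finitary)

context
  fixes A1 :: "('a, 'am) category" and A2 :: "('b, 'bm) category"
    and X1 :: "('x1, 'xm1, 'a, 'am, 'b, 'bm) span"
    and X2 :: "('x2, 'xm2, 'a, 'am, 'b, 'bm) span"
    and Y :: "('y, 'ym, 'x1, 'xm1, 'x2, 'xm2, 'am, 'bm) span2"
  assumes X1: "finitary_span A1 A2 X1" and X2: "finitary_span A1 A2 X2"
    and Y: "finitary_span2 A1 A2 X1 X2 Y" and strict: "strictly_commuting A1 A2 X1 Y"
begin

lemma strict_functors: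
  "cat_functor (apex Y) A1 (sleg X1 \<circ>\<^sub>F sleg Y)" "cat_functor (apex Y) A1 (sleg X2 \<circ>\<^sub>F tleg Y)"
  "cat_functor (apex Y) A2 (tleg X1 \<circ>\<^sub>F sleg Y)" "cat_functor (apex Y) A2 (tleg X2 \<circ>\<^sub>F tleg Y)"
  using X1 X2 Y by (auto simp: finitary_span_def finitary_span2_def intro: cat_functor_comp)

lemma strictly_commuting_legs:
  shows "\<And>y. y \<in> Obj (apex Y) \<Longrightarrow> omap (sleg X1) (omap (sleg Y) y) = omap (sleg X2) (omap (tleg Y) y)"
    and "\<And>u. u \<in> Arr (apex Y) \<Longrightarrow> amap (sleg X1) (amap (sleg Y) u) = amap (sleg X2) (amap (tleg Y) u)"
    and "\<And>y. y \<in> Obj (apex Y) \<Longrightarrow> omap (tleg X1) (omap (sleg Y) y) = omap (tleg X2) (omap (tleg Y) y)"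
    and "\<And>u. u \<in> Arr (apex Y) \<Longrightarrow> amap (tleg X1) (amap (sleg Y) u) = amap (tleg X2) (amap (tleg Y) u)"
proof -
  have cat: "category (apex Y)" "category A1" "category A2"
    using strict_functors(1,3) by (auto simp: cat_functor_def)
  have nat: "nat_iso (apex Y) A1 (sleg X1 \<circ>\<^sub>F sleg Y) (sleg X2 \<circ>\<^sub>F tleg Y) (zeta_s Y)"
    "nat_iso (apex Y) A2 (tleg X1 \<circ>\<^sub>F sleg Y) (tleg X2 \<circ>\<^sub>F tleg Y) (zeta_t Y)"
    using Y by (auto simp: finitary_span2_def)
  note s = nat_iso_ident[OF cat(1,2) strict_functors(1,2) nat(1)]
  note t = nat_iso_ident[OF cat(1,3) strict_functors(3,4) nat(2)]
  show "\<And>y. y \<in> Obj (apex Y) \<Longrightarrow> omap (sleg X1) (omap (sleg Y) y) = omap (sleg X2) (omap (tleg Y) y)"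
    "\<And>u. u \<in> Arr (apex Y) \<Longrightarrow> amap (sleg X1) (amap (sleg Y) u) = amap (sleg X2) (amap (tleg Y) u)"
    using s strict by (simp_all add: strictly_commuting_def)
  show "\<And>y. y \<in> Obj (apex Y) \<Longrightarrow> omap (tleg X1) (omap (sleg Y) y) = omap (tleg X2) (omap (tleg Y) y)"
    "\<And>u. u \<in> Arr (apex Y) \<Longrightarrow> amap (tleg X1) (amap (sleg Y) u) = amap (tleg X2) (amap (tleg Y) u)"
    using t strict by (simp_all add: strictly_commuting_def)
qed

text \<open>\<open>strictly_commuting\<close> places the identities at objects reached through
  \<open>X1\<close>; in the computation they are composed with arrows typed through
  \<open>X2\<close>.\<close>

lemma strictly_commuting_zeta:
  assumes "y \<in> Obj (apex Y)"
  shows "zeta_s Y y = Ident A1 (omap (sleg X2) (omap (tleg Y) y))"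
    and "zeta_t Y y = Ident A2 (omap (tleg X2) (omap (tleg Y) y))"
  using assms strict strictly_commuting_legs(1,3) by (simp_all add: strictly_commuting_def)

end

lemma vcomp_simps:
  "apex (vcomp X2 Y' Y) = weak_pullback (apex Y) (apex Y') (apex X2) (tleg Y) (sleg Y')"
  "sleg (vcomp X2 Y' Y) = sleg Y \<circ>\<^sub>F wp_fst"
  "tleg (vcomp X2 Y' Y) = tleg Y' \<circ>\<^sub>F wp_snd"
  "zeta_s (vcomp X2 Y' Y) (y, k, y') = amap (sleg X2) k"
  "zeta_t (vcomp X2 Y' Y) (y, k, y') = amap (tleg X2) k"
  by (simp_all add: vcomp_def)

text \<open>The components of the composite are images of the tautological isomorphism under the
  legs of \<open>X2\<close>. Their naturality is the image of the square defining an arrow of the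
  weak pullback, once strictness has rewritten its outer edges through \<open>X1\<close> and
  \<open>X3\<close>.\<close>

lemma finitary_span2_vcomp:
  assumes A1: "groupoid A1" and A2: "groupoid A2" and X1: "finitary_span A1 A2 X1"
    and X2: "finitary_span A1 A2 X2" and X3: "finitary_span A1 A2 X3"
    and Y: "finitary_span2 A1 A2 X1 X2 Y" "strictly_commuting A1 A2 X1 Y"
    and Y': "finitary_span2 A1 A2 X2 X3 Y'" "strictly_commuting A1 A2 X2 Y'"
  shows "finitary_span2 A1 A2 X1 X3 (vcomp X2 Y' Y)"
proof -
  have fn: "cat_functor (apex Y) (apex X1) (sleg Y)" "cat_functor (apex Y) (apex X2) (tleg Y)"
    "cat_functor (apex Y') (apex X2) (sleg Y')" "cat_functor (apex Y') (apex X3) (tleg Y')"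
    using Y(1) Y'(1) by (simp_all add: finitary_span2_def)
  have fin: "finitary_groupoid (apex Y)" "finitary_groupoid (apex Y')" "finitary_groupoid (apex X2)"
    using Y(1) Y'(1) X2 by (simp_all add: finitary_span_def finitary_span2_def)
  let ?P = "weak_pullback (apex Y) (apex Y') (apex X2) (tleg Y) (sleg Y')"
  note strict = strictly_commuting_legs[OF X1 X2 Y] and strict' = strictly_commuting_legs[OF X2 X3 Y']
  \<comment> \<open>Stated for abstract legs \<open>l1\<close>, \<open>l2\<close>,
    \<open>l3\<close>, so that one argument serves both the source legs into \<open>A1\<close> and
    the target legs into \<open>A2\<close>.\<close>
  have nat: "nat_iso ?P A (l1 \<circ>\<^sub>F (sleg Y \<circ>\<^sub>F wp_fst)) (l3 \<circ>\<^sub>F (tleg Y' \<circ>\<^sub>F wp_snd))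
      (\<lambda>(y, k, y'). amap l2 k)"
    if A: "groupoid A" and l2: "cat_functor (apex X2) A l2"
      and o: "\<And>y. y \<in> Obj (apex Y) \<Longrightarrow> omap l1 (omap (sleg Y) y) = omap l2 (omap (tleg Y) y)"
        "\<And>y. y \<in> Obj (apex Y') \<Longrightarrow> omap l2 (omap (sleg Y') y) = omap l3 (omap (tleg Y') y)"
      and m: "\<And>u. u \<in> Arr (apex Y) \<Longrightarrow> amap l1 (amap (sleg Y) u) = amap l2 (amap (tleg Y) u)"
        "\<And>u. u \<in> Arr (apex Y') \<Longrightarrow> amap l2 (amap (sleg Y') u) = amap l3 (amap (tleg Y') u)"
    for A :: "('p, 'q) category" and l1 l2 l3
    unfolding nat_iso_def
  proof (intro conjI ballI)
    fix p assume p: "p \<in> Obj ?P"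
    obtain y k y' where pk: "p = (y, k, y')" by (cases p)
    have k: "y \<in> Obj (apex Y)" "y' \<in> Obj (apex Y')"
      "k \<in> homs (apex X2) (omap (tleg Y) y) (omap (sleg Y') y')"
      using p by (auto simp: pk weak_pullback_def)
    show "(\<lambda>(y, k, y'). amap l2 k) p \<in> homs A (omap (l1 \<circ>\<^sub>F (sleg Y \<circ>\<^sub>F wp_fst)) p)
        (omap (l3 \<circ>\<^sub>F (tleg Y' \<circ>\<^sub>F wp_snd)) p)"
      using cat_functor.arr[OF l2 k(3)] k(1,2) by (simp add: pk o wp_fst_def wp_snd_def)
    then show "iso_arrow A ((\<lambda>(y, k, y'). amap l2 k) p)"
      by (rule groupoid.arr_iso[OF A homsD(1)])
  next
    fix h assume h: "h \<in> Arr ?P"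
    obtain y k y' u w z m z' where hk: "h = ((y, k, y'), (u, w), (z, m, z'))"
      by (metis prod.exhaust)
    have k: "k \<in> homs (apex X2) (omap (tleg Y) y) (omap (sleg Y') y')"
      and m': "m \<in> homs (apex X2) (omap (tleg Y) z) (omap (sleg Y') z')"
      and u: "u \<in> homs (apex Y) y z" and w: "w \<in> homs (apex Y') y' z'"
      and eq: "Comp (apex X2) m (amap (tleg Y) u) = Comp (apex X2) (amap (sleg Y') w) k"
      using h by (auto simp: hk weak_pullback_def)
    have "Comp A (amap l2 m) (amap l2 (amap (tleg Y) u)) =
        Comp A (amap l2 (amap (sleg Y') w)) (amap l2 k)"
      using cat_functor.comp[OF l2 cat_functor.arr[OF fn(2) u] m']
        cat_functor.comp[OF l2 k cat_functor.arr[OF fn(3) w]] eq by simp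
    then show "Comp A ((\<lambda>(y, k, y'). amap l2 k) (Cod ?P h)) (amap (l1 \<circ>\<^sub>F (sleg Y \<circ>\<^sub>F wp_fst)) h) =
        Comp A (amap (l3 \<circ>\<^sub>F (tleg Y' \<circ>\<^sub>F wp_snd)) h) ((\<lambda>(y, k, y'). amap l2 k) (Dom ?P h))"
      using homsD(1)[OF u] homsD(1)[OF w]
      by (simp add: hk weak_pullback_def m wp_fst_def wp_snd_def)
  qed
  have l2: "cat_functor (apex X2) A1 (sleg X2)" "cat_functor (apex X2) A2 (tleg X2)"
    using X2 by (simp_all add: finitary_span_def)
  show ?thesis
    unfolding finitary_span2_def vcomp_simps
  proof (intro conjI)
    show "finitary_groupoid ?P" by (rule weak_pullback_finitary[OF fn(2,3) fin])
    show "cat_functor ?P (apex X1) (sleg Y \<circ>\<^sub>F wp_fst)"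
      by (rule cat_functor_comp[OF fn(1) wp_fst_functor[OF fn(2,3) fin]])
    show "cat_functor ?P (apex X3) (tleg Y' \<circ>\<^sub>F wp_snd)"
      by (rule cat_functor_comp[OF fn(4) wp_snd_functor[OF fn(2,3) fin]])
    show "nat_iso ?P A1 (sleg X1 \<circ>\<^sub>F (sleg Y \<circ>\<^sub>F wp_fst)) (sleg X3 \<circ>\<^sub>F (tleg Y' \<circ>\<^sub>F wp_snd))
        (zeta_s (vcomp X2 Y' Y))"
      using nat[OF A1 l2(1) strict(1) strict'(1) strict(2) strict'(2)] by (simp add: vcomp_def)
    show "nat_iso ?P A2 (tleg X1 \<circ>\<^sub>F (sleg Y \<circ>\<^sub>F wp_fst)) (tleg X3 \<circ>\<^sub>F (tleg Y' \<circ>\<^sub>F wp_snd))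
        (zeta_t (vcomp X2 Y' Y))"
      using nat[OF A2 l2(2) strict(3) strict'(3) strict(4) strict'(4)] by (simp add: vcomp_def)
  qed
qed

text \<open>Three uses of the formula on generators: for \<open>Y\<close> over \<open>R\<close>, for
  \<open>Y'\<close> over \<open>R'\<close>, and for the composite over the cover of triples they
  generate. Multiplicativity of the weights and the exchange of sums reduce the claim to an equality
  of single terms.\<close>

lemma Lambda_span2_vcomp_incl:
  fixes F :: "('a, 'am, 'v) vfunctor"
    and Y :: "('y, 'ym, 'x1, 'xm1, 'x2, 'xm2, 'am, 'bm) span2"
  assumes A1: "groupoid A1" and A2: "groupoid A2" and X1: "finitary_span A1 A2 X1"
    and X2: "finitary_span A1 A2 X2" and X3: "finitary_span A1 A2 X3"
    and Y: "finitary_span2 A1 A2 X1 X2 Y" "strictly_commuting A1 A2 X1 Y"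
    and Y': "finitary_span2 A1 A2 X2 X3 Y'" "strictly_commuting A1 A2 X2 Y'"
    and F: "modf A1 F"
    and x: "x \<in> Obj (apex X1)" and h: "h \<in> homs A2 (omap (tleg X1) x) a"
    and v: "v \<in> carrier (omap (F \<circ>\<^sub>F sleg X1) x)"
  shows "Lambda_span2 A2 X1 X3 (vcomp X2 Y' Y) F a
      (push_incl (apex X1) A2 (tleg X1) (F \<circ>\<^sub>F sleg X1) a x h v) =
    Lambda_span2 A2 X2 X3 Y' F a
      (Lambda_span2 A2 X1 X2 Y F a (push_incl (apex X1) A2 (tleg X1) (F \<circ>\<^sub>F sleg X1) a x h v))"
proof -
  interpret A2: groupoid A2 by (rule A2)
  have fn: "cat_functor (apex Y) (apex X1) (sleg Y)" "cat_functor (apex Y) (apex X2) (tleg Y)"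
    "cat_functor (apex Y') (apex X2) (sleg Y')" "cat_functor (apex Y') (apex X3) (tleg Y')"
    using Y(1) Y'(1) by (simp_all add: finitary_span2_def)
  have leg: "cat_functor (apex X1) A1 (sleg X1)" "cat_functor (apex X1) A2 (tleg X1)"
    "cat_functor (apex X2) A1 (sleg X2)" "cat_functor (apex X2) A2 (tleg X2)"
    "cat_functor (apex X3) A1 (sleg X3)" "cat_functor (apex X3) A2 (tleg X3)"
    using X1 X2 X3 by (simp_all add: finitary_span_def)
  have fin: "finitary_groupoid (apex Y)" "finitary_groupoid (apex Y')" "finitary_groupoid (apex X2)"
    "finitary_groupoid (apex X1)"
    using Y(1) Y'(1) X1 X2 by (simp_all add: finitary_span_def finitary_span2_def)
  have gr: "groupoid (apex X1)" "groupoid (apex X2)"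
    using fin by (simp_all add: finitary_groupoid_def)
  obtain R R' where R: "covers (apex Y) R" and R': "covers (apex Y') R'"
    using fin by (auto simp: finitary_groupoid_def)
  have RO: "finite R" "finite R'" "y \<in> R \<Longrightarrow> y \<in> Obj (apex Y)" "z \<in> R' \<Longrightarrow> z \<in> Obj (apex Y')" for y z
    using R R' by (auto simp: covers_def)
  note strict = strictly_commuting_legs[OF X1 X2 Y] strictly_commuting_zeta[OF X1 X2 Y]
    and strict' = strictly_commuting_legs[OF X2 X3 Y'] strictly_commuting_zeta[OF X2 X3 Y']
  note vc = finitary_span2_vcomp[OF A1 A2 X1 X2 X3 Y Y']
  define H where "H y = homs (apex X1) x (omap (sleg Y) y)" for y
  define K where "K y z = homs (apex X2) (omap (tleg Y) y) (omap (sleg Y') z)" for y z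
  define W where "W = push_obj (apex X3) A2 (tleg X3) (F \<circ>\<^sub>F sleg X3) a"
  define m where "m g = Comp A2 h (amap (tleg X1) (inv_arrow (apex X1) g))" for g
  define u where "u g = amap (F \<circ>\<^sub>F sleg X1) g v" for g
  \<comment> \<open>The common summand, \<open>h t\<^sub>1(g)\<inverse> t\<^sub>2(k)\<inverse>
    \<otimes> F(s\<^sub>2(k)) F(s\<^sub>1(g)) v\<close>, towards which both sides are
    rewritten.\<close>
  define T where "T y g z k = push_incl (apex X3) A2 (tleg X3) (F \<circ>\<^sub>F sleg X3) a (omap (tleg Y') z)
      (Comp A2 (m g) (inv_arrow A2 (amap (tleg X2) k))) (amap F (amap (sleg X2) k) (u g))"
    for y :: 'y and g z k
  let ?c = "\<lambda>y. 1 / of_nat (card (outs (apex Y) R y)) :: complex"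
  let ?d = "\<lambda>z. 1 / of_nat (card (outs (apex Y') R' z)) :: complex"
  let ?I = "push_incl (apex X1) A2 (tleg X1) (F \<circ>\<^sub>F sleg X1) a x h v"
  have m: "m g \<in> homs A2 (omap (tleg X2) (omap (tleg Y) y)) a"
    and u: "u g \<in> carrier (omap (F \<circ>\<^sub>F sleg X2) (omap (tleg Y) y))"
    if "y \<in> R" "g \<in> H y" for y g
  proof -
    have g: "g \<in> homs (apex X1) x (omap (sleg Y) y)" using that by (simp add: H_def)
    show "m g \<in> homs A2 (omap (tleg X2) (omap (tleg Y) y)) a"
      using A2.comp_hom[OF cat_functor.arr[OF leg(2) groupoid.inv_arrow(1)[OF gr(1) g]] h]
        strict(3)[OF RO(3)[OF that(1)]] by (simp add: m_def)
    show "u g \<in> carrier (omap (F \<circ>\<^sub>F sleg X2) (omap (tleg Y) y))"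
      using modfD(5)[OF modf_comp[OF F leg(1)] g v] strict(1)[OF RO(3)[OF that(1)]] by (simp add: u_def)
  qed
  have T: "T y g z k \<in> carrier W"
    if "y \<in> R" "g \<in> H y" "z \<in> R'" "k \<in> K y z" for y g z k
  proof -
    have k: "k \<in> homs (apex X2) (omap (tleg Y) y) (omap (sleg Y') z)" using that by (simp add: K_def)
    note tk = cat_functor.arr[OF leg(4) k]
    show ?thesis
      unfolding T_def W_def
    proof (rule chomD(3)[OF push_incl_hom[OF leg(6) modf_comp[OF F leg(5)]]])
      show "omap (tleg Y') z \<in> Obj (apex X3)" by (rule cat_functor.obj[OF fn(4) RO(4)[OF that(3)]])
      show "Comp A2 (m g) (inv_arrow A2 (amap (tleg X2) k))
          \<in> homs A2 (omap (tleg X3) (omap (tleg Y') z)) a"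
        using A2.comp_hom[OF A2.inv_arrow(1)[OF tk] m[OF that(1,2)]] strict'(3)[OF RO(4)[OF that(3)]]
        by simp
      show "amap F (amap (sleg X2) k) (u g) \<in> carrier (omap (F \<circ>\<^sub>F sleg X3) (omap (tleg Y') z))"
        using modfD(5)[OF modf_comp[OF F leg(3)] k u[OF that(1,2)]] strict'(1)[OF RO(4)[OF that(3)]]
        by simp
    qed
  qed
  have W: "cvec W" unfolding W_def by (rule push_cvec[OF leg(6) modf_comp[OF F leg(5)]])
  let ?E = "pullback_cover (apex X2) (tleg Y) (sleg Y') R R'"
  have E: "covers (apex (vcomp X2 Y' Y)) ?E"
    unfolding vcomp_simps by (rule covers_pullback_cover[OF fn(2,3) fin(1-3) R R'])
  have H_fin: "finite (H y)" and K_fin: "finite (K y z)" for y z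
    using fin by (simp_all add: H_def K_def finitary_groupoid_def)
  \<comment> \<open>The weight of a triple is the product of the weights of its outer components,
    whatever its middle arrow is.\<close>
  have outs: "1 / of_nat (card (outs (apex (vcomp X2 Y' Y)) ?E p)) = ?c (fst p) * ?d (snd (snd p))"
    if "p \<in> ?E" for p
  proof -
    obtain y k z where pk: "p = (y, k, z)" by (cases p)
    have "p \<in> Obj (apex (vcomp X2 Y' Y))" using E that by (auto simp: covers_def)
    then show ?thesis
      using card_outs_pullback[OF fn(2,3) fin(1-3), where y = y and k = k and z = z and R = R and R' = R'] by (simp add: vcomp_simps pk)
  qed
  \<comment> \<open>For the composite, \<open>k\<close> is the middle component of the object
    \<open>p\<close>, so its images under the legs of \<open>X2\<close> appear here as
    \<open>zeta_s\<close> and \<open>zeta_t\<close> of \<open>vcomp\<close>.\<close>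
  have "Lambda_span2 A2 X1 X3 (vcomp X2 Y' Y) F a ?I =
      (\<Oplus>\<^bsub>W\<^esub>p\<in>?E. (1 / of_nat (card (outs (apex (vcomp X2 Y' Y)) ?E p))) \<odot>\<^bsub>W\<^esub>
        (\<Oplus>\<^bsub>W\<^esub>g\<in>H (fst p). T (fst p) g (snd (snd p)) (fst (snd p))))"
    unfolding Lambda_span2_incl[OF A2 X1 X3 vc F E x h v] W_def T_def m_def u_def H_def
    by (simp add: vcomp_def wp_fst_def wp_snd_def split_beta)
  also have "\<dots> = (\<Oplus>\<^bsub>W\<^esub>p\<in>?E. (?c (fst p) * ?d (snd (snd p))) \<odot>\<^bsub>W\<^esub>
        (\<Oplus>\<^bsub>W\<^esub>g\<in>H (fst p). T (fst p) g (snd (snd p)) (fst (snd p))))"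
  proof -
    interpret W: Module.module class_ring W by (rule W)
    show ?thesis
      using outs T by (intro W.M.finsum_cong' refl Pi_I cvecD(3)[OF W] W.M.finsum_closed)
        (auto simp: mem_pullback_cover K_def)
  qed
  also have "\<dots> = (\<Oplus>\<^bsub>W\<^esub>y\<in>R. ?c y \<odot>\<^bsub>W\<^esub>
      (\<Oplus>\<^bsub>W\<^esub>g\<in>H y. \<Oplus>\<^bsub>W\<^esub>z\<in>R'. ?d z \<odot>\<^bsub>W\<^esub> (\<Oplus>\<^bsub>W\<^esub>k\<in>K y z. T y g z k)))"
    unfolding pullback_cover_def K_def[symmetric]
    by (rule weighted_sum_fubini[OF W RO(1,2) H_fin K_fin T])
  also have "\<dots> = (\<Oplus>\<^bsub>W\<^esub>y\<in>R. ?c y \<odot>\<^bsub>W\<^esub> (\<Oplus>\<^bsub>W\<^esub>g\<in>H y. Lambda_span2 A2 X2 X3 Y' F a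
      (push_incl (apex X2) A2 (tleg X2) (F \<circ>\<^sub>F sleg X2) a (omap (tleg Y) y)
        (Comp A2 (m g) (inv_arrow A2 (zeta_t Y y))) (amap F (zeta_s Y y) (u g)))))"
  proof (rule weighted_sum_cong[OF W, symmetric])
    fix y g assume y: "y \<in> R" and g: "g \<in> H y"
    note yO = RO(3)[OF y] and m' = m[OF y g] and u' = u[OF y g]
    have ty: "omap (tleg Y) y \<in> Obj (apex X2)" by (rule cat_functor.obj[OF fn(2) yO])
    \<comment> \<open>The components of \<open>Y\<close> are identities, so the intermediate
      generator is just \<open>m g \<otimes> u g\<close>, ready for the formula for
      \<open>Y'\<close>.\<close>
    have "Comp A2 (m g) (inv_arrow A2 (zeta_t Y y)) = m g"
      using strict(6)[OF yO] A2.inv_arrow_ident[OF cat_functor.obj[OF leg(4) ty]]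
        A2.comp_ident_right[OF m'] by simp
    moreover have "amap F (zeta_s Y y) (u g) = u g"
      using strict(5)[OF yO] modfD(3)[OF F cat_functor.obj[OF leg(3) ty]] u' by simp
    ultimately have eq: "Lambda_span2 A2 X2 X3 Y' F a
        (push_incl (apex X2) A2 (tleg X2) (F \<circ>\<^sub>F sleg X2) a (omap (tleg Y) y)
          (Comp A2 (m g) (inv_arrow A2 (zeta_t Y y))) (amap F (zeta_s Y y) (u g))) =
        (\<Oplus>\<^bsub>W\<^esub>z\<in>R'. ?d z \<odot>\<^bsub>W\<^esub> (\<Oplus>\<^bsub>W\<^esub>k\<in>K y z.
          push_incl (apex X3) A2 (tleg X3) (F \<circ>\<^sub>F sleg X3) a (omap (tleg Y') z)
            (Comp A2 (Comp A2 (m g) (amap (tleg X2) (inv_arrow (apex X2) k)))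
              (inv_arrow A2 (zeta_t Y' z)))
            (amap F (zeta_s Y' z) (amap (F \<circ>\<^sub>F sleg X2) k (u g)))))"
      using Lambda_span2_incl[OF A2 X2 X3 Y'(1) F R' ty m' u'] by (simp add: W_def K_def)
    also have "\<dots> = (\<Oplus>\<^bsub>W\<^esub>z\<in>R'. ?d z \<odot>\<^bsub>W\<^esub> (\<Oplus>\<^bsub>W\<^esub>k\<in>K y z. T y g z k))"
    proof (rule weighted_sum_cong[OF W T[OF y g]])
      fix z k assume z: "z \<in> R'" and kK: "k \<in> K y z"
      note zO = RO(4)[OF z]
      have k: "k \<in> homs (apex X2) (omap (tleg Y) y) (omap (sleg Y') z)" using kK by (simp add: K_def)
      have tz: "omap (tleg Y') z \<in> Obj (apex X3)" by (rule cat_functor.obj[OF fn(4) zO])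
      note tk = cat_functor.arr[OF leg(4) k]
      \<comment> \<open>Here \<open>k\<close> is a summation index of the right unit of
        \<open>Y'\<close>. The term agrees with \<open>T\<close> because the target leg preserves
        inverses and the components of \<open>Y'\<close> are identities.\<close>
      have "amap (tleg X2) (inv_arrow (apex X2) k) = inv_arrow A2 (amap (tleg X2) k)"
        by (rule cat_functor_inv[OF leg(4) gr(2) A2 k])
      moreover have "Comp A2 (Comp A2 (m g) (inv_arrow A2 (amap (tleg X2) k)))
          (inv_arrow A2 (zeta_t Y' z)) = Comp A2 (m g) (inv_arrow A2 (amap (tleg X2) k))"
        using strict'(6)[OF zO] strict'(3)[OF zO]
          A2.inv_arrow_ident[OF cat_functor.obj[OF leg(6) tz]]
          A2.comp_ident_right[OF A2.comp_hom[OF A2.inv_arrow(1)[OF tk] m']] by simp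
      moreover have "amap F (zeta_s Y' z) (amap (F \<circ>\<^sub>F sleg X2) k (u g)) = amap F (amap (sleg X2) k) (u g)"
        using strict'(5)[OF zO] strict'(1)[OF zO]
          modfD(3)[OF F cat_functor.obj[OF leg(5) tz]]
          modfD(5)[OF modf_comp[OF F leg(3)] k u'] by simp
      ultimately show "push_incl (apex X3) A2 (tleg X3) (F \<circ>\<^sub>F sleg X3) a (omap (tleg Y') z)
            (Comp A2 (Comp A2 (m g) (amap (tleg X2) (inv_arrow (apex X2) k)))
              (inv_arrow A2 (zeta_t Y' z)))
            (amap F (zeta_s Y' z) (amap (F \<circ>\<^sub>F sleg X2) k (u g))) = T y g z k"
        by (simp add: T_def)
    qed
    finally show "Lambda_span2 A2 X2 X3 Y' F a
        (push_incl (apex X2) A2 (tleg X2) (F \<circ>\<^sub>F sleg X2) a (omap (tleg Y) y)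
          (Comp A2 (m g) (inv_arrow A2 (zeta_t Y y))) (amap F (zeta_s Y y) (u g))) =
        (\<Oplus>\<^bsub>W\<^esub>z\<in>R'. ?d z \<odot>\<^bsub>W\<^esub> (\<Oplus>\<^bsub>W\<^esub>k\<in>K y z. T y g z k))" .
    interpret W: Module.module class_ring W by (rule W)
    show "(\<Oplus>\<^bsub>W\<^esub>z\<in>R'. ?d z \<odot>\<^bsub>W\<^esub> (\<Oplus>\<^bsub>W\<^esub>k\<in>K y z. T y g z k)) \<in> carrier W"
      using T[OF y g] by (intro W.M.finsum_closed Pi_I cvecD(3)[OF W]) auto
  qed
  also have "\<dots> = Lambda_span2 A2 X2 X3 Y' F a (Lambda_span2 A2 X1 X2 Y F a ?I)"
    unfolding Lambda_span2_incl[OF A2 X1 X2 Y(1) F R x h v] m_def u_def H_def W_def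
  proof (rule chom_weighted_sum[OF Lambda_span2_hom[OF A2 X2 X3 Y'(1) F], symmetric])
    fix y g assume y: "y \<in> R" and g: "g \<in> homs (apex X1) x (omap (sleg Y) y)"
    note yO = RO(3)[OF y]
    note zs = zeta_s_hom[OF Y(1) yO] zeta_t_hom[OF Y(1) yO]
    show "push_incl (apex X2) A2 (tleg X2) (F \<circ>\<^sub>F sleg X2) a (omap (tleg Y) y)
        (Comp A2 (Comp A2 h (amap (tleg X1) (inv_arrow (apex X1) g))) (inv_arrow A2 (zeta_t Y y)))
        (amap F (zeta_s Y y) (amap (F \<circ>\<^sub>F sleg X1) g v))
        \<in> carrier (push_obj (apex X2) A2 (tleg X2) (F \<circ>\<^sub>F sleg X2) a)"
      using A2.comp_hom[OF A2.inv_arrow(1)[OF zs(2)]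
          A2.comp_hom[OF cat_functor.arr[OF leg(2) groupoid.inv_arrow(1)[OF gr(1) g]] h]]
        modfD(5)[OF F zs(1)] modfD(5)[OF modf_comp[OF F leg(1)] g v]
      by (intro chomD(3)[OF push_incl_hom[OF leg(4) modf_comp[OF F leg(3)] cat_functor.obj[OF fn(2) yO]]])
        auto
  qed
  finally show ?thesis .
qed

theorem lemma6p1p3:
  fixes A1 :: "('a, 'am) category"
    and A2 :: "('b, 'bm) category"
    and X1 :: "('x1, 'xm1, 'a, 'am, 'b, 'bm) span"
    and X2 :: "('x2, 'xm2, 'a, 'am, 'b, 'bm) span"
    and X3 :: "('x3, 'xm3, 'a, 'am, 'b, 'bm) span"
    and Y :: "('y, 'ym, 'x1, 'xm1, 'x2, 'xm2, 'am, 'bm) span2"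
    and Y' :: "('z, 'zm, 'x2, 'xm2, 'x3, 'xm3, 'am, 'bm) span2"
  assumes "ess_finite_groupoid A1" and "ess_finite_groupoid A2"
    and "is_span A1 A2 X1" and "is_span A1 A2 X2" and "is_span A1 A2 X3"
    and "is_span2 A1 A2 X1 X2 Y" and "strictly_commuting A1 A2 X1 Y"
    and "is_span2 A1 A2 X2 X3 Y'" and "strictly_commuting A1 A2 X2 Y'"
  shows "\<forall>F :: ('a, 'am, 'v) vfunctor. vect_functor A1 F \<longrightarrow>
    (\<forall>a \<in> Obj A2. \<forall>v \<in> carrier (omap (Lambda_span A2 X1 F) a).
       Lambda_span2 A2 X1 X3 (vcomp X2 Y' Y) F a v =
         (Lambda_span2 A2 X2 X3 Y' F a \<circ> Lambda_span2 A2 X1 X2 Y F a) v)"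
proof (intro allI impI ballI)
  fix F :: "('a, 'am, 'v) vfunctor" and a v
  assume "vect_functor A1 F" and v: "v \<in> carrier (omap (Lambda_span A2 X1 F) a)"
  then have F: "modf A1 F" by (simp add: vect_functor_imp_modf)
  have A: "groupoid A1" "groupoid A2"
    using assms(1,2) by (simp_all add: ess_finite_groupoid_def)
  note X = assms(3-5)[THEN is_span_imp_finitary]
  note Y = is_span2_imp_finitary[OF assms(6)] assms(7)
  note Y' = is_span2_imp_finitary[OF assms(8)] assms(9)
  have t1: "cat_functor (apex X1) A1 (sleg X1)" "cat_functor (apex X1) A2 (tleg X1)"
    using X(1) by (simp_all add: finitary_span_def)
  show "Lambda_span2 A2 X1 X3 (vcomp X2 Y' Y) F a v =
      (Lambda_span2 A2 X2 X3 Y' F a \<circ> Lambda_span2 A2 X1 X2 Y F a) v"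
    \<comment> \<open>Both sides are linear on the pushforward, so agreement on its generators
      suffices.\<close>
    using Lambda_span2_hom[OF A(2) X(1,3) finitary_span2_vcomp[OF A X Y Y'] F]
      chom_comp[OF Lambda_span2_hom[OF A(2) X(2,3) Y'(1) F] Lambda_span2_hom[OF A(2) X(1,2) Y(1) F]]
      _ v[unfolded Lambda_span_def omap_push]
  proof (rule push_hom_eqI[OF t1(2) modf_comp[OF F t1(1)]])
    fix x h w assume "x \<in> Obj (apex X1)" "h \<in> homs A2 (omap (tleg X1) x) a"
      "w \<in> carrier (omap (F \<circ>\<^sub>F sleg X1) x)"
    then show "Lambda_span2 A2 X1 X3 (vcomp X2 Y' Y) F a
          (push_incl (apex X1) A2 (tleg X1) (F \<circ>\<^sub>F sleg X1) a x h w) =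
        (Lambda_span2 A2 X2 X3 Y' F a \<circ> Lambda_span2 A2 X1 X2 Y F a)
          (push_incl (apex X1) A2 (tleg X1) (F \<circ>\<^sub>F sleg X1) a x h w)"
      by (simp add: Lambda_span2_vcomp_incl[OF A X Y Y' F])
  qed
qed

end
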